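(* Let $(X_n)_{n\ge 1}$ be the unbalanced step-reinforced random walk with parameters $p\in[0,1]$ and $\alpha\in(0,1]$ built from the i.i.d. real random variables $(\xi_n)_{n\ge1}$, let $T_n=\sum_{k=1}^n X_k$ and $a=(2p-1)\alpha$. Assume that $\mathbb E[\xi_1^2]<+\infty$, put $\mu_1=\mathbb E[\xi_1]$, $\mu_2=\mathbb E[\xi_1^2]$, and, for $a<1$, $\sigma^2=\mu_2-\frac{(1-\alpha)^2\mu_1^2}{(1-a)^2}$. The following convergences in law hold as $n\to+\infty$. (i) If $-1\le a<1/2$, then $\sqrt n\left(\frac{T_n}{n}-\frac{(1-\alpha)\mu_1}{1-a}\right)\to\mathcal N\left(0,\frac{\sigma^2}{1-2a}\right)$ in law. (ii) If $a=1/2$, then $\frac{\sqrt n}{\sqrt{\log n}}\left(\frac{T_n}{n}-2(1-\alpha)\mu_1\right)\to\mathcal N\left(0,\mu_2-4\mu_1^2(1-\alpha)^2\right)$ in law. (iii) If $1/2<a<1$, then $$\sqrt{n^{2a-1}}\left(n^{1-a}\left(\frac{T_n}{n}-\frac{(1-\alpha)\mu_1}{1-a}\right)-L\right)\to\mathcal N\left(0,\frac{\sigma^2}{2a-1}\right)\quad\text{in law},$$ where $L$ is the almost sure limit of $n^{1-a}\left(\frac{T_n}{n}-\frac{(1-\alpha)\mu_1}{1-a}\right)$ as $n\to+\infty$ (this limit exists almost surely and is square-integrable when $1/2<a<1$).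
   Context: $\mathcal N(0,v)$ is the centered normal law with variance $v$, and $\mathcal N(0,0)$ is the Dirac mass at $0$. Unbalanced step-reinforced random walk with parameters $(p,\alpha)$: let $(\xi_n)_{n\ge1}$ be i.i.d. real random variables, let $(U_n)_{n\ge1}$ be independent with $U_n$ uniform on $\{1,\dots,n\}$, let $(\gamma_n)_{n\ge1}$ be i.i.d. with $\mathbb P(\gamma_n=1)=\alpha=1-\mathbb P(\gamma_n=0)$, and let $(\rho_n)_{n\ge1}$ be i.i.d. with $\mathbb P(\rho_n=1)=p=1-\mathbb P(\rho_n=-1)$; the four sequences are mutually independent. The steps are $X_1=\xi_1$ and, for $n\ge1$, $X_{n+1}=\gamma_n\rho_nX_{U_n}+(1-\gamma_n)\xi_{n+1}$; that is, $X_{n+1}$ equals $X_{U_n}$ with probability $p\alpha$, $-X_{U_n}$ with probability $(1-p)\alpha$, and $\xi_{n+1}$ with probability $1-\alpha$.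
   Formalization: For α = 1 it is additionally assumed that |ξ_1| is almost surely constant; without this the claim fails (e.g. α = 1, p < 1, ξ_1 uniform on {0,1}: T_n has an atom of mass at least 1/2 at 0, while the stated normal limit has none). *)

theory Defs
  imports "HOL-Probability.Probability"
begin

text \<open>
  The law $N(0,v)$ for $v \geq 0$. The case split is needed because
  \<^const>\<open>normal_density\<close> with standard deviation 0 is the zero function, not a Dirac mass.
\<close>

definition centered_normal :: "real \<Rightarrow> real measure" where
  "centered_normal v =
     (if v = 0 then return borel 0 else density lborel (normal_density 0 (sqrt v)))"

text \<open>
  All sequences are indexed from 1; their values at index 0 are unconstrained. The assumption
  \<open>indep\<close> says that the whole family of variables \<open>\<xi> n, U n, \<gamma> n, \<rho> n\<close>, for \<open>n \<ge> 1\<close>, is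
  independent: each sequence consists of independent variables, and the four sequences are mutually
  independent. The pair \<open>(k, n)\<close> selects the \<open>n\<close>-th entry of the \<open>k\<close>-th sequence, and \<open>U n\<close> is
  embedded into the reals only to give the family a common codomain.
\<close>

locale step_reinforced_walk = prob_space M for M :: "'a measure" +
  fixes \<xi> :: "nat \<Rightarrow> 'a \<Rightarrow> real"
    and U :: "nat \<Rightarrow> 'a \<Rightarrow> nat"
    and \<gamma> \<rho> :: "nat \<Rightarrow> 'a \<Rightarrow> real"
    and p \<alpha> :: real
    and X :: "nat \<Rightarrow> 'a \<Rightarrow> real"
  assumes p_range: "0 \<le> p" "p \<le> 1"
    and alpha_range: "0 < \<alpha>" "\<alpha> \<le> 1"
    and indep: "indep_vars (\<lambda>_. borel)
          (\<lambda>(k, n) \<omega>. [\<xi> n \<omega>, real (U n \<omega>), \<gamma> n \<omega>, \<rho> n \<omega>] ! k) ({..<4::nat} \<times> {1..})"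
    and xi_distr: "\<And>n. n \<ge> 1 \<Longrightarrow> distr M borel (\<xi> n) = distr M borel (\<xi> 1)"
    and U_measurable: "\<And>n. n \<ge> 1 \<Longrightarrow> U n \<in> M \<rightarrow>\<^sub>M count_space {1..n}"
    and U_distr: "\<And>n. n \<ge> 1 \<Longrightarrow>
          distr M (count_space {1..n}) (U n) = uniform_count_measure {1..n}"
    and gamma_distr:
      "\<And>n. n \<ge> 1 \<Longrightarrow> prob {\<omega> \<in> space M. \<gamma> n \<omega> = 1} = \<alpha>"
      "\<And>n. n \<ge> 1 \<Longrightarrow> prob {\<omega> \<in> space M. \<gamma> n \<omega> = 0} = 1 - \<alpha>"
    and rho_distr:
      "\<And>n. n \<ge> 1 \<Longrightarrow> prob {\<omega> \<in> space M. \<rho> n \<omega> = 1} = p"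
      "\<And>n. n \<ge> 1 \<Longrightarrow> prob {\<omega> \<in> space M. \<rho> n \<omega> = -1} = 1 - p"
    and X_1: "\<And>\<omega>. \<omega> \<in> space M \<Longrightarrow> X 1 \<omega> = \<xi> 1 \<omega>"
    and X_Suc: "\<And>n \<omega>. n \<ge> 1 \<Longrightarrow> \<omega> \<in> space M \<Longrightarrow>
          X (n + 1) \<omega> = \<gamma> n \<omega> * \<rho> n \<omega> * X (U n \<omega>) \<omega> + (1 - \<gamma> n \<omega>) * \<xi> (n + 1) \<omega>"

end

theory Submission
  imports Defs "HOL-Real_Asymp.Real_Asymp"
begin

text \<open>
  Put \<open>c = (1 - \<alpha>) \<mu>1 / (1 - a)\<close> and \<open>Q n = T n - n c\<close>. Then \<open>Q (n + 1) = (1 + a / n) Q n\<close> plus a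
  martingale difference, whose conditional variance converges to \<open>\<sigma>2\<close> in the mean; for this one needs
  a weak law of large numbers for the squared steps, which form a reinforced sequence without signs.
  No martingale central limit theorem is needed: a second order expansion gives, for bounded \<open>G\<close>
  depending on the first \<open>n\<close> steps,
  \<open>E[G exp(i s Q (n + 1))] = E[G exp(i s (1 + a / n) Q n)] exp(- s^2 \<sigma>2 / 2) + o(s^2)\<close>
  as \<open>n\<close> tends to infinity and \<open>s\<close> to 0, uniformly in \<open>G\<close>. With \<open>q n = (1 + a / 2) ... (1 + a / (n - 1))\<close>,
  which is asymptotic to a multiple of \<open>n powr a\<close>, this is iterated along \<open>s = \<tau> / q k\<close>. The total error
  is small compared to the deterministic sum of the \<open>(\<tau> / q k)^2\<close>, so the limit of this sum gives the
  variance of the limit law by Levy's continuity theorem.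
  For \<open>a > 1 / 2\<close> the martingale \<open>Q n / q n\<close> is bounded in mean square and converges by Kolmogorov's
  maximal inequality; its fluctuations around the limit come from the same iteration, started at
  time \<open>n\<close> with \<open>G = exp(- i \<tau> Q n / q n)\<close>.
\<close>

section \<open>The filtration of the walk and independence\<close>

text \<open>With only two moments, the conditional variance is controlled in mean and not pointwise.
  Bounded test functions make this sufficient: \<open>G exp(i s Q n)\<close> has modulus at most 1,
  so errors that are small in mean stay small under the expectation. No conditional expectation is
  formed; the identity \<open>E[G f (X (n + 1))] = E[G step_mean f n]\<close> takes its place. The
  squared steps are integrable but need not be square-integrable, so their law of large numbers is
  first obtained in mean square for bounded even functions and then extended by truncation. The
  drift coefficient of even functions is \<alpha>, and the mean square argument requires it to be
  below 1; for \<alpha> = 1 the squared steps are almost surely one constant. The scaling by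
  \<open>q\<close> comes from \<open>(1 + a / k) / q (k + 1) = 1 / q k\<close>: going back one step
  turns the argument \<open>\<tau> / q (k + 1)\<close> into \<open>\<tau> / q k\<close>. Every
  Gaussian factor met on the way is at most 1, so errors add up without amplification.\<close>

context step_reinforced_walk
begin

definition driver :: "nat \<times> nat \<Rightarrow> 'a \<Rightarrow> real" where
  "driver = (\<lambda>(k, n) w. [\<xi> n w, real (U n w), \<gamma> n w, \<rho> n w] ! k)"

text \<open>The shape is that of the set systems in \<open>indep_vars_def2\<close>, and each of
  these systems is stable under intersection, as the grouping of independent families
  requires.\<close>

definition driver_events :: "nat \<times> nat \<Rightarrow> 'a set set" where
  "driver_events i = {driver i -` A \<inter> space M | A. A \<in> sets borel}"

text \<open>The indices of the variables that determine the first \<open>n\<close> steps.\<close>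

definition past :: "nat \<Rightarrow> (nat \<times> nat) set" where
  "past n = {0} \<times> {1..n} \<union> {1..<4} \<times> {1..<n}"

text \<open>\<open>past n\<close> leaves out index \<open>n\<close> of \<open>U\<close>,
  \<open>\<gamma>\<close> and \<open>\<rho>\<close>, which drive step \<open>n + 1\<close>. This
  \<sigma>-algebra is in general larger than the one generated by the first \<open>n\<close> steps,
  since it also records the copying choices and the innovations that were discarded.\<close>

definition F :: "nat \<Rightarrow> 'a measure" where
  "F n = sigma (space M) (\<Union>i\<in>past n. driver_events i)"

lemma driver_simps:
  "driver (0, n) w = \<xi> n w" "driver (Suc 0, n) w = real (U n w)" "driver (1, n) w = real (U n w)"
  "driver (2, n) w = \<gamma> n w" "driver (3, n) w = \<rho> n w"
  by (auto simp: driver_def)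

lemma indep_driver: "indep_vars (\<lambda>_. borel) driver ({..<4} \<times> {1..})"
  using indep by (simp add: driver_def)

lemma driver_measurable: "k < 4 \<Longrightarrow> n \<ge> 1 \<Longrightarrow> driver (k, n) \<in> borel_measurable M"
  using indep_driver unfolding indep_vars_def by auto

lemma xi_measurable: "n \<ge> 1 \<Longrightarrow> \<xi> n \<in> borel_measurable M"
  and gamma_measurable: "n \<ge> 1 \<Longrightarrow> \<gamma> n \<in> borel_measurable M"
  and rho_measurable: "n \<ge> 1 \<Longrightarrow> \<rho> n \<in> borel_measurable M"
  using driver_measurable[of 0 n] driver_measurable[of 2 n] driver_measurable[of 3 n]
  by (simp_all add: driver_simps[abs_def])

lemma U_space: "n \<ge> 1 \<Longrightarrow> w \<in> space M \<Longrightarrow> U n w \<in> {1..n}"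
  using measurable_space[OF U_measurable] by auto

lemma driver_events_subset: "k < 4 \<Longrightarrow> n \<ge> 1 \<Longrightarrow> driver_events (k, n) \<subseteq> sets M"
  using driver_measurable by (auto simp: driver_events_def)

lemma space_F [simp]: "space (F n) = space M"
  by (simp add: F_def space_measure_of_conv)

lemma sets_F: "sets (F n) = sigma_sets (space M) (\<Union>i\<in>past n. driver_events i)"
  unfolding F_def by (rule sets_measure_of) (auto simp: driver_events_def)

lemma past_mono: "m \<le> n \<Longrightarrow> past m \<subseteq> past n"
  by (auto simp: past_def)

lemma sets_F_subset: "sets (F n) \<subseteq> sets M"
  unfolding sets_F
  by (rule sets.sigma_sets_subset) (use driver_events_subset in \<open>fastforce simp: past_def\<close>)

lemma sets_F_mono: "m \<le> n \<Longrightarrow> sets (F m) \<subseteq> sets (F n)"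
  unfolding sets_F using past_mono by (intro sigma_sets_mono') blast

lemma measurable_F_M: "G \<in> measurable (F n) N \<Longrightarrow> G \<in> measurable M N"
  using sets_F_subset unfolding measurable_def by auto

lemma measurable_F_mono: "G \<in> measurable (F m) N \<Longrightarrow> m \<le> n \<Longrightarrow> G \<in> measurable (F n) N"
  using sets_F_mono[of m n] unfolding measurable_def by auto

lemma driver_measurable_F: "i \<in> past n \<Longrightarrow> driver i \<in> borel_measurable (F n)"
  unfolding measurable_def sets_F
  by (auto simp: driver_events_def intro!: sigma_sets.Basic)

lemma X_measurable_F: "1 \<le> k \<Longrightarrow> k \<le> n \<Longrightarrow> X k \<in> borel_measurable (F n)"
proof (induction k arbitrary: n rule: less_induct)
  case (less k)
  show ?case
  proof (cases "k = 1")
    case True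
    have "\<xi> 1 \<in> borel_measurable (F n)"
      using driver_measurable_F[of "(0, 1)" n] less.prems
      by (auto simp: past_def driver_simps[abs_def])
    then show ?thesis
      using X_1 True by (subst measurable_cong[where g = "\<xi> 1"]) auto
  next
    case False
    define m where "m = k - 1"
    have m: "1 \<le> m" "k = m + 1" "m < n" using False less.prems by (auto simp: m_def)
    have [measurable]: "\<gamma> m \<in> borel_measurable (F n)" "\<rho> m \<in> borel_measurable (F n)"
      "(\<lambda>w. real (U m w)) \<in> borel_measurable (F n)" "\<xi> (m + 1) \<in> borel_measurable (F n)"
      using driver_measurable_F[of "(2, m)" n] driver_measurable_F[of "(3, m)" n]
        driver_measurable_F[of "(1, m)" n] driver_measurable_F[of "(0, m + 1)" n] m
      by (auto simp: past_def driver_simps[abs_def])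
    have [measurable]: "\<And>j. j \<in> {1..m} \<Longrightarrow> X j \<in> borel_measurable (F n)"
      using less.IH m by auto
    \<comment> \<open>The random index \<open>U m\<close> is replaced by a finite sum over its
      possible values, so that measurability of each earlier step is enough.\<close>
    have "X k w = \<gamma> m w * \<rho> m w * (\<Sum>j\<in>{1..m}. indicator {real j} (real (U m w)) * X j w)
        + (1 - \<gamma> m w) * \<xi> (m + 1) w" if "w \<in> space M" for w
    proof -
      have "(\<Sum>j\<in>{1..m}. indicator {real j} (real (U m w)) * X j w)
          = (\<Sum>j\<in>{1..m}. if j = U m w then X j w else 0)"
        by (intro sum.cong) (auto simp: indicator_def)
      also have "\<dots> = X (U m w) w"
        using U_space[OF m(1) that] by (subst sum.delta) auto
      finally show ?thesis using X_Suc[OF m(1) that] m by simp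
    qed
    moreover have "(\<lambda>w. \<gamma> m w * \<rho> m w * (\<Sum>j\<in>{1..m}. indicator {real j} (real (U m w)) * X j w)
        + (1 - \<gamma> m w) * \<xi> (m + 1) w) \<in> borel_measurable (F n)"
      by measurable
    ultimately show ?thesis
      by (metis (no_types, lifting) measurable_cong space_F)
  qed
qed

lemma X_measurable: "1 \<le> k \<Longrightarrow> X k \<in> borel_measurable M"
  using X_measurable_F[of k k] measurable_F_M by auto

lemma prob_U: "n \<ge> 1 \<Longrightarrow> j \<in> {1..n} \<Longrightarrow> prob {w \<in> space M. U n w = j} = 1 / n"
proof -
  assume n: "n \<ge> 1" and j: "j \<in> {1..n}"
  have "prob {w \<in> space M. U n w = j} = measure (distr M (count_space {1..n}) (U n)) {j}"
    using j by (subst measure_distr[OF U_measurable[OF n]]) (auto intro!: arg_cong[where f = prob])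
  also have "\<dots> = 1 / n"
    unfolding U_distr[OF n] using j n by (subst measure_uniform_count_measure) auto
  finally show ?thesis .
qed

text \<open>The locale prescribes only the masses of two atoms; since they add up to 1, no other
  value has positive probability.\<close>

lemma AE_gamma: "n \<ge> 1 \<Longrightarrow> AE w in M. \<gamma> n w = 1 \<or> \<gamma> n w = 0"
proof -
  assume n: "n \<ge> 1"
  note [measurable] = gamma_measurable[OF n]
  have "prob {w \<in> space M. \<gamma> n w = 1 \<or> \<gamma> n w = 0}
      = prob ({w \<in> space M. \<gamma> n w = 1} \<union> {w \<in> space M. \<gamma> n w = 0})"
    by (intro arg_cong[where f = prob]) auto
  also have "\<dots> = 1"
    using gamma_distr[OF n] by (subst finite_measure_Union) auto
  finally show ?thesis by (subst (asm) prob_Collect_eq_1) auto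
qed

lemma AE_rho: "n \<ge> 1 \<Longrightarrow> AE w in M. \<rho> n w = 1 \<or> \<rho> n w = -1"
proof -
  assume n: "n \<ge> 1"
  note [measurable] = rho_measurable[OF n]
  have "prob {w \<in> space M. \<rho> n w = 1 \<or> \<rho> n w = -1}
      = prob ({w \<in> space M. \<rho> n w = 1} \<union> {w \<in> space M. \<rho> n w = -1})"
    by (intro arg_cong[where f = prob]) auto
  also have "\<dots> = 1"
    using rho_distr[OF n] by (subst finite_measure_Union) auto
  finally show ?thesis by (subst (asm) prob_Collect_eq_1) auto
qed

text \<open>Disjoint blocks of an independent family generate independent \<sigma>-algebras. Block 0
  is the past, and each of the four variables that create step \<open>n + 1\<close> forms a block of
  its own. The maps \<open>\<phi>\<close> bring all blocks into the type of \<open>G\<close>,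
  because the product formula for expectations works in a single codomain.\<close>

lemma indep_past_fresh:
  fixes G :: "'a \<Rightarrow> 'b::{real_normed_field, banach, second_countable_topology}"
    and \<phi> :: "nat \<Rightarrow> real \<Rightarrow> 'b"
  assumes n: "n \<ge> 1" and G: "G \<in> borel_measurable (F n)"
    and [measurable]: "\<And>k. k < 4 \<Longrightarrow> \<phi> k \<in> borel_measurable (borel :: real measure)"
  shows "indep_vars (\<lambda>_. borel) (\<lambda>j. case j of 0 \<Rightarrow> G
      | Suc k \<Rightarrow> (\<lambda>w. \<phi> k (driver (k, if k = 0 then n + 1 else n) w))) {..<5}"
    (is "indep_vars _ ?Y _")
proof -
  \<comment> \<open>The innovation used by step \<open>n + 1\<close> has index \<open>n + 1\<close>,
    the other three variables have index \<open>n\<close>.\<close>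
  define B where "B j = (case j of 0 \<Rightarrow> past n | Suc k \<Rightarrow> {(k, if k = 0 then n + 1 else n)})" for j
  have "indep_sets driver_events ({..<4} \<times> {1..})"
    using indep_driver unfolding indep_vars_def2 driver_events_def by simp
  then have "indep_sets driver_events (\<Union>j\<in>{..<5}. B j)"
    by (rule indep_sets_mono_index[rotated])
       (use n in \<open>auto simp: B_def past_def split: nat.splits if_splits\<close>)
  moreover have "disjoint_family_on B {..<5}"
    unfolding disjoint_family_on_def B_def past_def by (auto split: nat.splits if_splits)
  moreover have "Int_stable (driver_events i)" for i
    unfolding Int_stable_def driver_events_def
  proof safe
    fix A A' :: "real set" assume "A \<in> sets borel" "A' \<in> sets borel"
    then show "\<exists>C. driver i -` A \<inter> space M \<inter> (driver i -` A' \<inter> space M) = driver i -` C \<inter> space M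
        \<and> C \<in> sets borel"
      by (intro exI[of _ "A \<inter> A'"]) auto
  qed
  ultimately have *: "indep_sets (\<lambda>j. sigma_sets (space M) (\<Union>i\<in>B j. driver_events i)) {..<5}"
    by (intro indep_sets_collect_sigma) auto
  show ?thesis
    unfolding indep_vars_def2
  proof (intro conjI ballI)
    fix j :: nat assume "j \<in> {..<5}"
    then show "?Y j \<in> borel_measurable M"
      using measurable_F_M[OF G] n
      by (auto split: nat.splits
            intro!: measurable_compose[OF driver_measurable] assms(3))
  next
    show "indep_sets (\<lambda>i. {?Y i -` A \<inter> space M |A. A \<in> sets borel}) {..<5}"
    proof (rule indep_sets_mono_sets[OF *])
      fix j :: nat assume j: "j \<in> {..<5}"
      show "{?Y j -` A \<inter> space M |A. A \<in> sets borel}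
          \<subseteq> sigma_sets (space M) (\<Union>i\<in>B j. driver_events i)"
      proof (cases j)
        case 0
        then show ?thesis using measurable_sets[OF G] by (auto simp: B_def sets_F)
      next
        case (Suc k)
        then have k: "k < 4" using j by auto
        have "\<phi> k -` A \<in> sets borel" if "A \<in> sets borel" for A
          using measurable_sets[OF assms(3)[OF k] that] by simp
        then show ?thesis
          unfolding Suc B_def driver_events_def
          by (auto intro!: sigma_sets.Basic simp: vimage_def)
      qed
    qed
  qed
qed

lemma expectation_past_fresh:
  fixes G :: "'a \<Rightarrow> 'b::{real_normed_field, banach, second_countable_topology}"
    and a b c d :: "real \<Rightarrow> 'b"
  assumes n: "n \<ge> 1" and G: "G \<in> borel_measurable (F n)" "integrable M G"
    and meas: "a \<in> borel_measurable borel" "b \<in> borel_measurable borel"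
      "c \<in> borel_measurable borel" "d \<in> borel_measurable borel"
    and int: "integrable M (\<lambda>w. a (\<xi> (n + 1) w))" "integrable M (\<lambda>w. b (real (U n w)))"
      "integrable M (\<lambda>w. c (\<gamma> n w))" "integrable M (\<lambda>w. d (\<rho> n w))"
  defines "H \<equiv> \<lambda>w. G w * a (\<xi> (n + 1) w) * b (real (U n w)) * c (\<gamma> n w) * d (\<rho> n w)"
  shows "integrable M H"
    and "expectation H = expectation G * (\<integral>w. a (\<xi> (n + 1) w) \<partial>M)
      * (\<integral>w. b (real (U n w)) \<partial>M) * (\<integral>w. c (\<gamma> n w) \<partial>M) * (\<integral>w. d (\<rho> n w) \<partial>M)" (is ?eq)
proof -
  define \<phi> where "\<phi> k = [a, b, c, d] ! k" for k
  have \<phi>: "k < 4 \<Longrightarrow> \<phi> k \<in> borel_measurable borel" for k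
    using meas by (auto simp: \<phi>_def numeral_eq_Suc less_Suc_eq)
  define Y where "Y = (\<lambda>j. case j of 0 \<Rightarrow> G
      | Suc k \<Rightarrow> (\<lambda>w. \<phi> k (driver (k, if k = 0 then n + 1 else n) w)))"
  have ind: "indep_vars (\<lambda>_. borel) Y {..<5}"
    unfolding Y_def using n G(1) \<phi> by (rule indep_past_fresh)
  have Y: "Y 0 = G" "Y 1 = (\<lambda>w. a (\<xi> (n + 1) w))" "Y 2 = (\<lambda>w. b (real (U n w)))"
    "Y 3 = (\<lambda>w. c (\<gamma> n w))" "Y 4 = (\<lambda>w. d (\<rho> n w))"
    by (auto simp: Y_def \<phi>_def driver_def numeral_eq_Suc)
  have five: "{..<5} = {0, 1, 2, 3, 4::nat}" by auto
  have "integrable M (Y i)" if "i \<in> {..<5}" for i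
    using that int G(2) unfolding five by (auto simp: Y[simplified])
  note * = indep_vars_lebesgue_integral[OF _ ind this] indep_vars_integrable[OF _ ind this]
  show "integrable M H" 
    using *(2) unfolding five H_def by (simp add: Y[simplified] mult.assoc)
  show ?eq
    using *(1) unfolding five H_def by (simp add: Y[simplified] mult.assoc)
qed

end

section \<open>Expectations of functions of the next step\<close>

context step_reinforced_walk
begin

lemma integrable_xi_shift:
  fixes f :: "real \<Rightarrow> 'b::{banach, second_countable_topology}"
  assumes "n \<ge> 1" and [measurable]: "f \<in> borel_measurable borel"
  shows "integrable M (\<lambda>w. f (\<xi> n w)) \<longleftrightarrow> integrable M (\<lambda>w. f (\<xi> 1 w))" (is ?int)
    and "(\<integral>w. f (\<xi> n w) \<partial>M) = (\<integral>w. f (\<xi> 1 w) \<partial>M)" (is ?eq)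
proof -
  note [measurable] = xi_measurable[of n] xi_measurable[of "Suc 0"]
  have "integrable M (\<lambda>w. f (\<xi> n w)) \<longleftrightarrow> integrable (distr M borel (\<xi> n)) f"
    using assms by (subst integrable_distr_eq) auto
  also have "\<dots> \<longleftrightarrow> integrable M (\<lambda>w. f (\<xi> 1 w))"
    unfolding xi_distr[OF assms(1)] by (subst integrable_distr_eq) auto
  finally show ?int .
  have "(\<integral>w. f (\<xi> n w) \<partial>M) = integral\<^sup>L (distr M borel (\<xi> n)) f"
    using assms by (subst integral_distr) auto
  also have "\<dots> = (\<integral>w. f (\<xi> 1 w) \<partial>M)"
    unfolding xi_distr[OF assms(1)] by (subst integral_distr) auto
  finally show ?eq .
qed

text \<open>With \<open>of_real\<close>, the same indicator serves real and complex test
  functions.\<close>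

lemma expectation_atom:
  fixes x :: real
  assumes [measurable]: "Y \<in> borel_measurable M"
  shows "integrable M (\<lambda>w. of_real (indicator {x} (Y w)) :: 'b::{real_normed_field, banach, second_countable_topology})" (is ?int)
    and "(\<integral>w. of_real (indicator {x} (Y w)) \<partial>M) =
      (of_real (prob {w \<in> space M. Y w = x}) :: 'b)" (is ?eq)
proof -
  have eq: "indicator {x} (Y w) = (indicator {w \<in> space M. Y w = x} w :: real)" if "w \<in> space M" for w
    using that by (auto simp: indicator_def)
  have "integrable M (\<lambda>w. indicator {x} (Y w) :: real)"
    by (rule integrable_const_bound[of _ 1]) (auto simp: indicator_def)
  note int = this
  then show "integrable M (\<lambda>w. of_real (indicator {x} (Y w)) :: 'b)"
    by (rule integrable_of_real)
  have "(\<integral>w. indicator {x} (Y w) \<partial>M) = (\<integral>w. indicator {w \<in> space M. Y w = x} w \<partial>M :: real)"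
    by (intro Bochner_Integration.integral_cong refl eq)
  also have "\<dots> = prob {w \<in> space M. Y w = x}"
    by (subst Bochner_Integration.integral_indicator) (auto intro!: arg_cong[where f = prob])
  finally show ?eq
    using int by (simp add: integral_of_real)
qed

text \<open>This is the conditional law of step \<open>n + 1\<close> given \<open>F n\<close>, in
  integrated form. The expectation is split according to the copied index, the decision to copy and
  the sign; each piece factorises by independence.\<close>

lemma expectation_step:
  fixes G :: "'a \<Rightarrow> 'b::{real_normed_field, banach, second_countable_topology}" and f :: "real \<Rightarrow> 'b"
  assumes n: "n \<ge> 1" and G: "G \<in> borel_measurable (F n)" "integrable M G"
    and f: "f \<in> borel_measurable borel" "integrable M (\<lambda>w. f (\<xi> 1 w))"
    and pos: "\<And>j. j \<in> {1..n} \<Longrightarrow> integrable M (\<lambda>w. G w * f (X j w))"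
    and neg: "\<And>j. j \<in> {1..n} \<Longrightarrow> integrable M (\<lambda>w. G w * f (- X j w))"
  shows "integrable M (\<lambda>w. G w * f (X (n + 1) w))" (is ?int)
    and "(\<integral>w. G w * f (X (n + 1) w) \<partial>M) =
      (\<Sum>j=1..n. of_real (\<alpha> * p) * (\<integral>w. G w * f (X j w) \<partial>M)
        + of_real (\<alpha> * (1 - p)) * (\<integral>w. G w * f (- X j w) \<partial>M)) / of_nat n
      + of_real (1 - \<alpha>) * expectation G * (\<integral>w. f (\<xi> 1 w) \<partial>M)" (is ?eq)
proof -
  let ?i = "\<lambda>x y. of_real (indicator {x::real} y) :: 'b"
  define A where "A = (\<lambda>s r j w. (G w * f (s * X j w)) * 1 * ?i (real j) (real (U n w))
    * ?i 1 (\<gamma> n w) * ?i r (\<rho> n w))"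
  define C where "C = (\<lambda>w. G w * f (\<xi> (n + 1) w) * 1 * ?i 0 (\<gamma> n w) * 1)"
  have rU: "(\<lambda>w. real (U n w)) \<in> borel_measurable M"
    using driver_measurable[of 1 n] n by (simp add: driver_simps[abs_def])
  note atoms = expectation_atom[OF rU] expectation_atom[OF gamma_measurable[OF n]]
    expectation_atom[OF rho_measurable[OF n]]
  have GX: "(\<lambda>w. G w * f (s * X j w)) \<in> borel_measurable (F n)" if "j \<in> {1..n}" for s j
    using that by (intro borel_measurable_times G(1) measurable_compose[OF _ f(1)]
        borel_measurable_const X_measurable_F) auto
  have A: "integrable M (A s r j)" 
      "expectation (A s r j) = (\<integral>w. G w * f (s * X j w) \<partial>M) * of_real (1 / n) * of_real \<alpha>
        * of_real (prob {w \<in> space M. \<rho> n w = r})"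
    if "j \<in> {1..n}" "integrable M (\<lambda>w. G w * f (s * X j w))" for s r j
  proof -
    note fresh = expectation_past_fresh[OF n GX[OF that(1)] that(2),
        of "\<lambda>_. 1" "?i (real j)" "?i 1" "?i r"]
    have *: "integrable M (\<lambda>w. 1 :: 'b)" by simp
    show "integrable M (A s r j)"
      unfolding A_def by (rule fresh(1); (rule * atoms)?) measurable
    have "expectation (A s r j) = (\<integral>w. G w * f (s * X j w) \<partial>M) * (\<integral>w. 1 \<partial>M)
      * (\<integral>w. ?i (real j) (real (U n w)) \<partial>M) * (\<integral>w. ?i 1 (\<gamma> n w) \<partial>M) * (\<integral>w. ?i r (\<rho> n w) \<partial>M)"
      unfolding A_def by (rule fresh(2); (rule * atoms)?) measurable
    then show "expectation (A s r j) = (\<integral>w. G w * f (s * X j w) \<partial>M) * of_real (1 / n)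
        * of_real \<alpha> * of_real (prob {w \<in> space M. \<rho> n w = r})"
      unfolding atoms by (simp add: prob_U[OF n that(1)] gamma_distr[OF n] prob_space)
  qed
  have C: "integrable M C" 
     "expectation C = of_real (1 - \<alpha>) * expectation G * (\<integral>w. f (\<xi> 1 w) \<partial>M)"
  proof -
    note fresh = expectation_past_fresh[OF n G, of f "\<lambda>_. 1" "?i 0" "\<lambda>_. 1"]
    have *: "integrable M (\<lambda>w. 1 :: 'b)" "integrable M (\<lambda>w. f (\<xi> (n + 1) w))"
      using integrable_xi_shift(1)[OF _ f(1), of "n + 1"] f(2) by simp_all
    show "integrable M C"
      unfolding C_def by (rule fresh(1); (rule * atoms f)?) measurable
    have "expectation C = expectation G * (\<integral>w. f (\<xi> (n + 1) w) \<partial>M) * (\<integral>w. 1 \<partial>M)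
        * (\<integral>w. ?i 0 (\<gamma> n w) \<partial>M) * (\<integral>w. 1 \<partial>M)"
      unfolding C_def by (rule fresh(2); (rule * atoms f)?) measurable
    then show "expectation C = of_real (1 - \<alpha>) * expectation G * (\<integral>w. f (\<xi> 1 w) \<partial>M)"
      unfolding atoms integrable_xi_shift(2)[OF le_add2 f(1)]
      by (simp add: gamma_distr[OF n] prob_space)
  qed
  have Aint: "integrable M (A 1 1 j)" "integrable M (A (-1) (-1) j)" if "j \<in> {1..n}" for j
    using A(1)[OF that] pos[OF that] neg[OF that] by auto
  let ?R = "\<lambda>w. (\<Sum>j=1..n. A 1 1 j w + A (-1) (-1) j w) + C w"
  \<comment> \<open>The decomposition is only almost sure, because \<open>\<gamma> n\<close> and
    \<open>\<rho> n\<close> may take other values on a null set.\<close>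
  have ae: "AE w in M. G w * f (X (n + 1) w) = ?R w"
    using AE_gamma[OF n] AE_rho[OF n] AE_space
  proof eventually_elim
    case (elim w)
    have "(\<Sum>j=1..n. A 1 1 j w + A (-1) (-1) j w)
        = (\<Sum>j=1..n. if j = U n w then ?i 1 (\<gamma> n w) * (G w * f (X j w) * ?i 1 (\<rho> n w)
            + G w * f (- X j w) * ?i (-1) (\<rho> n w)) else 0)"
      by (intro sum.cong) (auto simp: A_def indicator_def)
    also have "\<dots> = ?i 1 (\<gamma> n w) * (G w * f (X (U n w) w) * ?i 1 (\<rho> n w)
            + G w * f (- X (U n w) w) * ?i (-1) (\<rho> n w))"
      using U_space[OF n elim(3)] by (subst sum.delta) auto
    finally show ?case
      using elim X_Suc[OF n elim(3)] by (auto simp: C_def indicator_def)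
  qed
  have meas: "(\<lambda>w. G w * f (X (n + 1) w)) \<in> borel_measurable M"
    by (intro borel_measurable_times measurable_F_M[OF G(1)] measurable_compose[OF _ f(1)]
        X_measurable) auto
  have R: "integrable M ?R"
    by (intro Bochner_Integration.integrable_add Bochner_Integration.integrable_sum Aint C(1))
  show ?int
    using integrable_cong_AE[OF meas borel_measurable_integrable[OF R] ae] R by simp
  have "(\<integral>w. G w * f (X (n + 1) w) \<partial>M) = expectation ?R"
    by (rule integral_cong_AE[OF meas borel_measurable_integrable[OF R] ae])
  also have "\<dots> = (\<integral>w. (\<Sum>j=1..n. A 1 1 j w + A (-1) (-1) j w) \<partial>M) + expectation C"
    by (intro Bochner_Integration.integral_add Bochner_Integration.integrable_add
        Bochner_Integration.integrable_sum Aint C(1))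
  also have "(\<integral>w. (\<Sum>j=1..n. A 1 1 j w + A (-1) (-1) j w) \<partial>M)
      = (\<Sum>j=1..n. \<integral>w. A 1 1 j w + A (-1) (-1) j w \<partial>M)"
    by (intro Bochner_Integration.integral_sum Bochner_Integration.integrable_add Aint)
  also have "\<dots> = (\<Sum>j=1..n. (of_real (\<alpha> * p) * (\<integral>w. G w * f (X j w) \<partial>M)
        + of_real (\<alpha> * (1 - p)) * (\<integral>w. G w * f (- X j w) \<partial>M)) / of_nat n)"
  proof (intro sum.cong refl)
    fix j assume j: "j \<in> {1..n}"
    have "(\<integral>w. A 1 1 j w + A (-1) (-1) j w \<partial>M) = expectation (A 1 1 j) + expectation (A (-1) (-1) j)"
      by (intro Bochner_Integration.integral_add Aint j)
    also have "expectation (A 1 1 j) = (\<integral>w. G w * f (X j w) \<partial>M) * of_real (1 / n) * of_real \<alpha> * of_real p"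
      using A(2)[OF j, of 1 1] pos[OF j] rho_distr(1)[OF n] by simp
    also have "expectation (A (-1) (-1) j)
        = (\<integral>w. G w * f (- X j w) \<partial>M) * of_real (1 / n) * of_real \<alpha> * of_real (1 - p)"
      using A(2)[OF j, of "-1" "-1"] neg[OF j] rho_distr(2)[OF n] by simp
    finally show "(\<integral>w. A 1 1 j w + A (-1) (-1) j w \<partial>M)
        = (of_real (\<alpha> * p) * (\<integral>w. G w * f (X j w) \<partial>M)
          + of_real (\<alpha> * (1 - p)) * (\<integral>w. G w * f (- X j w) \<partial>M)) / of_nat n"
      by (simp add: add_divide_distrib diff_divide_distrib algebra_simps)
  qed
  also have "\<dots> = (\<Sum>j=1..n. of_real (\<alpha> * p) * (\<integral>w. G w * f (X j w) \<partial>M)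
        + of_real (\<alpha> * (1 - p)) * (\<integral>w. G w * f (- X j w) \<partial>M)) / of_nat n"
    by (simp only: sum_divide_distrib)
  also note C(2)
  finally show ?eq
    by this
qed

text \<open>Since \<open>f\<close> is even, signs do not matter, and every step has the same law up to sign as \<open>\<xi> 1\<close>.\<close>

lemma even_expectation:
  fixes f :: "real \<Rightarrow> real"
  assumes f: "f \<in> borel_measurable borel" "\<And>x. f (- x) = f x" "integrable M (\<lambda>w. f (\<xi> 1 w))"
    and "n \<ge> 1"
  shows "integrable M (\<lambda>w. f (X n w)) \<and> (\<integral>w. f (X n w) \<partial>M) = (\<integral>w. f (\<xi> 1 w) \<partial>M)"
  using \<open>n \<ge> 1\<close>
proof (induction n rule: less_induct)
  case (less n)
  show ?case
  proof (cases "n = 1")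
    case True
    have "integrable M (\<lambda>w. f (X 1 w)) \<longleftrightarrow> integrable M (\<lambda>w. f (\<xi> 1 w))"
      by (rule Bochner_Integration.integrable_cong) (simp_all only: X_1)
    moreover have "(\<integral>w. f (X 1 w) \<partial>M) = (\<integral>w. f (\<xi> 1 w) \<partial>M)"
      by (rule Bochner_Integration.integral_cong) (simp_all only: X_1)
    ultimately have "integrable M (\<lambda>w. f (X 1 w)) \<and> (\<integral>w. f (X 1 w) \<partial>M) = (\<integral>w. f (\<xi> 1 w) \<partial>M)"
      using f(3) by blast
    then show ?thesis unfolding \<open>n = 1\<close> .
  next
    case False
    define m where "m = n - 1"
    have m: "n = m + 1" "m \<ge> 1" using False \<open>1 \<le> n\<close> by (simp_all add: m_def)
    have IH: "integrable M (\<lambda>w. f (X j w))" "(\<integral>w. f (X j w) \<partial>M) = (\<integral>w. f (\<xi> 1 w) \<partial>M)"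
      if "j \<in> {1..m}" for j using less.IH[of j] that m by auto
    have f': "integrable M (\<lambda>w. 1 * f (X j w))" "integrable M (\<lambda>w. 1 * f (- X j w))"
      if "j \<in> {1..m}" for j using IH(1)[OF that] f(2) by simp_all
    have step: "integrable M (\<lambda>w. 1 * f (X (m + 1) w))"
      "(\<integral>w. 1 * f (X (m + 1) w) \<partial>M) = (\<Sum>j=1..m. of_real (\<alpha> * p) * (\<integral>w. 1 * f (X j w) \<partial>M)
        + of_real (\<alpha> * (1 - p)) * (\<integral>w. 1 * f (- X j w) \<partial>M)) / of_nat m
        + of_real (1 - \<alpha>) * (\<integral>w. 1 \<partial>M) * (\<integral>w. f (\<xi> 1 w) \<partial>M)"
      by (rule expectation_step[where G = "\<lambda>_. 1"], (rule m(2) f f' | assumption | simp; fail)+)+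
    let ?e = "\<integral>w. f (\<xi> 1 w) \<partial>M"
    have "(\<integral>w. 1 * f (X (m + 1) w) \<partial>M)
        = (\<Sum>j=1..m. \<alpha> * p * ?e + \<alpha> * (1 - p) * ?e) / real m + (1 - \<alpha>) * ?e"
      unfolding step(2) using IH(2) by (simp add: f(2) prob_space)
    also have "\<dots> = ?e"
      using m(2) by (simp add: field_simps)
    finally show ?thesis using step(1) m by simp
  qed
qed

end

section \<open>Linear recursions with a drift of order 1/n\<close>

lemma powr_tangent:
  fixes p :: real
  assumes "p \<ge> 1" "n \<ge> (1::nat)"
  shows "real n powr p * (1 + p / n) \<le> real (n + 1) powr p"
proof -
  \<comment> \<open>The power function is convex, so at \<open>n + 1\<close> it lies above its
    tangent at \<open>n\<close>.\<close>
  have "real (n + 1) powr p - real n powr p \<ge> (p * real n powr (p - 1)) * (real (n + 1) - real n)"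
    by (rule convex_on_imp_above_tangent[OF powr_convex[OF assms(1)]])
       (use assms(2) in \<open>auto simp: at_within_open[OF _ open_greaterThan] interior_open intro!: derivative_eq_intros\<close>)
  moreover have "real n powr (p - 1) = real n powr p / n"
    using assms(2) by (simp add: powr_diff)
  ultimately show ?thesis by (simp add: algebra_simps)
qed

text \<open>The bound is a supersolution. Increments of \<open>A * n powr (1 + b)\<close> are at
  least \<open>A * (1 + b) * n powr b\<close>, while the recursion asks for
  \<open>2 * b * A * n powr b + K\<close>; the surplus \<open>A * (1 - b) * n powr b\<close> absorbs
  \<open>K\<close> once \<open>A\<close> is at least \<open>K / (1 - b)\<close>. The exponent
  \<open>1 + b\<close> avoids a case split at \<open>b = 1 / 2\<close> and stays below 2.\<close>

lemma linear_recursion_bound: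
  fixes e :: "nat \<Rightarrow> real"
  assumes e: "\<And>n. n \<ge> 1 \<Longrightarrow> e (n + 1) \<le> (1 + 2 * b / n) * e n + K"
    and "0 \<le> b" "b < 1" "0 \<le> K" "n \<ge> 1"
  shows "e n \<le> max (e 1) (K / (1 - b)) * real n powr (1 + b)"
  using \<open>n \<ge> 1\<close>
proof (induction n rule: nat_induct_at_least)
  case base
  then show ?case by simp
next
  case (Suc n)
  define A where "A = max (e 1) (K / (1 - b))"
  have A: "A \<ge> 0" "K \<le> A * (1 - b)"
    using assms pos_divide_le_eq[of "1 - b" K A] divide_nonneg_nonneg[of K "1 - b"]
    unfolding A_def by (auto simp: le_max_iff_disj)
  have n: "real n powr (1 + b) / n \<ge> 1"
    using Suc.hyps assms(2) by (simp add: powr_add ge_one_powr_ge_zero)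
  have "K \<le> A * (1 - b) * 1" using A by simp
  also have "\<dots> \<le> A * (1 - b) * (real n powr (1 + b) / n)"
    using A assms n by (intro mult_left_mono) auto
  finally have K: "K \<le> A * (1 - b) * (real n powr (1 + b) / n)" .
  have "e (Suc n) \<le> (1 + 2 * b / n) * e n + K"
    using e[OF Suc.hyps] by simp
  also have "\<dots> \<le> (1 + 2 * b / n) * (A * real n powr (1 + b)) + A * (1 - b) * (real n powr (1 + b) / n)"
    using Suc.IH assms(2) K unfolding A_def by (intro add_mono mult_left_mono) auto
  also have "\<dots> = A * (real n powr (1 + b) * (1 + (1 + b) / n))"
    using Suc.hyps by (simp add: field_simps)
  also have "\<dots> \<le> A * real (n + 1) powr (1 + b)"
    using A powr_tangent[of "1 + b" n] assms Suc.hyps by (intro mult_left_mono) auto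
  finally show ?case by (simp add: A_def)
qed

lemma linear_recursion_limit:
  fixes e :: "nat \<Rightarrow> real"
  assumes e: "\<And>n. n \<ge> 1 \<Longrightarrow> e (n + 1) \<le> (1 + 2 * b / n) * e n + K"
    and nonneg: "\<And>n. 0 \<le> e n" "0 \<le> K" and "b < 1"
  shows "(\<lambda>n. e n / (real n)\<^sup>2) \<longlonglongrightarrow> 0"
proof -
  \<comment> \<open>A negative \<open>b\<close> may be raised to 0 because \<open>e\<close> is
    nonnegative.\<close>
  define c where "c = max b 0"
  have c: "0 \<le> c" "c < 1" using \<open>b < 1\<close> by (auto simp: c_def)
  have "e (n + 1) \<le> (1 + 2 * c / n) * e n + K" if "n \<ge> 1" for n
    using e[OF that] nonneg(1)[of n] that
      mult_right_mono[of "1 + 2 * b / n" "1 + 2 * c / n" "e n"]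
    by (auto simp: c_def divide_right_mono)
  note bound = linear_recursion_bound[OF this c nonneg(2)]
  define A where "A = max (e 1) (K / (1 - c))"
  have "(\<lambda>n. A * (real n powr (1 + c) / (real n)\<^sup>2)) \<longlonglongrightarrow> 0"
  proof -
    have "(\<lambda>n. real n powr (1 + c) / (real n)\<^sup>2) \<longlonglongrightarrow> 0"
      using c by real_asymp
    from tendsto_mult_right_zero[OF this] show ?thesis by simp
  qed
  then show ?thesis
  proof (rule tendsto_sandwich[OF _ _ tendsto_const, rotated 2])
    show "\<forall>\<^sub>F n in sequentially. 0 \<le> e n / (real n)\<^sup>2"
      using nonneg by auto
    show "\<forall>\<^sub>F n in sequentially. e n / (real n)\<^sup>2 \<le> A * (real n powr (1 + c) / (real n)\<^sup>2)"
      using bound unfolding A_def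
      by (intro eventually_sequentiallyI[of 1]) (auto simp: divide_right_mono)
  qed
qed

section \<open>Square-integrable functions\<close>

lemma integrable_mult_of_squares:
  fixes f g :: "'a \<Rightarrow> real"
  assumes "f \<in> borel_measurable M" "g \<in> borel_measurable M"
    and "integrable M (\<lambda>x. (f x)\<^sup>2)" "integrable M (\<lambda>x. (g x)\<^sup>2)"
  shows "integrable M (\<lambda>x. f x * g x)"
proof (rule Bochner_Integration.integrable_bound)
  show "integrable M (\<lambda>x. (f x)\<^sup>2 + (g x)\<^sup>2)" using assms by auto
  show "AE x in M. norm (f x * g x) \<le> norm ((f x)\<^sup>2 + (g x)\<^sup>2)"
  proof (rule AE_I2)
    fix x
    have "2 * (\<bar>f x\<bar> * \<bar>g x\<bar>) \<le> (f x)\<^sup>2 + (g x)\<^sup>2"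
      using sum_squares_bound[of "\<bar>f x\<bar>" "\<bar>g x\<bar>"] by simp
    moreover have "0 \<le> \<bar>f x\<bar> * \<bar>g x\<bar>" by simp
    ultimately show "norm (f x * g x) \<le> norm ((f x)\<^sup>2 + (g x)\<^sup>2)"
      unfolding real_norm_def abs_mult by linarith
  qed
qed (use assms in auto)

lemma integrable_square_add:
  fixes f g :: "'a \<Rightarrow> real"
  assumes "f \<in> borel_measurable M" "g \<in> borel_measurable M"
    and "integrable M (\<lambda>x. (f x)\<^sup>2)" "integrable M (\<lambda>x. (g x)\<^sup>2)"
  shows "integrable M (\<lambda>x. (f x + g x)\<^sup>2)"
  unfolding power2_sum using integrable_mult_of_squares[OF assms] assms(3,4) by (auto simp: mult.assoc)

lemma integrable_square_sum:
  fixes f :: "'i \<Rightarrow> 'a \<Rightarrow> real"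
  assumes "finite I" "\<And>i. i \<in> I \<Longrightarrow> f i \<in> borel_measurable M"
    and "\<And>i. i \<in> I \<Longrightarrow> integrable M (\<lambda>x. (f i x)\<^sup>2)"
  shows "integrable M (\<lambda>x. (\<Sum>i\<in>I. f i x)\<^sup>2)"
  using assms
proof (induction rule: finite_induct)
  case (insert i I)
  then have "integrable M (\<lambda>x. (f i x + (\<Sum>i\<in>I. f i x))\<^sup>2)"
    by (intro integrable_square_add) auto
  then show ?case using insert.hyps by simp
qed simp

text \<open>This is nonnegativity of the variance of \<open>\<bar>f x\<bar>\<close>.\<close>

lemma (in prob_space) expectation_abs_le_sqrt:
  fixes f :: "'a \<Rightarrow> real"
  assumes [measurable]: "f \<in> borel_measurable M" and "integrable M (\<lambda>x. (f x)\<^sup>2)"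
  shows "expectation (\<lambda>x. \<bar>f x\<bar>) \<le> sqrt (expectation (\<lambda>x. (f x)\<^sup>2))"
proof -
  have int: "integrable M (\<lambda>x. \<bar>f x\<bar>)"
    using square_integrable_imp_integrable[OF assms] by simp
  have "0 \<le> variance (\<lambda>x. \<bar>f x\<bar>)" by (intro Bochner_Integration.integral_nonneg) auto
  also have "\<dots> = expectation (\<lambda>x. (f x)\<^sup>2) - (expectation (\<lambda>x. \<bar>f x\<bar>))\<^sup>2"
    using assms int by (subst variance_eq) auto
  finally show ?thesis by (simp add: real_le_rsqrt)
qed

section \<open>Conditional means of functions of the next step\<close>

context step_reinforced_walk
begin

text \<open>A version of the conditional expectation of \<open>f (X (n + 1))\<close> given
  \<open>F n\<close>, written as an explicit function of the first \<open>n\<close> steps;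
  \<open>expectation_step_mean\<close> justifies this reading.\<close>

definition step_mean :: "(real \<Rightarrow> real) \<Rightarrow> nat \<Rightarrow> 'a \<Rightarrow> real" where
  "step_mean f n w = (\<Sum>j=1..n. \<alpha> * p * f (X j w) + \<alpha> * (1 - p) * f (- X j w)) / n
    + (1 - \<alpha>) * (\<integral>w. f (\<xi> 1 w) \<partial>M)"

lemma X_comp_measurable:
  assumes "f \<in> borel_measurable borel" "1 \<le> j" "j \<le> n"
  shows "(\<lambda>w. f (X j w)) \<in> borel_measurable (F n)" "(\<lambda>w. f (- X j w)) \<in> borel_measurable (F n)"
    "(\<lambda>w. f (X j w)) \<in> borel_measurable M" "(\<lambda>w. f (- X j w)) \<in> borel_measurable M"
proof -
  note [measurable] = X_measurable_F[OF assms(2,3)] assms(1)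
  show "(\<lambda>w. f (X j w)) \<in> borel_measurable (F n)" "(\<lambda>w. f (- X j w)) \<in> borel_measurable (F n)"
    by measurable
  then show "(\<lambda>w. f (X j w)) \<in> borel_measurable M" "(\<lambda>w. f (- X j w)) \<in> borel_measurable M"
    using measurable_F_M by blast+
qed

lemma step_mean_measurable:
  assumes "f \<in> borel_measurable borel"
  shows "step_mean f n \<in> borel_measurable (F n)" "step_mean f n \<in> borel_measurable M"
proof -
  show "step_mean f n \<in> borel_measurable (F n)"
    unfolding step_mean_def[abs_def] using X_comp_measurable[OF assms]
    by (intro borel_measurable_add borel_measurable_divide borel_measurable_sum
        borel_measurable_times borel_measurable_const) auto
  then show "step_mean f n \<in> borel_measurable M" by (rule measurable_F_M)
qed

text \<open>The function \<open>f\<close> need not be even, but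
  \<open>\<bar>f x\<bar> + \<bar>f (- x)\<bar>\<close> is, and it dominates both. Hence the bound
  does not depend on \<open>n\<close>.\<close>

lemma X_comp_integrable:
  fixes f :: "real \<Rightarrow> real"
  assumes f: "f \<in> borel_measurable borel" "integrable M (\<lambda>w. f (\<xi> 1 w))"
      "integrable M (\<lambda>w. f (- \<xi> 1 w))" and n: "n \<ge> 1"
  shows "integrable M (\<lambda>w. f (X n w))" "integrable M (\<lambda>w. f (- X n w))"
    "(\<integral>w. \<bar>f (X n w)\<bar> \<partial>M) \<le> (\<integral>w. \<bar>f (\<xi> 1 w)\<bar> + \<bar>f (- \<xi> 1 w)\<bar> \<partial>M)"
proof -
  have "integrable M (\<lambda>w. \<bar>f (X n w)\<bar> + \<bar>f (- X n w)\<bar>)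
    \<and> (\<integral>w. \<bar>f (X n w)\<bar> + \<bar>f (- X n w)\<bar> \<partial>M) = (\<integral>w. \<bar>f (\<xi> 1 w)\<bar> + \<bar>f (- \<xi> 1 w)\<bar> \<partial>M)"
    using f by (intro even_expectation[where f = "\<lambda>x. \<bar>f x\<bar> + \<bar>f (- x)\<bar>"] n) auto
  then have *: "integrable M (\<lambda>w. \<bar>f (X n w)\<bar> + \<bar>f (- X n w)\<bar>)"
    "(\<integral>w. \<bar>f (X n w)\<bar> + \<bar>f (- X n w)\<bar> \<partial>M) = (\<integral>w. \<bar>f (\<xi> 1 w)\<bar> + \<bar>f (- \<xi> 1 w)\<bar> \<partial>M)"
    by blast+
  show X: "integrable M (\<lambda>w. f (X n w))" "integrable M (\<lambda>w. f (- X n w))"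
    by (rule Bochner_Integration.integrable_bound[OF *(1)];
        use X_comp_measurable[OF f(1) n order_refl] in auto)+
  show "(\<integral>w. \<bar>f (X n w)\<bar> \<partial>M) \<le> (\<integral>w. \<bar>f (\<xi> 1 w)\<bar> + \<bar>f (- \<xi> 1 w)\<bar> \<partial>M)"
    unfolding *(2)[symmetric] using X by (intro integral_mono *(1)) auto
qed

lemma expectation_step_mean:
  fixes G :: "'a \<Rightarrow> 'b::{real_normed_field, banach, second_countable_topology}" and f :: "real \<Rightarrow> real"
  assumes n: "n \<ge> 1" and G: "G \<in> borel_measurable (F n)" "integrable M G"
    and f: "f \<in> borel_measurable borel" "integrable M (\<lambda>w. f (\<xi> 1 w))"
    and pos: "\<And>j. j \<in> {1..n} \<Longrightarrow> integrable M (\<lambda>w. G w * of_real (f (X j w)))"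
    and neg: "\<And>j. j \<in> {1..n} \<Longrightarrow> integrable M (\<lambda>w. G w * of_real (f (- X j w)))"
  shows "integrable M (\<lambda>w. G w * of_real (f (X (n + 1) w)))" (is ?int)
    and "integrable M (\<lambda>w. G w * of_real (step_mean f n w))" (is ?int2)
    and "(\<integral>w. G w * of_real (f (X (n + 1) w)) \<partial>M) = (\<integral>w. G w * of_real (step_mean f n w) \<partial>M)" (is ?eq)
proof -
  let ?f = "\<lambda>x. of_real (f x) :: 'b" and ?e = "\<integral>w. f (\<xi> 1 w) \<partial>M"
  let ?S = "\<lambda>w. \<Sum>j=1..n. of_real (\<alpha> * p) * (G w * ?f (X j w)) + of_real (\<alpha> * (1 - p)) * (G w * ?f (- X j w))"
  have f': "?f \<in> borel_measurable borel" "integrable M (\<lambda>w. ?f (\<xi> 1 w))"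
    using f by auto
  note step = expectation_step[OF n G f' pos neg]
  show ?int
    by (rule step(1))
  have eq: "G w * of_real (step_mean f n w) = ?S w / of_nat n + of_real ((1 - \<alpha>) * ?e) * G w" for w
    unfolding step_mean_def
    by (simp add: distrib_left sum_distrib_left mult_ac sum.distrib)
  have S: "integrable M ?S"
    using pos neg by (intro Bochner_Integration.integrable_sum Bochner_Integration.integrable_add
       integrable_mult_right) auto
  show ?int2
    unfolding eq using S G by (intro Bochner_Integration.integrable_add integrable_mult_right 
        integrable_divide) auto
  have "(\<integral>w. G w * of_real (step_mean f n w) \<partial>M) = expectation ?S / of_nat n + of_real ((1 - \<alpha>) * ?e) * expectation G"
    unfolding eq using S G
    by (subst Bochner_Integration.integral_add) (auto intro!: integrable_divide)
  also have "expectation ?S = (\<Sum>j=1..n. of_real (\<alpha> * p) * (\<integral>w. G w * ?f (X j w) \<partial>M)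
        + of_real (\<alpha> * (1 - p)) * (\<integral>w. G w * ?f (- X j w) \<partial>M))"
    using pos neg
    by (subst Bochner_Integration.integral_sum)
       (auto intro!: sum.cong Bochner_Integration.integrable_add integrable_mult_right
         simp: Bochner_Integration.integral_add)
  also have "of_real ((1 - \<alpha>) * ?e) * expectation G = of_real (1 - \<alpha>) * expectation G * (\<integral>w. ?f (\<xi> 1 w) \<partial>M)"
    using f(2) by (simp add: integral_of_real mult_ac)
  finally show ?eq
    by (intro trans[OF step(2)]) simp_all
qed

text \<open>This variant lets complex exponentials of the walk act as test functions, at the price
  of first absolute moments of \<open>f\<close> only.\<close>

lemma expectation_step_mean_bounded:
  fixes G :: "'a \<Rightarrow> 'b::{real_normed_field, banach, second_countable_topology}" and f :: "real \<Rightarrow> real"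
  assumes n: "n \<ge> 1" and G: "G \<in> borel_measurable (F n)" "\<And>w. norm (G w) \<le> 1"
    and f: "f \<in> borel_measurable borel" "integrable M (\<lambda>w. f (\<xi> 1 w))"
      "integrable M (\<lambda>w. f (- \<xi> 1 w))"
  shows "(\<integral>w. G w * of_real (f (X (n + 1) w)) \<partial>M) = (\<integral>w. G w * of_real (step_mean f n w) \<partial>M)"
proof -
  have GM: "G \<in> borel_measurable M" using G(1) by (rule measurable_F_M)
  have int: "integrable M (\<lambda>w. G w * of_real (Y w))" if "integrable M Y" for Y :: "'a \<Rightarrow> real"
    by (rule Bochner_Integration.integrable_bound[OF that])
       (use G(2) GM that in \<open>auto simp: norm_mult intro!: mult_left_le_one_le\<close>)
  show ?thesis
  proof (rule expectation_step_mean(3)[OF n G(1) _ f(1,2)])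
    show "integrable M G"
      by (rule integrable_const_bound[of _ 1]) (use G(2) GM in auto)
  qed (auto intro!: int X_comp_integrable f)
qed

text \<open>This variant admits unbounded test functions such as the centered walk itself, as needed
  for second moment recursions and martingale orthogonality.\<close>

lemma expectation_step_mean_square:
  fixes G :: "'a \<Rightarrow> real" and f :: "real \<Rightarrow> real"
  assumes n: "n \<ge> 1" and G: "G \<in> borel_measurable (F n)" "integrable M (\<lambda>w. (G w)\<^sup>2)"
    and f: "f \<in> borel_measurable borel" "integrable M (\<lambda>w. (f (\<xi> 1 w))\<^sup>2)"
      "integrable M (\<lambda>w. (f (- \<xi> 1 w))\<^sup>2)"
  shows "(\<integral>w. G w * f (X (n + 1) w) \<partial>M) = (\<integral>w. G w * step_mean f n w \<partial>M)"
proof -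
  note [measurable] = measurable_F_M[OF G(1)] f(1) xi_measurable[of "Suc 0"]
  have sq: "integrable M (\<lambda>w. (f (X j w))\<^sup>2)" "integrable M (\<lambda>w. (f (- X j w))\<^sup>2)" if "j \<ge> 1" for j
    using X_comp_integrable(1,2)[of "\<lambda>x. (f x)\<^sup>2" j] f that by auto
  have "integrable M (\<lambda>w. f (\<xi> 1 w))"
    by (rule square_integrable_imp_integrable) (use f in auto)
  moreover have "integrable M G"
    by (rule square_integrable_imp_integrable) (use G in auto)
  moreover have "integrable M (\<lambda>w. G w * f (X j w))" "integrable M (\<lambda>w. G w * f (- X j w))"
    if "j \<in> {1..n}" for j
    using that by (intro integrable_mult_of_squares[OF measurable_F_M[OF G(1)] _ G(2)] sq
        X_comp_measurable[OF f(1) _ order_refl]; simp)+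
  ultimately show ?thesis
    using expectation_step_mean(3)[where 'b = real, OF n G(1) _ f(1)] by simp
qed

end

section \<open>Linear drift and the law of large numbers\<close>

text \<open>
  The drift condition makes the conditional expectation of \<open>f (X (n + 1))\<close> equal to \<open>\<beta> / n\<close> times the
  sum of the \<open>f (X j)\<close> with \<open>j \<le> n\<close>. It holds for \<open>f x = x - c\<close> with \<open>\<beta> = a\<close>, and for centered even
  functions with \<open>\<beta> = \<alpha>\<close>.
\<close>

locale walk_drift = step_reinforced_walk +
  fixes f :: "real \<Rightarrow> real" and \<beta> :: real
  assumes f_measurable: "f \<in> borel_measurable borel"
    and f_square: "integrable M (\<lambda>w. (f (\<xi> 1 w))\<^sup>2)" "integrable M (\<lambda>w. (f (- \<xi> 1 w))\<^sup>2)"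
    and drift: "\<And>x. \<alpha> * p * f x + \<alpha> * (1 - p) * f (- x) + (1 - \<alpha>) * (\<integral>w. f (\<xi> 1 w) \<partial>M) = \<beta> * f x"
begin

definition Q :: "nat \<Rightarrow> 'a \<Rightarrow> real" where
  "Q n w = (\<Sum>j=1..n. f (X j w))"

lemma Q_Suc: "Q (n + 1) w = Q n w + f (X (n + 1) w)"
  by (simp add: Q_def)

lemma step_mean_eq: "n \<ge> 1 \<Longrightarrow> step_mean f n w = \<beta> / n * Q n w"
proof -
  assume n: "n \<ge> 1"
  let ?e = "(1 - \<alpha>) * (\<integral>w. f (\<xi> 1 w) \<partial>M)"
  have "(\<Sum>j=1..n. \<alpha> * p * f (X j w) + \<alpha> * (1 - p) * f (- X j w)) = (\<Sum>j=1..n. \<beta> * f (X j w) - ?e)"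
    using drift by (intro sum.cong refl) (simp only: eq_diff_eq)
  also have "\<dots> = \<beta> * Q n w - n * ?e"
    by (simp add: Q_def sum_subtractf sum_distrib_left)
  finally show ?thesis
    using n unfolding step_mean_def by (simp add: field_simps)
qed

lemma Q_measurable_F: "Q n \<in> borel_measurable (F n)"
  unfolding Q_def[abs_def] by (intro borel_measurable_sum X_comp_measurable f_measurable) auto

lemma Q_measurable: "Q n \<in> borel_measurable M"
  using Q_measurable_F by (rule measurable_F_M)

lemma f_X_measurable: "n \<ge> 1 \<Longrightarrow> (\<lambda>w. f (X n w)) \<in> borel_measurable M"
  using X_comp_measurable[OF f_measurable _ order_refl] by auto

lemma f_X_square: "n \<ge> 1 \<Longrightarrow> integrable M (\<lambda>w. (f (X n w))\<^sup>2)"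
  using X_comp_integrable(1)[of "\<lambda>x. (f x)\<^sup>2" n] f_square f_measurable by simp

lemma f_X_square_bound:
  "n \<ge> 1 \<Longrightarrow> (\<integral>w. (f (X n w))\<^sup>2 \<partial>M) \<le> (\<integral>w. (f (\<xi> 1 w))\<^sup>2 + (f (- \<xi> 1 w))\<^sup>2 \<partial>M)"
  using X_comp_integrable(3)[of "\<lambda>x. (f x)\<^sup>2" n] f_square f_measurable by simp

lemma Q_square: "integrable M (\<lambda>w. (Q n w)\<^sup>2)"
  unfolding Q_def by (intro integrable_square_sum) (auto intro: f_X_square f_X_measurable)

lemma expectation_drift:
  assumes "n \<ge> 1" "G \<in> borel_measurable (F n)" "integrable M (\<lambda>w. (G w)\<^sup>2)"
  shows "(\<integral>w. G w * f (X (n + 1) w) \<partial>M) = \<beta> / n * (\<integral>w. G w * Q n w \<partial>M)"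
proof -
  have "(\<integral>w. G w * f (X (n + 1) w) \<partial>M) = (\<integral>w. \<beta> / n * (G w * Q n w) \<partial>M)"
    unfolding expectation_step_mean_square[OF assms f_measurable f_square] step_mean_eq[OF assms(1)]
    by (simp add: mult_ac)
  then show ?thesis by simp
qed

text \<open>The drift condition evaluates the cross term of the square as \<open>\<beta> / n\<close>
  times the second moment, so the recursion for second moments is exact and closed.\<close>

lemma Q_square_Suc:
  assumes n: "n \<ge> 1"
  shows "(\<integral>w. (Q (n + 1) w)\<^sup>2 \<partial>M)
    = (1 + 2 * \<beta> / n) * (\<integral>w. (Q n w)\<^sup>2 \<partial>M) + (\<integral>w. (f (X (n + 1) w))\<^sup>2 \<partial>M)"
proof -
  have fX: "(\<lambda>w. f (X (n + 1) w)) \<in> borel_measurable M" "integrable M (\<lambda>w. (f (X (n + 1) w))\<^sup>2)"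
    using f_X_measurable[of "n + 1"] f_X_square[of "n + 1"] by simp_all
  have int: "integrable M (\<lambda>w. Q n w * f (X (n + 1) w))"
    by (intro integrable_mult_of_squares Q_square Q_measurable fX)
  have "(\<integral>w. (Q (n + 1) w)\<^sup>2 \<partial>M)
      = (\<integral>w. ((Q n w)\<^sup>2 + 2 * (Q n w * f (X (n + 1) w))) + (f (X (n + 1) w))\<^sup>2 \<partial>M)"
    unfolding Q_Suc power2_sum by (simp add: algebra_simps)
  also have "\<dots> = (\<integral>w. (Q n w)\<^sup>2 \<partial>M) + 2 * (\<integral>w. Q n w * f (X (n + 1) w) \<partial>M)
      + (\<integral>w. (f (X (n + 1) w))\<^sup>2 \<partial>M)"
    using int Q_square fX by simp
  also have "(\<integral>w. Q n w * f (X (n + 1) w) \<partial>M) = \<beta> / n * (\<integral>w. (Q n w)\<^sup>2 \<partial>M)"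
    unfolding expectation_drift[OF n Q_measurable_F Q_square] by (simp add: power2_eq_square)
  finally show ?thesis by (simp add: algebra_simps)
qed

text \<open>A weak law of large numbers in mean square: the second moments of the new terms are
  bounded uniformly in \<open>n\<close>, and \<beta> < 1 keeps the recursion below quadratic
  growth.\<close>

lemma Q_square_limit:
  assumes "\<beta> < 1"
  shows "(\<lambda>n. (\<integral>w. (Q n w)\<^sup>2 \<partial>M) / (real n)\<^sup>2) \<longlonglongrightarrow> 0"
proof (rule linear_recursion_limit[OF _ _ _ assms])
  fix n :: nat assume n: "n \<ge> 1"
  show "(\<integral>w. (Q (n + 1) w)\<^sup>2 \<partial>M) \<le> (1 + 2 * \<beta> / n) * (\<integral>w. (Q n w)\<^sup>2 \<partial>M)
      + (\<integral>w. (f (\<xi> 1 w))\<^sup>2 + (f (- \<xi> 1 w))\<^sup>2 \<partial>M)"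
    unfolding Q_square_Suc[OF n] using f_X_square_bound[of "n + 1"] by simp
qed (auto intro!: Bochner_Integration.integral_nonneg)

lemma Q_abs_limit:
  assumes "\<beta> < 1"
  shows "(\<lambda>n. (\<integral>w. \<bar>Q n w\<bar> \<partial>M) / real n) \<longlonglongrightarrow> 0"
proof -
  have "(\<lambda>n. sqrt ((\<integral>w. (Q n w)\<^sup>2 \<partial>M) / (real n)\<^sup>2)) \<longlonglongrightarrow> 0"
    using tendsto_real_sqrt[OF Q_square_limit[OF assms]] by simp
  then show ?thesis
  proof (rule tendsto_sandwich[OF _ _ tendsto_const, rotated 2])
    show "\<forall>\<^sub>F n in sequentially. 0 \<le> (\<integral>w. \<bar>Q n w\<bar> \<partial>M) / real n" by simp
    show "\<forall>\<^sub>F n in sequentially. (\<integral>w. \<bar>Q n w\<bar> \<partial>M) / real n \<le> sqrt ((\<integral>w. (Q n w)\<^sup>2 \<partial>M) / (real n)\<^sup>2)"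
      using expectation_abs_le_sqrt[OF Q_measurable Q_square]
      by (auto simp: real_sqrt_divide divide_right_mono)
  qed
qed

end

section \<open>The weak law for even functions of the steps\<close>

context step_reinforced_walk
begin

lemma truncation_limit:
  assumes [measurable]: "g \<in> borel_measurable borel" and int: "integrable M (\<lambda>w. g (\<xi> 1 w))"
  shows "(\<lambda>K. \<integral>w. \<bar>g (\<xi> 1 w) - g (\<xi> 1 w) * indicator {..real K} \<bar>g (\<xi> 1 w)\<bar>\<bar> \<partial>M) \<longlonglongrightarrow> 0"
proof -
  note [measurable] = xi_measurable[of "Suc 0"]
  have "(\<lambda>K. \<integral>w. \<bar>g (\<xi> 1 w) - g (\<xi> 1 w) * indicator {..real K} \<bar>g (\<xi> 1 w)\<bar>\<bar> \<partial>M) \<longlonglongrightarrow> (\<integral>w. 0 \<partial>M)"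
  proof (rule integral_dominated_convergence[where w = "\<lambda>w. \<bar>g (\<xi> 1 w)\<bar>"])
    show "AE w in M. (\<lambda>K. \<bar>g (\<xi> 1 w) - g (\<xi> 1 w) * indicator {..real K} \<bar>g (\<xi> 1 w)\<bar>\<bar>) \<longlonglongrightarrow> 0"
    proof (rule AE_I2)
      fix w
      obtain N where N: "\<bar>g (\<xi> 1 w)\<bar> \<le> real N" using real_arch_simple by blast
      show "(\<lambda>K. \<bar>g (\<xi> 1 w) - g (\<xi> 1 w) * indicator {..real K} \<bar>g (\<xi> 1 w)\<bar>\<bar>) \<longlonglongrightarrow> 0"
        by (rule tendsto_eventually) (use N in \<open>auto intro!: eventually_sequentiallyI[of N] simp: indicator_def\<close>)
    qed
    show "AE w in M. norm \<bar>g (\<xi> 1 w) - g (\<xi> 1 w) * indicator {..real K} \<bar>g (\<xi> 1 w)\<bar>\<bar> \<le> \<bar>g (\<xi> 1 w)\<bar>" for K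
      by (auto simp: indicator_def)
    show "(\<lambda>w. \<bar>g (\<xi> 1 w) - g (\<xi> 1 w) * indicator {..real K} \<bar>g (\<xi> 1 w)\<bar>\<bar>) \<in> borel_measurable M" for K
      by simp
  qed (use int in auto)
  then show ?thesis by simp
qed

text \<open>A copy has the same value of \<open>g\<close> whatever its sign, so \<open>g\<close>
  minus its mean satisfies the drift condition with \<beta> = \<alpha>. Boundedness supplies the
  second moment.\<close>

lemma even_LLN_bounded:
  fixes g :: "real \<Rightarrow> real"
  assumes [measurable]: "g \<in> borel_measurable borel" and even: "\<And>x. g (- x) = g x"
    and bounded: "\<And>x. \<bar>g x\<bar> \<le> K" and "\<alpha> < 1"
  shows "(\<lambda>n. (\<integral>w. \<bar>(\<Sum>j=1..n. g (X j w)) - n * (\<integral>w. g (\<xi> 1 w) \<partial>M)\<bar> \<partial>M) / n) \<longlonglongrightarrow> 0"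
proof -
  note [measurable] = xi_measurable[of "Suc 0"]
  define m where "m = (\<integral>w. g (\<xi> 1 w) \<partial>M)"
  have int: "integrable M (\<lambda>w. g (\<xi> 1 w))"
    by (rule integrable_const_bound[of _ K]) (use bounded in auto)
  have int2: "integrable M (\<lambda>w. (g (\<xi> 1 w) - m)\<^sup>2)"
  proof (rule integrable_const_bound[of _ "(K + \<bar>m\<bar>)\<^sup>2"])
    show "AE w in M. norm ((g (\<xi> 1 w) - m)\<^sup>2) \<le> (K + \<bar>m\<bar>)\<^sup>2"
    proof (rule AE_I2)
      fix w
      have "\<bar>g (\<xi> 1 w) - m\<bar> \<le> \<bar>K + \<bar>m\<bar>\<bar>" using bounded[of "\<xi> 1 w"] by linarith
      then have "(g (\<xi> 1 w) - m)\<^sup>2 \<le> (K + \<bar>m\<bar>)\<^sup>2" by (rule abs_le_square_iff[THEN iffD1])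
      then show "norm ((g (\<xi> 1 w) - m)\<^sup>2) \<le> (K + \<bar>m\<bar>)\<^sup>2" by simp
    qed
  qed simp
  have zero: "(\<integral>w. g (\<xi> 1 w) - m \<partial>M) = 0"
    using int by (simp add: m_def prob_space)
  interpret D: walk_drift M \<xi> U \<gamma> \<rho> p \<alpha> X "\<lambda>x. g x - m" \<alpha>
    by unfold_locales (use int2 zero in \<open>simp_all add: even algebra_simps\<close>)
  have "D.Q n w = (\<Sum>j=1..n. g (X j w)) - n * m" for n w
    by (simp add: D.Q_def sum_subtractf)
  then show ?thesis using D.Q_abs_limit[OF \<open>\<alpha> < 1\<close>] by (simp add: m_def)
qed

text \<open>Truncation reduces integrable functions to bounded ones. The truncation error is uniform
  in \<open>n\<close>, because an even function has the same expectation at every step as at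
  \<open>\<xi> 1\<close>.\<close>

lemma even_LLN:
  fixes g :: "real \<Rightarrow> real"
  assumes [measurable]: "g \<in> borel_measurable borel" and even: "\<And>x. g (- x) = g x"
    and int: "integrable M (\<lambda>w. g (\<xi> 1 w))"
    and const: "\<alpha> = 1 \<Longrightarrow> \<exists>c. AE w in M. g (\<xi> 1 w) = c"
  shows "(\<lambda>n. \<integral>w. \<bar>(\<Sum>j=1..n. g (X j w)) / n - (\<integral>w. g (\<xi> 1 w) \<partial>M)\<bar> \<partial>M) \<longlonglongrightarrow> 0"
proof -
  note [measurable] = xi_measurable[of "Suc 0"]
  define m where "m = (\<integral>w. g (\<xi> 1 w) \<partial>M)"
  let ?L = "\<lambda>n. \<integral>w. \<bar>(\<Sum>j=1..n. g (X j w)) / n - m\<bar> \<partial>M"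
  \<comment> \<open>The factor 2 arises because \<open>g\<close> is exchanged for \<open>h\<close>
    twice: in the average over the steps and in the mean.\<close>
  have approx: "?L n \<le> (\<integral>w. \<bar>(\<Sum>j=1..n. h (X j w)) - n * (\<integral>w. h (\<xi> 1 w) \<partial>M)\<bar> \<partial>M) / n
      + 2 * (\<integral>w. \<bar>g (\<xi> 1 w) - h (\<xi> 1 w)\<bar> \<partial>M)"
    if [measurable]: "h \<in> borel_measurable borel" and h: "\<And>x. h (- x) = h x"
      "integrable M (\<lambda>w. h (\<xi> 1 w))" and n: "n \<ge> 1" for h n
  proof -
    let ?d = "\<integral>w. \<bar>g (\<xi> 1 w) - h (\<xi> 1 w)\<bar> \<partial>M" and ?m = "\<integral>w. h (\<xi> 1 w) \<partial>M"
    have [measurable]: "X j \<in> borel_measurable M" if "j \<in> {1..n}" for j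
      using that by (intro X_measurable) auto
    have d: "integrable M (\<lambda>w. \<bar>g (X j w) - h (X j w)\<bar>)"
        "(\<integral>w. \<bar>g (X j w) - h (X j w)\<bar> \<partial>M) = ?d" if "j \<ge> 1" for j
      using even_expectation[of "\<lambda>x. \<bar>g x - h x\<bar>" j] that int h even by auto
    have hX: "integrable M (\<lambda>w. h (X j w))" if "j \<ge> 1" for j
      using even_expectation[of h j] that h by auto
    have mm: "\<bar>?m - m\<bar> \<le> ?d"
    proof -
      have "?m - m = (\<integral>w. h (\<xi> 1 w) - g (\<xi> 1 w) \<partial>M)"
        unfolding m_def using int h by simp
      then have "\<bar>?m - m\<bar> \<le> (\<integral>w. \<bar>h (\<xi> 1 w) - g (\<xi> 1 w)\<bar> \<partial>M)" by simp
      then show ?thesis by (simp add: abs_minus_commute)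
    qed
    have I: "integrable M (\<lambda>w. \<bar>(\<Sum>j=1..n. h (X j w)) - n * ?m\<bar>)"
      using hX by (intro integrable_abs Bochner_Integration.integrable_diff 
          Bochner_Integration.integrable_sum) auto
    have I2: "integrable M (\<lambda>w. \<Sum>j=1..n. \<bar>g (X j w) - h (X j w)\<bar>)"
      using d(1) by (intro Bochner_Integration.integrable_sum) auto
    let ?B = "\<lambda>w. \<bar>(\<Sum>j=1..n. h (X j w)) - n * ?m\<bar> / n
      + ((\<Sum>j=1..n. \<bar>g (X j w) - h (X j w)\<bar>) / n + \<bar>?m - m\<bar>)"
    have B: "integrable M ?B"
      using I I2 by auto
    have le: "\<bar>(\<Sum>j=1..n. g (X j w)) / n - m\<bar> \<le> ?B w" for w
    proof -
      have eq: "(\<Sum>j=1..n. g (X j w)) / n - m = ((\<Sum>j=1..n. h (X j w)) - n * ?m) / n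
          + ((\<Sum>j=1..n. g (X j w) - h (X j w)) / n + (?m - m))"
        using n by (simp add: field_simps sum_subtractf)
      have "\<bar>(\<Sum>j=1..n. g (X j w) - h (X j w)) / n\<bar> \<le> (\<Sum>j=1..n. \<bar>g (X j w) - h (X j w)\<bar>) / n"
        by (simp add: divide_right_mono sum_abs)
      moreover have "\<bar>((\<Sum>j=1..n. h (X j w)) - n * ?m) / n\<bar> = \<bar>(\<Sum>j=1..n. h (X j w)) - n * ?m\<bar> / n"
        by simp
      moreover have "\<bar>a + (b + c)\<bar> \<le> A + (B + \<bar>c\<bar>)" if "\<bar>b\<bar> \<le> B" "\<bar>a\<bar> = A" for a b c A B :: real
        using that by linarith
      ultimately show ?thesis unfolding eq by blast
    qed
    have "?L n \<le> expectation ?B"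
    proof (rule integral_mono[OF _ B le])
      show "integrable M (\<lambda>w. \<bar>(\<Sum>j=1..n. g (X j w)) / n - m\<bar>)"
      proof (rule Bochner_Integration.integrable_bound[OF B])
        show "AE w in M. norm \<bar>(\<Sum>j=1..n. g (X j w)) / n - m\<bar> \<le> norm (?B w)"
          unfolding real_norm_def abs_abs by (intro AE_I2 order_trans[OF le abs_ge_self])
      qed simp
    qed
    also have "\<dots> = (\<integral>w. \<bar>(\<Sum>j=1..n. h (X j w)) - n * ?m\<bar> \<partial>M) / n
      + ((\<integral>w. (\<Sum>j=1..n. \<bar>g (X j w) - h (X j w)\<bar>) \<partial>M) / n + \<bar>?m - m\<bar>)"
      using I I2 by (simp add: prob_space)
    also have "(\<integral>w. (\<Sum>j=1..n. \<bar>g (X j w) - h (X j w)\<bar>) \<partial>M) = n * ?d"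
      using d by (subst Bochner_Integration.integral_sum) auto
    finally show ?thesis using mm n by simp
  qed
  have "?L \<longlonglongrightarrow> 0"
  proof (cases "\<alpha> = 1")
    case True
    then obtain c where c: "AE w in M. g (\<xi> 1 w) = c" using const by blast
    have d: "(\<integral>w. \<bar>g (\<xi> 1 w) - c\<bar> \<partial>M) = 0"
      by (rule integral_eq_zero_AE) (use c in auto)
    have "?L n \<le> 0" if n: "n \<ge> 1" for n
    proof -
      \<comment> \<open>The constant function \<open>c\<close> is even and at distance 0 in mean
        from \<open>g\<close>, so it can play the role of \<open>h\<close>.\<close>
      have "?L n \<le> (\<integral>w. \<bar>(\<Sum>j=1..n. c) - n * (\<integral>w. c \<partial>M)\<bar> \<partial>M) / n
          + 2 * (\<integral>w. \<bar>g (\<xi> 1 w) - c\<bar> \<partial>M)"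
        by (rule approx[OF _ _ _ n]) simp_all
      also have "\<dots> = 0" unfolding d by (simp add: prob_space)
      finally show ?thesis .
    qed
    moreover have "0 \<le> ?L n" for n by simp
    ultimately have "?L n = 0" if "n \<ge> 1" for n
      using that by (meson antisym)
    then show ?thesis
      by (intro tendsto_eventually eventually_sequentiallyI[of 1]) auto
  next
    case False
    then have \<alpha>: "\<alpha> < 1" using alpha_range by auto
    show ?thesis
    proof (rule LIMSEQ_I)
      fix r :: real assume "r > 0"
      \<comment> \<open>Cutting according to the size of \<open>g x\<close>, not of
        \<open>x\<close>, keeps \<open>h\<close> even and bounded at once.\<close>
      define h where "h K x = g x * indicator {..real K} \<bar>g x\<bar>" for K :: nat and x
      have "(\<lambda>K. 2 * (\<integral>w. \<bar>g (\<xi> 1 w) - h K (\<xi> 1 w)\<bar> \<partial>M)) \<longlonglongrightarrow> 0"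
        using tendsto_mult_right_zero[OF truncation_limit[OF assms(1) int]] unfolding h_def by simp
      from order_tendstoD(2)[OF this, of "r / 2"] \<open>r > 0\<close> 
      obtain K where K: "2 * (\<integral>w. \<bar>g (\<xi> 1 w) - h K (\<xi> 1 w)\<bar> \<partial>M) < r / 2"
        by (auto simp: eventually_sequentially)
      have [measurable]: "h K \<in> borel_measurable borel" unfolding h_def by measurable
      have h: "h K (- x) = h K x" "\<bar>h K x\<bar> \<le> K" for x
        by (auto simp: h_def even indicator_def)
      have "integrable M (\<lambda>w. h K (\<xi> 1 w))"
        by (rule integrable_const_bound[of _ K]) (use h in auto)
      note approx' = approx[of "h K", OF \<open>h K \<in> borel_measurable borel\<close> h(1) this]
      from order_tendstoD(2)[OF even_LLN_bounded[of "h K" K, OF _ h \<alpha>], of "r / 2"] \<open>r > 0\<close>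
      obtain N where N: "(\<integral>w. \<bar>(\<Sum>j=1..n. h K (X j w)) - n * (\<integral>w. h K (\<xi> 1 w) \<partial>M)\<bar> \<partial>M) / n < r / 2"
        if "n \<ge> N" for n
        by (auto simp: eventually_sequentially)
      have "?L n < r" if "n \<ge> max N 1" for n
        using order.strict_trans1[OF approx' add_strict_mono[OF N K], of n] that
        unfolding field_sum_of_halves by simp
      then show "\<exists>no. \<forall>n\<ge>no. norm (?L n - 0) < r"
        by (intro exI[of _ "max N 1"]) auto
    qed
  qed
  then show ?thesis by (simp add: m_def)
qed

end

section \<open>One step of the characteristic function\<close>

lemma iexp_add: "iexp (x + y) = iexp x * iexp y"
  by (simp add: distrib_left exp_add)

lemma iexp_first_order: "cmod (iexp y - 1) \<le> \<bar>y\<bar>"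
  using iexp_approx1[of y 0] by simp

lemma iexp_second_order: "cmod (iexp y - (1 + \<i> * y)) \<le> y\<^sup>2 / 2"
  using iexp_approx1[of y 1] by (simp add: power2_eq_square)

text \<open>Two remainder estimates are combined: the cubic one is effective for small
  \<open>y\<close>, and the quadratic one keeps the expectation finite when only two moments
  exist.\<close>

lemma iexp_third_order: "cmod (iexp y - (1 + \<i> * of_real y - (of_real y)\<^sup>2 / 2)) \<le> min (y\<^sup>2) (\<bar>y\<bar> ^ 3)"
proof -
  have eq: "(\<Sum>k\<le>2. (\<i> * complex_of_real y) ^ k / fact k) = 1 + \<i> * of_real y - (of_real y)\<^sup>2 / 2"
    by (simp add: numeral_2_eq_2 power_mult_distrib)
  have "cmod (iexp y - (1 + \<i> * of_real y - (of_real y)\<^sup>2 / 2)) \<le> \<bar>y\<bar> ^ 3 / 6"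
    using iexp_approx1[of y 2] unfolding eq by (simp add: fact_numeral eval_nat_numeral)
  moreover have "\<bar>y\<bar> ^ 3 / 6 \<le> \<bar>y\<bar> ^ 3" by simp
  moreover have "cmod (iexp y - (1 + \<i> * of_real y - (of_real y)\<^sup>2 / 2)) \<le> y\<^sup>2"
    using iexp_approx2[of y 2] unfolding eq by (simp add: fact_numeral)
  ultimately show ?thesis by linarith
qed

text \<open>The function \<open>x^2 / 2 - x + 1 - exp (- x)\<close> vanishes at 0 and has derivative
  \<open>x - 1 + exp (- x)\<close>, which is nonnegative.\<close>

lemma exp_minus_second_order:
  fixes x :: real
  assumes "0 \<le> x"
  shows "\<bar>(1 - x) - exp (- x)\<bar> \<le> x\<^sup>2 / 2"
proof -
  have "0\<^sup>2 / 2 - 0 + 1 - exp (- 0) \<le> x\<^sup>2 / 2 - x + 1 - exp (- x)"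
    by (rule DERIV_nonneg_imp_nondecreasing[OF assms])
       (rule exI, rule conjI, (auto intro!: derivative_eq_intros)[1],
        use exp_ge_add_one_self[of "- _"] in \<open>auto simp: algebra_simps\<close>)
  then show ?thesis
    using exp_ge_add_one_self[of "- x"] by (auto simp: abs_le_iff)
qed

lemma norm_integral_diff_le:
  fixes A B :: "'a \<Rightarrow> 'b::{banach, second_countable_topology}"
  assumes "integrable M A" "integrable M B" "integrable M b" "\<And>x. norm (A x - B x) \<le> b x"
  shows "norm (integral\<^sup>L M A - integral\<^sup>L M B) \<le> integral\<^sup>L M b"
proof -
  have "norm (\<integral>x. A x - B x \<partial>M) \<le> (\<integral>x. norm (A x - B x) \<partial>M)"
    by (rule integral_norm_bound)
  also have "\<dots> \<le> integral\<^sup>L M b"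
    by (rule integral_mono) (use assms in auto)
  finally have "norm (\<integral>x. A x - B x \<partial>M) \<le> integral\<^sup>L M b" .
  then show ?thesis using assms by simp
qed

text \<open>The last condition excludes only \<open>p = 1\<close> with \<alpha> = 1, where
  \<open>c\<close> would be undefined. The middle one makes averages of squared steps converge to a
  constant when \<alpha> = 1.\<close>

locale square_integrable_walk = step_reinforced_walk +
  assumes xi_square: "integrable M (\<lambda>w. (\<xi> 1 w)\<^sup>2)"
    and alpha_one: "\<alpha> = 1 \<Longrightarrow> \<exists>c. AE w in M. \<bar>\<xi> 1 w\<bar> = c"
    and drift_less_1: "(2 * p - 1) * \<alpha> < 1"
begin

definition a :: real where "a = (2 * p - 1) * \<alpha>"
definition \<mu>1 :: real where "\<mu>1 = (\<integral>w. \<xi> 1 w \<partial>M)"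
definition \<mu>2 :: real where "\<mu>2 = (\<integral>w. (\<xi> 1 w)\<^sup>2 \<partial>M)"
text \<open>The fixed point of \<open>x \<mapsto> a * x + (1 - \<alpha>) * \<mu>1\<close>;
  subtracting it from the steps makes their drift purely linear.\<close>

definition c :: real where "c = (1 - \<alpha>) * \<mu>1 / (1 - a)"
text \<open>The limit in mean of the conditional second moments of
  \<open>X (n + 1) - c\<close>.\<close>

definition \<sigma>2 :: real where "\<sigma>2 = \<mu>2 - c\<^sup>2"

lemma a_less_1: "a < 1"
  using drift_less_1 by (simp add: a_def)

lemma c_eq: "c * (1 - a) = (1 - \<alpha>) * \<mu>1"
  using a_less_1 by (simp add: c_def)

lemma xi_integrable: "integrable M (\<xi> 1)"
  by (rule square_integrable_imp_integrable[OF xi_measurable[OF order_refl] xi_square])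

lemma shifted_square:
  "integrable M (\<lambda>w. (\<xi> 1 w - c)\<^sup>2)" "integrable M (\<lambda>w. (- \<xi> 1 w - c)\<^sup>2)"
  using integrable_square_add[OF xi_measurable[OF order_refl] _ xi_square, of "\<lambda>_. -c"]
    integrable_square_add[OF xi_measurable[OF order_refl] _ xi_square, of "\<lambda>_. c"]
  by (simp_all add: power2_commute[of "- _" c] add.commute)

sublocale walk_drift M \<xi> U \<gamma> \<rho> p \<alpha> X "\<lambda>x. x - c" a
proof unfold_locales
  fix x
  have "(\<integral>w. \<xi> 1 w - c \<partial>M) = \<mu>1 - c"
    using xi_integrable by (simp add: \<mu>1_def prob_space)
  moreover have "\<alpha> * p * (x - c) + \<alpha> * (1 - p) * (- x - c) + (1 - \<alpha>) * (\<mu>1 - c) = a * (x - c)"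
    using c_eq by (simp add: a_def algebra_simps)
  ultimately show "\<alpha> * p * (x - c) + \<alpha> * (1 - p) * (- x - c) + (1 - \<alpha>) * (\<integral>w. \<xi> 1 w - c \<partial>M) = a * (x - c)"
    by simp
qed (use shifted_square in auto)

text \<open>As \<open>a\<close> is at most \<alpha>, the factor
  \<open>(1 - \<alpha>) / (1 - a)\<close> lies between 0 and 1, so the square of \<open>c\<close> is
  at most that of \<open>\<mu>1\<close>, which is at most \<open>\<mu>2\<close>.\<close>

lemma sigma2_nonneg: "0 \<le> \<sigma>2"
proof -
  have "\<mu>1\<^sup>2 \<le> \<mu>2"
  proof -
    have "0 \<le> variance (\<xi> 1)" by (intro Bochner_Integration.integral_nonneg) auto
    then show ?thesis
      using xi_integrable xi_square by (subst (asm) variance_eq) (auto simp: \<mu>1_def \<mu>2_def)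
  qed
  moreover have "c\<^sup>2 \<le> \<mu>1\<^sup>2"
  proof -
    have "\<alpha> * p \<le> \<alpha>" using alpha_range p_range by (simp add: mult_left_le)
    then have "0 \<le> 1 - \<alpha>" "1 - \<alpha> \<le> 1 - a"
      using alpha_range by (auto simp: a_def algebra_simps)
    then have "\<bar>c\<bar> \<le> \<bar>\<mu>1\<bar>"
      using a_less_1 mult_right_mono[of "1 - \<alpha>" "1 - a" "\<bar>\<mu>1\<bar>"]
      by (simp add: c_def abs_mult pos_divide_le_eq mult.commute)
    then show ?thesis by (simp add: abs_le_square_iff)
  qed
  ultimately show ?thesis by (simp add: \<sigma>2_def)
qed

text \<open>The conditional second moment of \<open>X (n + 1) - c\<close> given the first \<open>n\<close> steps.\<close>

definition R :: "nat \<Rightarrow> 'a \<Rightarrow> real" where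
  "R n = step_mean (\<lambda>x. (x - c)\<^sup>2) n"

lemma R_measurable: "R n \<in> borel_measurable M"
  unfolding R_def by (rule step_mean_measurable) measurable

text \<open>Expanding \<open>(x - c)^2 = x^2 - 2 * c * (x - c) - c^2\<close> leaves an average of
  squares, which signs do not affect, and the drift of the centered walk. A law of large numbers is
  known for each.\<close>

lemma R_eq:
  assumes n: "n \<ge> 1"
  shows "R n w - \<sigma>2 = \<alpha> * ((\<Sum>j=1..n. (X j w)\<^sup>2) / n - \<mu>2) - 2 * c * (a / n * Q n w)"
proof -
  have e2: "(\<integral>w. (\<xi> 1 w - c)\<^sup>2 \<partial>M) = \<mu>2 - 2 * c * (\<integral>w. \<xi> 1 w - c \<partial>M) - c\<^sup>2"
    using xi_integrable xi_square
    by (simp add: power2_diff \<mu>2_def prob_space) (simp add: power2_eq_square algebra_simps)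
  have split: "(x - c)\<^sup>2 = x\<^sup>2 - 2 * c * (x - c) - c\<^sup>2" "(- x - c)\<^sup>2 = x\<^sup>2 - 2 * c * (- x - c) - c\<^sup>2" for x
    by (simp_all add: power2_eq_square algebra_simps)
  define s where "s = (\<Sum>j=1..n. \<alpha> * p * (X j w - c) + \<alpha> * (1 - p) * (- X j w - c))"
  have "(\<Sum>j=1..n. \<alpha> * p * (X j w - c)\<^sup>2 + \<alpha> * (1 - p) * (- X j w - c)\<^sup>2)
      = (\<Sum>j=1..n. \<alpha> * (X j w)\<^sup>2 - 2 * c * (\<alpha> * p * (X j w - c) + \<alpha> * (1 - p) * (- X j w - c)) - \<alpha> * c\<^sup>2)"
    unfolding split by (intro sum.cong refl) (simp add: algebra_simps)
  also have "\<dots> = \<alpha> * (\<Sum>j=1..n. (X j w)\<^sup>2) - 2 * c * s - n * (\<alpha> * c\<^sup>2)"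
    by (simp add: s_def sum_subtractf sum_distrib_left)
  finally have sum: "(\<Sum>j=1..n. \<alpha> * p * (X j w - c)\<^sup>2 + \<alpha> * (1 - p) * (- X j w - c)\<^sup>2)
      = \<alpha> * (\<Sum>j=1..n. (X j w)\<^sup>2) - 2 * c * s - n * (\<alpha> * c\<^sup>2)" .
  define v t e where "v = (\<Sum>j=1..n. (X j w)\<^sup>2) / n" and "t = s / n"
    and "e = (\<integral>w. \<xi> 1 w - c \<partial>M)"
  have "R n w = \<alpha> * v - 2 * c * t - \<alpha> * c\<^sup>2 + (1 - \<alpha>) * (\<mu>2 - 2 * c * e - c\<^sup>2)"
    unfolding R_def step_mean_def e2 sum v_def t_def e_def using n by (simp add: diff_divide_distrib)
  moreover have "t + (1 - \<alpha>) * e = a / n * Q n w"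
    using step_mean_eq[OF n, of w] unfolding step_mean_def s_def t_def e_def .
  ultimately show ?thesis
    unfolding \<sigma>2_def v_def[symmetric] by (simp only: flip: \<open>t + _ = _\<close>) (simp add: algebra_simps)
qed

lemma second_moment_LLN: "(\<lambda>n. \<integral>w. \<bar>(\<Sum>j=1..n. (X j w)\<^sup>2) / n - \<mu>2\<bar> \<partial>M) \<longlonglongrightarrow> 0"
  unfolding \<mu>2_def
proof (rule even_LLN)
  assume "\<alpha> = 1"
  then obtain c where c: "AE w in M. \<bar>\<xi> 1 w\<bar> = c" using alpha_one by blast
  have "AE w in M. (\<xi> 1 w)\<^sup>2 = c\<^sup>2"
    using c by eventually_elim (metis power2_abs)
  then show "\<exists>c. AE w in M. (\<xi> 1 w)\<^sup>2 = c" by blast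
qed (use xi_square in auto)

lemma X_square_integrable: "n \<ge> 1 \<Longrightarrow> integrable M (\<lambda>w. (X n w)\<^sup>2)"
  using even_expectation[of "\<lambda>x. x\<^sup>2" n] xi_square by simp

lemma Q_integrable: "integrable M (Q n)"
  by (rule square_integrable_imp_integrable[OF Q_measurable Q_square])

lemma R_integrable: "n \<ge> 1 \<Longrightarrow> integrable M (R n)"
proof -
  assume n: "n \<ge> 1"
  have "integrable M (\<lambda>w. (\<alpha> * ((\<Sum>j=1..n. (X j w)\<^sup>2) / n - \<mu>2) - 2 * c * (a / n * Q n w)) + \<sigma>2)"
    using X_square_integrable Q_integrable
    by (intro Bochner_Integration.integrable_add Bochner_Integration.integrable_diff
        integrable_mult_right integrable_divide Bochner_Integration.integrable_sum) auto
  then show ?thesis unfolding R_eq[OF n, symmetric] by simp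
qed

lemma R_limit: "(\<lambda>n. \<integral>w. \<bar>R n w - \<sigma>2\<bar> \<partial>M) \<longlonglongrightarrow> 0"
proof -
  let ?V = "\<lambda>n w. \<bar>(\<Sum>j=1..n. (X j w)\<^sup>2) / n - \<mu>2\<bar>"
  have "(\<lambda>n. \<alpha> * (\<integral>w. ?V n w \<partial>M) + 2 * \<bar>c * a\<bar> * ((\<integral>w. \<bar>Q n w\<bar> \<partial>M) / n)) \<longlonglongrightarrow> 0"
    using tendsto_add[OF tendsto_mult_right_zero[OF second_moment_LLN, of \<alpha>]
        tendsto_mult_right_zero[OF Q_abs_limit[OF a_less_1], of "2 * \<bar>c * a\<bar>"]] by simp
  then show ?thesis
  proof (rule tendsto_sandwich[OF _ _ tendsto_const, rotated 2])
    show "\<forall>\<^sub>F n in sequentially. 0 \<le> (\<integral>w. \<bar>R n w - \<sigma>2\<bar> \<partial>M)" by simp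
    show "\<forall>\<^sub>F n in sequentially. (\<integral>w. \<bar>R n w - \<sigma>2\<bar> \<partial>M)
        \<le> \<alpha> * (\<integral>w. ?V n w \<partial>M) + 2 * \<bar>c * a\<bar> * ((\<integral>w. \<bar>Q n w\<bar> \<partial>M) / n)"
    proof (rule eventually_sequentiallyI[of 1])
      fix n :: nat assume n: "n \<ge> 1"
      have V: "integrable M (?V n)"
        using X_square_integrable
        by (intro integrable_abs Bochner_Integration.integrable_diff integrable_divide
            Bochner_Integration.integrable_sum) auto
      have "(\<integral>w. \<bar>R n w - \<sigma>2\<bar> \<partial>M) \<le> (\<integral>w. \<alpha> * ?V n w + 2 * \<bar>c * a\<bar> / n * \<bar>Q n w\<bar> \<partial>M)"
      proof (rule integral_mono)
        fix w
        have "\<bar>R n w - \<sigma>2\<bar> \<le> \<bar>\<alpha> * ((\<Sum>j=1..n. (X j w)\<^sup>2) / n - \<mu>2)\<bar> + \<bar>2 * c * (a / n * Q n w)\<bar>"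
          unfolding R_eq[OF n] by (rule abs_triangle_ineq4)
        also have "\<dots> = \<alpha> * ?V n w + 2 * \<bar>c * a\<bar> / n * \<bar>Q n w\<bar>"
          using alpha_range by (simp add: abs_mult)
        finally show "\<bar>R n w - \<sigma>2\<bar> \<le> \<alpha> * ?V n w + 2 * \<bar>c * a\<bar> / n * \<bar>Q n w\<bar>" .
      qed (use V Q_integrable R_integrable[OF n] in auto)
      also have "\<dots> = \<alpha> * (\<integral>w. ?V n w \<partial>M) + 2 * \<bar>c * a\<bar> * ((\<integral>w. \<bar>Q n w\<bar> \<partial>M) / n)"
        using V Q_integrable by (subst Bochner_Integration.integral_add) auto
      finally show "(\<integral>w. \<bar>R n w - \<sigma>2\<bar> \<partial>M) \<le> \<dots>" .
    qed
  qed
qed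

text \<open>The bound of \<open>iexp_third_order\<close> at \<open>y = s * (x - c)\<close> after the
  factor \<open>s^2\<close> is taken out.\<close>

definition lindeberg :: "real \<Rightarrow> real \<Rightarrow> real" where
  "lindeberg s x = min ((x - c)\<^sup>2) (\<bar>s\<bar> * \<bar>x - c\<bar> ^ 3)"

text \<open>Both signs are added because a step agrees with \<open>\<xi> 1\<close> in law only up to
  its sign; the sum bounds the Taylor remainder at every step simultaneously.\<close>

definition \<Lambda> :: "real \<Rightarrow> real" where
  "\<Lambda> s = (\<integral>w. lindeberg s (\<xi> 1 w) + lindeberg s (- \<xi> 1 w) \<partial>M)"

lemma lindeberg_measurable [measurable]: "lindeberg s \<in> borel_measurable borel"
  unfolding lindeberg_def[abs_def] by measurable

lemma lindeberg_bounds: "0 \<le> lindeberg s x" "lindeberg s x \<le> (x - c)\<^sup>2"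
  by (auto simp: lindeberg_def)

lemma lindeberg_xi_integrable:
  "integrable M (\<lambda>w. lindeberg s (\<xi> 1 w))" "integrable M (\<lambda>w. lindeberg s (- \<xi> 1 w))"
proof -
  note [measurable] = xi_measurable[of "Suc 0"]
  show "integrable M (\<lambda>w. lindeberg s (\<xi> 1 w))"
    by (rule Bochner_Integration.integrable_bound[OF shifted_square(1)])
       (use lindeberg_bounds in auto)
  show "integrable M (\<lambda>w. lindeberg s (- \<xi> 1 w))"
    by (rule Bochner_Integration.integrable_bound[OF shifted_square(2)])
       (use lindeberg_bounds in auto)
qed

lemma lindeberg_X:
  assumes "n \<ge> 1"
  shows "integrable M (\<lambda>w. lindeberg s (X n w))" "(\<integral>w. lindeberg s (X n w) \<partial>M) \<le> \<Lambda> s"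
  using X_comp_integrable(1,3)[OF lindeberg_measurable lindeberg_xi_integrable assms, of s]
  by (simp_all add: \<Lambda>_def lindeberg_bounds)

text \<open>Dominated convergence with the second moments as majorant. This takes the place of a
  Lindeberg condition.\<close>

lemma Lambda_limit: "(\<Lambda> \<longlongrightarrow> 0) (at 0)"
  unfolding tendsto_at_iff_sequentially comp_def
proof safe
  fix s :: "nat \<Rightarrow> real" assume s: "s \<longlonglongrightarrow> 0"
  note [measurable] = xi_measurable[of "Suc 0"]
  have lim: "(\<lambda>n. lindeberg (s n) x) \<longlonglongrightarrow> 0" for x
  proof (rule tendsto_sandwich[OF _ _ tendsto_const])
    show "(\<lambda>n. \<bar>s n\<bar> * \<bar>x - c\<bar> ^ 3) \<longlonglongrightarrow> 0"
      using tendsto_mult_left_zero[OF tendsto_rabs_zero[OF s]] .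
  qed (auto simp: lindeberg_bounds, auto simp: lindeberg_def)
  have "(\<lambda>n. \<Lambda> (s n)) \<longlonglongrightarrow> (\<integral>w. 0 \<partial>M)"
    unfolding \<Lambda>_def
  proof (rule integral_dominated_convergence[where w = "\<lambda>w. (\<xi> 1 w - c)\<^sup>2 + (- \<xi> 1 w - c)\<^sup>2"])
    show "AE w in M. (\<lambda>n. lindeberg (s n) (\<xi> 1 w) + lindeberg (s n) (- \<xi> 1 w)) \<longlonglongrightarrow> 0"
      using tendsto_add[OF lim lim] by simp
    show "AE w in M. norm (lindeberg (s n) (\<xi> 1 w) + lindeberg (s n) (- \<xi> 1 w))
        \<le> (\<xi> 1 w - c)\<^sup>2 + (- \<xi> 1 w - c)\<^sup>2" for n
    proof (rule AE_I2)
      fix w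
      show "norm (lindeberg (s n) (\<xi> 1 w) + lindeberg (s n) (- \<xi> 1 w)) \<le> (\<xi> 1 w - c)\<^sup>2 + (- \<xi> 1 w - c)\<^sup>2"
        using lindeberg_bounds[of "s n" "\<xi> 1 w"] lindeberg_bounds[of "s n" "- \<xi> 1 w"] by simp
    qed
  qed (use shifted_square in auto)
  then show "(\<lambda>n. \<Lambda> (s n)) \<longlonglongrightarrow> 0" by simp
qed

text \<open>The limit at 0 gives no information about the point 0 itself, while zero arguments do
  occur later.\<close>

lemma Lambda_0: "\<Lambda> 0 = 0"
  by (simp add: \<Lambda>_def lindeberg_def min_absorb2)

abbreviation char_fun :: "('a \<Rightarrow> complex) \<Rightarrow> real \<Rightarrow> nat \<Rightarrow> complex" where
  "char_fun G s n \<equiv> \<integral>w. G w * iexp (s * Q n w) \<partial>M"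

text \<open>Given the past, the increment has mean \<open>a / n * Q n\<close> and second moment
  \<open>R n\<close>. The mean is moved into the exponent, where it turns \<open>s\<close> into
  \<open>s * (1 + a / n)\<close>, and \<open>R n\<close> is replaced by \<open>\<sigma>2\<close>.
  The five terms of the bound are, in order: the Taylor remainder, the square of the mean, the error
  in the second moment, the interaction of mean and variance, and the passage from
  \<open>1 - x\<close> to \<open>exp (- x)\<close>.\<close>

lemma one_step:
  fixes G :: "'a \<Rightarrow> complex" and s :: real
  assumes n: "n \<ge> 1" and G: "G \<in> borel_measurable (F n)" "\<And>w. cmod (G w) \<le> 1"
  defines "x \<equiv> s\<^sup>2 * \<sigma>2 / 2"
  shows "cmod (char_fun G s (n + 1) 
      - char_fun G (s * (1 + a / n)) n * exp (- x))
    \<le> s\<^sup>2 * (\<Lambda> s + a\<^sup>2 / 2 * ((\<integral>w. (Q n w)\<^sup>2 \<partial>M) / (real n)\<^sup>2) + (\<integral>w. \<bar>R n w - \<sigma>2\<bar> \<partial>M) / 2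
        + \<bar>s\<bar> * \<sigma>2 * \<bar>a\<bar> / 2 * ((\<integral>w. \<bar>Q n w\<bar> \<partial>M) / n) + s\<^sup>2 * \<sigma>2\<^sup>2 / 8)"
proof -
  define H where "H w = G w * iexp (s * Q n w)" for w
  define Y where "Y w = X (n + 1) w - c" for w
  define D where "D w = a / n * Q n w" for w
  have HF: "H \<in> borel_measurable (F n)"
    unfolding H_def using G(1) Q_measurable_F[of n] by measurable
  have H1: "cmod (H w) \<le> 1" for w using G(2) by (simp add: H_def norm_mult)
  have Yeq: "Y = (\<lambda>w. X (n + 1) w - c)" by (simp add: Y_def fun_eq_iff)
  have Ym: "Y \<in> borel_measurable M" and Y2: "integrable M (\<lambda>w. (Y w)\<^sup>2)"
    unfolding Yeq using f_X_measurable[of "n + 1"] f_X_square[of "n + 1"] by auto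
  have Y1: "integrable M Y" by (rule square_integrable_imp_integrable[OF Ym Y2])
  have Dm: "D \<in> borel_measurable M" and D1: "integrable M D" and D2: "integrable M (\<lambda>w. (D w)\<^sup>2)"
    unfolding D_def[abs_def] power_mult_distrib using Q_measurable[of n] Q_integrable[of n] Q_square[of n] by auto
  note [measurable] = measurable_F_M[OF HF] Ym Dm R_measurable
  have intH: "integrable M (\<lambda>w. H w * of_real (Z w))" if "integrable M Z" for Z :: "'a \<Rightarrow> real"
    by (rule Bochner_Integration.integrable_bound[OF that])
       (use H1 that in \<open>auto simp: norm_mult intro!: mult_left_le_one_le\<close>)
  have intHi: "integrable M (\<lambda>w. H w * iexp (Z w))" if [measurable]: "Z \<in> borel_measurable M" for Z :: "'a \<Rightarrow> real"
    by (rule integrable_const_bound[of _ 1]) (use H1 in \<open>auto simp: norm_mult\<close>)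
  have int0: "integrable M H" using intHi[of "\<lambda>_. 0"] by simp
  have poly: "(\<integral>w. H w * (1 + \<i> * of_real (s * Z1 w) - of_real (s\<^sup>2 / 2) * of_real (Z2 w)) \<partial>M)
      = expectation H + \<i> * of_real s * (\<integral>w. H w * of_real (Z1 w) \<partial>M) - of_real (s\<^sup>2 / 2) * (\<integral>w. H w * of_real (Z2 w) \<partial>M)"
    and poly_int: "integrable M (\<lambda>w. H w * (1 + \<i> * of_real (s * Z1 w) - of_real (s\<^sup>2 / 2) * of_real (Z2 w)))"
    if "integrable M Z1" "integrable M Z2" for Z1 Z2 :: "'a \<Rightarrow> real"
  proof -
    have eq: "H w * (1 + \<i> * of_real (s * Z1 w) - of_real (s\<^sup>2 / 2) * of_real (Z2 w))
      = H w + \<i> * of_real s * (H w * of_real (Z1 w)) - of_real (s\<^sup>2 / 2) * (H w * of_real (Z2 w))" for w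
      by (simp add: algebra_simps)
    show "integrable M (\<lambda>w. H w * (1 + \<i> * of_real (s * Z1 w) - of_real (s\<^sup>2 / 2) * of_real (Z2 w)))"
      unfolding eq using int0 intH[OF that(1)] intH[OF that(2)]
      by (intro Bochner_Integration.integrable_add Bochner_Integration.integrable_diff integrable_mult_right)
    show "(\<integral>w. H w * (1 + \<i> * of_real (s * Z1 w) - of_real (s\<^sup>2 / 2) * of_real (Z2 w)) \<partial>M)
      = expectation H + \<i> * of_real s * (\<integral>w. H w * of_real (Z1 w) \<partial>M) - of_real (s\<^sup>2 / 2) * (\<integral>w. H w * of_real (Z2 w) \<partial>M)"
      unfolding eq using int0 intH[OF that(1)] intH[OF that(2)]
      by (subst Bochner_Integration.integral_diff
            Bochner_Integration.integral_add, simp_all)+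
  qed
  \<comment> \<open>\<open>A\<close> is the exact integrand, \<open>B\<close> its second order
    expansion in \<open>s * Y\<close>, \<open>C\<close> has the powers of \<open>Y\<close> replaced
    by their conditional means, and \<open>E\<close> carries the shifted argument. In expectation,
    \<open>A\<close> is close to \<open>B\<close>, \<open>B\<close> equals \<open>C\<close>, and
    \<open>C\<close> is close to \<open>E * (1 - x)\<close>.\<close>
  define A where "A w = H w * iexp (s * Y w)" for w
  define B where "B w = H w * (1 + \<i> * of_real (s * Y w) - of_real (s\<^sup>2 / 2) * of_real ((Y w)\<^sup>2))" for w
  define C where "C w = H w * (1 + \<i> * of_real (s * D w) - of_real (s\<^sup>2 / 2) * of_real (R n w))" for w
  define E where "E w = H w * iexp (s * D w)" for w
  have intA: "integrable M A" unfolding A_def by (rule intHi) measurable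
  have intE: "integrable M E" unfolding E_def by (rule intHi) measurable
  have intB: "integrable M B" unfolding B_def by (rule poly_int[OF Y1 Y2])
  have intC: "integrable M C" unfolding C_def by (rule poly_int[OF D1 R_integrable[OF n]])
  have "integrable M (\<lambda>w. \<xi> 1 w - c)" "integrable M (\<lambda>w. - \<xi> 1 w - c)"
    using xi_integrable by (intro Bochner_Integration.integrable_diff integrable_minus; simp)+
  from expectation_step_mean_bounded[OF n HF H1 f_measurable this]
  have "(\<integral>w. H w * of_real (Y w) \<partial>M) = (\<integral>w. H w * of_real (D w) \<partial>M)"
    unfolding Y_def D_def step_mean_eq[OF n] .
  moreover have "(\<integral>w. H w * of_real ((Y w)\<^sup>2) \<partial>M) = (\<integral>w. H w * of_real (R n w) \<partial>M)"
    unfolding Y_def R_def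
    by (rule expectation_step_mean_bounded[OF n HF H1 _ f_square]) measurable
  \<comment> \<open>This equality is exact: \<open>H\<close> is a bounded test function depending on
    the past only, so \<open>Y\<close> and its square may be replaced by their conditional
    means.\<close>
  ultimately have BC: "expectation B = expectation C"
    unfolding B_def C_def poly[OF Y1 Y2] poly[OF D1 R_integrable[OF n]] by simp
  have AB: "cmod (expectation A - expectation B) \<le> s\<^sup>2 * \<Lambda> s"
  proof -
    have "cmod (expectation A - expectation B) \<le> (\<integral>w. s\<^sup>2 * lindeberg s (X (n + 1) w) \<partial>M)"
    proof (rule norm_integral_diff_le[OF intA intB])
      fix w
      have "A w - B w = H w * (iexp (s * Y w) - (1 + \<i> * of_real (s * Y w) - (of_real (s * Y w))\<^sup>2 / 2))"
        unfolding A_def B_def by (simp add: algebra_simps power_mult_distrib)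
      then have "cmod (A w - B w) \<le> 1 * cmod (iexp (s * Y w) - (1 + \<i> * of_real (s * Y w) - (of_real (s * Y w))\<^sup>2 / 2))"
        using H1 by (simp only: norm_mult mult_right_mono norm_ge_zero)
      also have "\<dots> \<le> min ((s * Y w)\<^sup>2) (\<bar>s * Y w\<bar> ^ 3)"
        using iexp_third_order[of "s * Y w"] by simp
      also have "\<dots> = s\<^sup>2 * lindeberg s (X (n + 1) w)"
      proof -
        have "\<bar>s\<bar> ^ 3 = s\<^sup>2 * \<bar>s\<bar>" using power_add[of "\<bar>s\<bar>" 2 1] by simp
        then show ?thesis
          by (simp add: lindeberg_def Y_def power_mult_distrib abs_mult min_mult_distrib_left mult.assoc)
      qed
      finally show "cmod (A w - B w) \<le> s\<^sup>2 * lindeberg s (X (n + 1) w)" .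
    qed (use lindeberg_X[of "n + 1"] in auto)
    also have "\<dots> \<le> s\<^sup>2 * \<Lambda> s"
      using lindeberg_X[of "n + 1" s] by (simp add: mult_left_mono)
    finally show ?thesis .
  qed
  have x: "0 \<le> x" using sigma2_nonneg by (simp add: x_def)
  have CE: "cmod (expectation C - expectation E * of_real (1 - x))
      \<le> s\<^sup>2 * (a\<^sup>2 / 2 * ((\<integral>w. (Q n w)\<^sup>2 \<partial>M) / (real n)\<^sup>2) + (\<integral>w. \<bar>R n w - \<sigma>2\<bar> \<partial>M) / 2
        + \<bar>s\<bar> * \<sigma>2 * \<bar>a\<bar> / 2 * ((\<integral>w. \<bar>Q n w\<bar> \<partial>M) / n))"
  proof -
    let ?b = "\<lambda>w. s\<^sup>2 / 2 * (D w)\<^sup>2 + (s\<^sup>2 / 2 * \<bar>R n w - \<sigma>2\<bar> + x * \<bar>s\<bar> * \<bar>D w\<bar>)"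
    have b: "integrable M ?b"
      using D1 D2 R_integrable[OF n] by auto
    have "cmod (expectation C - (\<integral>w. E w * of_real (1 - x) \<partial>M)) \<le> expectation ?b"
    proof (rule norm_integral_diff_le[OF intC _ b])
      show "integrable M (\<lambda>w. E w * of_real (1 - x))" using intE by simp
      fix w
      let ?e = "iexp (s * D w)"
      \<comment> \<open>Three discrepancies are separated: \<open>1 + i s D\<close> against its
        exponential, \<open>R n\<close> against \<open>\<sigma>2\<close>, and \<open>x\<close>
        against \<open>x\<close> times the exponential.\<close>
      have eq: "C w - E w * of_real (1 - x) = H w * (- (?e - (1 + \<i> * of_real (s * D w)))
          - (of_real (s\<^sup>2 / 2 * (R n w - \<sigma>2)) - of_real x * (?e - 1)))"
      proof -
        have "s\<^sup>2 / 2 * (R n w - \<sigma>2) = s\<^sup>2 / 2 * R n w - x"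
          by (simp add: x_def algebra_simps)
        then have r: "complex_of_real (s\<^sup>2 / 2 * (R n w - \<sigma>2))
            = of_real (s\<^sup>2 / 2) * of_real (R n w) - of_real x"
          by (simp only: of_real_mult of_real_diff)
        show ?thesis
          unfolding C_def E_def r of_real_diff of_real_1 by (simp only: algebra_simps mult_1 mult_1_right minus_diff_eq)
      qed
      have "cmod (C w - E w * of_real (1 - x)) \<le> 1 * cmod (- (?e - (1 + \<i> * of_real (s * D w)))
          - (of_real (s\<^sup>2 / 2 * (R n w - \<sigma>2)) - of_real x * (?e - 1)))"
        unfolding eq norm_mult by (rule mult_right_mono[OF H1 norm_ge_zero])
      also have "\<dots> \<le> cmod (- (?e - (1 + \<i> * of_real (s * D w))))
          + (cmod (of_real (s\<^sup>2 / 2 * (R n w - \<sigma>2))) + cmod (of_real x * (?e - 1)))"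
        by (intro order_trans[OF _ add_left_mono[OF norm_triangle_ineq4]])
           (simp only: mult_1 norm_triangle_ineq4)
      also have "\<dots> \<le> (s * D w)\<^sup>2 / 2 + (s\<^sup>2 / 2 * \<bar>R n w - \<sigma>2\<bar> + x * \<bar>s * D w\<bar>)"
        using iexp_second_order[of "s * D w"] mult_left_mono[OF iexp_first_order[of "s * D w"] x] x
        unfolding norm_minus_cancel norm_mult norm_of_real by (intro add_mono) (simp_all add: abs_mult)
      also have "\<dots> = ?b w"
        by (simp add: power_mult_distrib abs_mult)
      finally show "cmod (C w - E w * of_real (1 - x)) \<le> ?b w" .
    qed
    also have "expectation ?b = s\<^sup>2 / 2 * (\<integral>w. (D w)\<^sup>2 \<partial>M) + (s\<^sup>2 / 2 * (\<integral>w. \<bar>R n w - \<sigma>2\<bar> \<partial>M)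
        + x * \<bar>s\<bar> * (\<integral>w. \<bar>D w\<bar> \<partial>M))"
      using D1 D2 R_integrable[OF n] by simp
    also have "(\<integral>w. (D w)\<^sup>2 \<partial>M) = a\<^sup>2 * ((\<integral>w. (Q n w)\<^sup>2 \<partial>M) / (real n)\<^sup>2)"
      by (simp add: D_def power_mult_distrib power_divide)
    also have "(\<integral>w. \<bar>D w\<bar> \<partial>M) = \<bar>a\<bar> * ((\<integral>w. \<bar>Q n w\<bar> \<partial>M) / n)"
      by (simp add: D_def abs_mult)
    finally show ?thesis using intE by (simp add: x_def algebra_simps)
  qed
  have EE: "cmod (expectation E * of_real (1 - x) - expectation E * exp (- x)) \<le> s\<^sup>2 * (s\<^sup>2 * \<sigma>2\<^sup>2 / 8)"
  proof -
    have "cmod (expectation E - (\<integral>w. 0 \<partial>M)) \<le> (\<integral>w. 1 \<partial>M)"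
      by (rule norm_integral_diff_le[OF intE]) (use H1 in \<open>auto simp: E_def norm_mult\<close>)
    then have E1: "cmod (expectation E) \<le> 1" by (simp add: prob_space)
    have "expectation E * of_real (1 - x) - expectation E * exp (- x)
        = expectation E * of_real ((1 - x) - exp (- x))"
      by (simp add: algebra_simps exp_of_real)
    then have "cmod (expectation E * of_real (1 - x) - expectation E * exp (- x))
        \<le> 1 * \<bar>(1 - x) - exp (- x)\<bar>"
      using E1 by (simp only: norm_mult norm_of_real mult_right_mono abs_ge_zero)
    also have "\<dots> \<le> x\<^sup>2 / 2" using exp_minus_second_order[OF x] by simp
    also have "\<dots> = s\<^sup>2 * (s\<^sup>2 * \<sigma>2\<^sup>2 / 8)" by (simp add: x_def power2_eq_square)
    finally show ?thesis .
  qed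
  have Aeq: "A w = G w * iexp (s * Q (n + 1) w)" for w
  proof -
    have "s * Q (n + 1) w = s * Q n w + s * Y w" unfolding Q_Suc Y_def by (simp add: algebra_simps)
    then show ?thesis by (simp only: A_def H_def iexp_add mult.assoc)
  qed
  have Eeq: "E w = G w * iexp (s * (1 + a / n) * Q n w)" for w
  proof -
    have "s * (1 + a / n) * Q n w = s * Q n w + s * D w" by (simp add: D_def algebra_simps)
    then show ?thesis by (simp only: E_def H_def iexp_add mult.assoc)
  qed
  have AE: "char_fun G s (n + 1) = expectation A"
     "char_fun G (s * (1 + a / n)) n = expectation E"
    by (simp_all only: Aeq[symmetric] Eeq[symmetric])
  have "cmod (expectation A - expectation E * exp (- x))
      \<le> cmod (expectation A - expectation B) + (cmod (expectation B - expectation E * of_real (1 - x))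
        + cmod (expectation E * of_real (1 - x) - expectation E * exp (- x)))"
    using norm_triangle_ineq[of "expectation A - expectation B" "expectation B - expectation E * exp (- x)"]
      norm_triangle_ineq[of "expectation B - expectation E * of_real (1 - x)"
        "expectation E * of_real (1 - x) - expectation E * exp (- x)"] by simp
  also have "\<dots> \<le> s\<^sup>2 * \<Lambda> s + (s\<^sup>2 * (a\<^sup>2 / 2 * ((\<integral>w. (Q n w)\<^sup>2 \<partial>M) / (real n)\<^sup>2) + (\<integral>w. \<bar>R n w - \<sigma>2\<bar> \<partial>M) / 2
        + \<bar>s\<bar> * \<sigma>2 * \<bar>a\<bar> / 2 * ((\<integral>w. \<bar>Q n w\<bar> \<partial>M) / n)) + s\<^sup>2 * (s\<^sup>2 * \<sigma>2\<^sup>2 / 8))"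
    using AB CE[folded BC] EE by (intro add_mono)
  finally show ?thesis unfolding AE by (simp only: distrib_left add.assoc)
qed

end

section \<open>Stolz-Cesaro and the normalising products\<close>

text \<open>Increments of a monotone \<open>B\<close> have one sign, so their absolute values
  telescope without loss. Both directions are allowed because \<open>B\<close> increases in one
  Stolz theorem and decreases in the other.\<close>

lemma stolz_step_bound:
  fixes B z :: "nat \<Rightarrow> real"
  assumes "\<And>n. n \<ge> N \<Longrightarrow> \<bar>z (n + 1) - z n\<bar> \<le> \<epsilon> * \<bar>B (n + 1) - B n\<bar>"
    and "(\<forall>n\<ge>N. B n \<le> B (n + 1)) \<or> (\<forall>n\<ge>N. B (n + 1) \<le> B n)"
    and "N \<le> m" "m \<le> n"
  shows "\<bar>z n - z m\<bar> \<le> \<epsilon> * \<bar>B n - B m\<bar>"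
  using \<open>m \<le> n\<close>
proof (induction n rule: dec_induct)
  case (step n)
  have mono: "B m \<le> B n \<and> B n \<le> B (n + 1) \<or> B n \<le> B m \<and> B (n + 1) \<le> B n"
  proof -
    have "B m \<le> B n" if "\<forall>n\<ge>N. B n \<le> B (n + 1)"
      using step.hyps(1) by (induction n rule: dec_induct)
        (use that assms(3) in \<open>auto intro: order_trans\<close>)
    moreover have "B n \<le> B m" if "\<forall>n\<ge>N. B (n + 1) \<le> B n"
      using step.hyps(1) by (induction n rule: dec_induct)
        (use that assms(3) in \<open>auto intro: order_trans\<close>)
    ultimately show ?thesis using assms(2,3) step.hyps by auto
  qed
  have "\<bar>z (n + 1) - z m\<bar> \<le> \<epsilon> * \<bar>B (n + 1) - B n\<bar> + \<epsilon> * \<bar>B n - B m\<bar>"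
    using assms(1)[of n] step assms(3) by linarith
  also have "\<dots> = \<epsilon> * (\<bar>B (n + 1) - B n\<bar> + \<bar>B n - B m\<bar>)" by (simp add: distrib_left)
  also have "\<bar>B (n + 1) - B n\<bar> + \<bar>B n - B m\<bar> = \<bar>B (n + 1) - B m\<bar>"
    using mono by linarith
  finally show ?case by simp
qed simp

text \<open>Passing to \<open>y - L * B\<close> converts the limit of the difference quotient into
  the hypothesis of \<open>stolz_step_bound\<close>.\<close>

lemma stolz_difference:
  fixes B y :: "nat \<Rightarrow> real"
  assumes "(\<lambda>n. (y (n + 1) - y n) / (B (n + 1) - B n)) \<longlonglongrightarrow> L"
    and "\<forall>\<^sub>F n in sequentially. B (n + 1) \<noteq> B n" and "\<epsilon> > 0"
  shows "\<forall>\<^sub>F n in sequentially. \<bar>(y (n + 1) - L * B (n + 1)) - (y n - L * B n)\<bar> \<le> \<epsilon> * \<bar>B (n + 1) - B n\<bar>"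
proof -
  have "\<forall>\<^sub>F n in sequentially. \<bar>(y (n + 1) - y n) / (B (n + 1) - B n) - L\<bar> < \<epsilon>"
    using tendstoD[OF assms(1,3)] by (simp add: dist_real_def)
  with assms(2) show ?thesis
  proof eventually_elim
    case (elim n)
    define d where "d = B (n + 1) - B n"
    have "d \<noteq> 0" using elim(1) by (simp add: d_def)
    have "(y (n + 1) - L * B (n + 1)) - (y n - L * B n) = ((y (n + 1) - y n) / d - L) * d"
    proof -
      have "(y (n + 1) - L * B (n + 1)) - (y n - L * B n) = (y (n + 1) - y n) - L * d"
        by (simp add: d_def algebra_simps)
      moreover have "(u / d - L) * d = u - L * d" for u
        using \<open>d \<noteq> 0\<close> by (simp add: left_diff_distrib)
      ultimately show ?thesis by simp
    qed
    then show ?case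
      using elim(2) unfolding d_def[symmetric] by (simp add: abs_mult mult_right_mono)
  qed
qed

text \<open>For \<open>z = y - L * B\<close>, late increments are at most \<open>r / 2\<close> times
  those of \<open>B\<close>, and the value of \<open>z\<close> at the starting index is negligible
  because \<open>B\<close> is unbounded.\<close>

lemma stolz_cesaro_top:
  fixes B y :: "nat \<Rightarrow> real"
  assumes lim: "(\<lambda>n. (y (n + 1) - y n) / (B (n + 1) - B n)) \<longlonglongrightarrow> L"
    and mono: "\<forall>\<^sub>F n in sequentially. B n < B (n + 1)" and top: "filterlim B at_top sequentially"
  shows "(\<lambda>n. y n / B n) \<longlonglongrightarrow> L"
proof (rule LIMSEQ_I)
  fix r :: real assume r: "r > 0"
  define z where "z n = y n - L * B n" for n
  have "\<forall>\<^sub>F n in sequentially. B (n + 1) \<noteq> B n" using mono by eventually_elim simp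
  from stolz_difference[OF lim this, of "r / 2"] r
  have "\<forall>\<^sub>F n in sequentially. \<bar>z (n + 1) - z n\<bar> \<le> r / 2 * \<bar>B (n + 1) - B n\<bar>"
    by (simp add: z_def)
  moreover have "\<forall>\<^sub>F n in sequentially. B n > 0" using top by (simp add: filterlim_at_top_dense)
  ultimately have "\<forall>\<^sub>F n in sequentially. B n > 0 \<and> B n < B (n + 1) \<and> \<bar>z (n + 1) - z n\<bar> \<le> r / 2 * \<bar>B (n + 1) - B n\<bar>"
    using mono by eventually_elim simp
  then obtain N where N: "\<And>n. n \<ge> N \<Longrightarrow> B n > 0 \<and> B n < B (n + 1) \<and> \<bar>z (n + 1) - z n\<bar> \<le> r / 2 * \<bar>B (n + 1) - B n\<bar>"
    unfolding eventually_sequentially by blast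
  have bound: "\<bar>z n\<bar> \<le> \<bar>z N\<bar> + r / 2 * B n" if "n \<ge> N" for n
  proof -
    have "\<bar>z n - z N\<bar> \<le> r / 2 * \<bar>B n - B N\<bar>"
      by (rule stolz_step_bound[of N]) (use N that in \<open>auto intro: less_imp_le\<close>)
    moreover have "B N \<le> B n"
      using that by (induction n rule: dec_induct) (use N in \<open>auto intro: order_trans less_imp_le\<close>)
    then have "r / 2 * \<bar>B n - B N\<bar> \<le> r / 2 * B n" using r N[of N] by (intro mult_left_mono) auto
    ultimately show ?thesis by linarith
  qed
  have "\<forall>\<^sub>F n in sequentially. B n > 2 * \<bar>z N\<bar> / r" using top by (simp add: filterlim_at_top_dense)
  then obtain N' where N': "\<And>n. n \<ge> N' \<Longrightarrow> B n > 2 * \<bar>z N\<bar> / r"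
    unfolding eventually_sequentially by blast
  show "\<exists>no. \<forall>n\<ge>no. norm (y n / B n - L) < r"
  proof (intro exI[of _ "max N N'"] allI impI)
    fix n assume n: "max N N' \<le> n"
    then have B: "B n > 0" "\<bar>z N\<bar> < r / 2 * B n" using N[of n] N'[of n] r by (auto simp: field_simps)
    then have "\<bar>z n\<bar> < r * B n" using bound[of n] n by auto
    moreover have "y n / B n - L = z n / B n" using B by (simp add: z_def field_simps)
    ultimately show "norm (y n / B n - L) < r" using B by (simp add: pos_divide_less_eq)
  qed
qed

text \<open>Here \<open>z = y - L * B\<close> is estimated from infinity: both \<open>z\<close> and
  \<open>B\<close> vanish there, so letting the far end of the telescoped bound tend to infinity
  controls \<open>z n\<close> by \<open>B n\<close>.\<close>

lemma stolz_cesaro_zero: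
  fixes B y :: "nat \<Rightarrow> real"
  assumes lim: "(\<lambda>n. (y (n + 1) - y n) / (B (n + 1) - B n)) \<longlonglongrightarrow> L"
    and mono: "\<forall>\<^sub>F n in sequentially. B (n + 1) < B n" and B0: "B \<longlonglongrightarrow> 0" and y0: "y \<longlonglongrightarrow> 0"
  shows "(\<lambda>n. y n / B n) \<longlonglongrightarrow> L"
proof (rule LIMSEQ_I)
  fix r :: real assume r: "r > 0"
  define z where "z n = y n - L * B n" for n
  have "\<forall>\<^sub>F n in sequentially. B (n + 1) \<noteq> B n" using mono by eventually_elim simp
  from stolz_difference[OF lim this, of "r / 2"] r
  have "\<forall>\<^sub>F n in sequentially. \<bar>z (n + 1) - z n\<bar> \<le> r / 2 * \<bar>B (n + 1) - B n\<bar>"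
    by (simp add: z_def)
  with mono have "\<forall>\<^sub>F n in sequentially. B (n + 1) < B n \<and> \<bar>z (n + 1) - z n\<bar> \<le> r / 2 * \<bar>B (n + 1) - B n\<bar>"
    by eventually_elim simp
  then obtain N where N: "\<And>n. n \<ge> N \<Longrightarrow> B (n + 1) < B n \<and> \<bar>z (n + 1) - z n\<bar> \<le> r / 2 * \<bar>B (n + 1) - B n\<bar>"
    unfolding eventually_sequentially by blast
  have z0: "z \<longlonglongrightarrow> 0" unfolding z_def[abs_def] using tendsto_diff[OF y0 tendsto_mult_right_zero[OF B0]] by simp
  \<comment> \<open>A strictly decreasing sequence with limit 0 is positive.\<close>
  have pos: "B n > 0" if "n \<ge> N" for n
  proof -
    have le: "B m \<le> B (n + 1)" if "n + 1 \<le> m" for m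
      using that
    proof (induction m rule: dec_induct)
      case (step m)
      then show ?case using N[of m] \<open>n \<ge> N\<close> by simp
    qed simp
    have "0 \<le> B (n + 1)"
      by (rule LIMSEQ_le_const2[OF B0]) (use le in blast)
    then show ?thesis using N[OF that] by linarith
  qed
  show "\<exists>no. \<forall>n\<ge>no. norm (y n / B n - L) < r"
  proof (intro exI[of _ N] allI impI)
    fix n assume n: "N \<le> n"
    have "\<bar>z n - 0\<bar> \<le> r / 2 * \<bar>B n - 0\<bar>"
    proof (rule tendsto_le[OF sequentially_bot])
      show "(\<lambda>m. r / 2 * \<bar>B n - B m\<bar>) \<longlonglongrightarrow> r / 2 * \<bar>B n - 0\<bar>" by (intro tendsto_intros B0)
      show "(\<lambda>m. \<bar>z n - z m\<bar>) \<longlonglongrightarrow> \<bar>z n - 0\<bar>" by (intro tendsto_intros z0)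
      show "\<forall>\<^sub>F m in sequentially. \<bar>z n - z m\<bar> \<le> r / 2 * \<bar>B n - B m\<bar>"
        by (rule eventually_sequentiallyI[of n], subst (1 2) abs_minus_commute,
            rule stolz_step_bound[of N]) (use N n in \<open>auto intro: less_imp_le\<close>)
    qed
    then have "\<bar>z n\<bar> < r * B n" using pos[OF n] r by (simp add: mult_pos_pos)
        (smt (verit) mult_pos_pos field_sum_of_halves)
    moreover have "y n / B n - L = z n / B n" using pos[OF n] by (simp add: z_def field_simps)
    ultimately show "norm (y n / B n - L) < r" using pos[OF n] by (simp add: pos_divide_less_eq)
  qed
qed

section \<open>Asymptotics of the normalising products\<close>

lemma abs_exp_minus_one_le:
  fixes u :: real
  assumes "\<bar>u\<bar> \<le> 1 / 2"
  shows "\<bar>exp u - 1\<bar> \<le> 2 * \<bar>u\<bar>"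
proof -
  have "exp u * (1 - u) \<le> exp u * exp (- u)"
    using exp_ge_add_one_self[of "- u"] by (intro mult_left_mono) auto
  then have le: "exp u * (1 - u) \<le> 1" by (simp flip: exp_add)
  have "exp u - 1 \<le> 2 * \<bar>u\<bar>"
  proof (cases "u \<ge> 0")
    case True
    have "1 \<le> (1 + 2 * u) * (1 - u)" using True assms mult_nonneg_nonneg[of u "1 - 2 * u"] by (simp add: algebra_simps)
    with le have "exp u * (1 - u) \<le> (1 + 2 * u) * (1 - u)" by simp
    then have "exp u \<le> 1 + 2 * u" using assms by (subst (asm) mult_le_cancel_right) auto
    then show ?thesis using True by simp
  next
    case False
    then have "exp u \<le> 1" by simp
    then show ?thesis by linarith
  qed
  then show ?thesis using exp_ge_add_one_self[of u] by linarith
qed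

text \<open>The product starts at 2 because the factor with index 1 vanishes for \<open>a = - 1\<close>.\<close>

definition growth :: "real \<Rightarrow> nat \<Rightarrow> real" where
  "growth a n = (\<Prod>j=2..<n. 1 + a / real j)"

lemma growth_2: "growth a 2 = 1"
  by (simp add: growth_def)

lemma growth_Suc: "n \<ge> 2 \<Longrightarrow> growth a (n + 1) = growth a n * (1 + a / n)"
  by (simp add: growth_def)

lemma growth_factor_pos: "a \<ge> - 1 \<Longrightarrow> n \<ge> 2 \<Longrightarrow> 1 + a / real n > 0"
  by (simp add: field_simps)

lemma growth_pos: "a \<ge> - 1 \<Longrightarrow> growth a n > 0"
  unfolding growth_def by (intro prod_pos) (auto simp: growth_factor_pos)

lemma growth_mono: "a \<ge> 0 \<Longrightarrow> 2 \<le> m \<Longrightarrow> m \<le> n \<Longrightarrow> growth a m \<le> growth a n"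
proof (rotate_tac 2, induction n rule: dec_induct)
  case (step n)
  have "growth a n * 1 \<le> growth a n * (1 + a / n)"
    using step growth_pos[of a n] by (intro mult_left_mono) auto
  then show ?case using step growth_Suc[of n a] by simp
qed simp

lemma growth_antimono: "- 1 \<le> a \<Longrightarrow> a \<le> 0 \<Longrightarrow> 2 \<le> m \<Longrightarrow> m \<le> n \<Longrightarrow> growth a n \<le> growth a m"
proof (rotate_tac 3, induction n rule: dec_induct)
  case (step n)
  have "growth a n * (1 + a / n) \<le> growth a n * 1"
    using step growth_pos[of a n] by (intro mult_left_mono) (auto simp: divide_nonpos_nonneg)
  then show ?case using step growth_Suc[of n a] by simp
qed simp

text \<open>The products start at 1 and are monotone, upwards or downwards according to the sign of
  \<open>a\<close>. The bound makes the arguments \<open>\<tau> / q k\<close> small uniformly in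
  \<open>k\<close>.\<close>

lemma growth_ratio_le:
  assumes "a \<ge> - 1" "2 \<le> k" "k \<le> n"
  shows "growth a n / growth a k \<le> max 1 (growth a n)"
proof (cases "a \<ge> 0")
  case True
  have "1 \<le> growth a k" using growth_mono[OF True order_refl assms(2)] by (simp add: growth_2)
  then have "growth a n / growth a k \<le> growth a n / 1"
    using growth_pos[OF assms(1), of n] by (intro divide_left_mono) auto
  then show ?thesis by simp
next
  case False
  then have "growth a n / growth a k \<le> 1"
    using growth_antimono[of a k n] growth_pos[OF assms(1), of k] assms by simp
  then show ?thesis by simp
qed

text \<open>The logarithm of the quotient has increments of order \<open>1 / n^2\<close>, so it
  converges with error of order \<open>1 / n\<close>, which beats the factor \<open>sqrt n\<close>.
  The limit is \<open>1 / Gamma (a + 2)\<close>. The rate allows \<open>q n\<close> to be exchanged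
  for a power of \<open>n\<close> in the supercritical fluctuations.\<close>

lemma growth_asymptotics:
  assumes a: "a \<ge> - 1"
  obtains C where "C > 0" "(\<lambda>n. growth a n / real n powr a) \<longlonglongrightarrow> C"
    "(\<lambda>n. sqrt n * (growth a n / real n powr a - C)) \<longlonglongrightarrow> 0"
proof -
  define l where "l n = ln (growth a n) - a * ln n" for n
  have l_Suc: "l (n + 1) - l n = ln (1 + a / n) - a * ln (1 + 1 / n)" if "n \<ge> 2" for n
  proof -
    have "ln (growth a (n + 1)) = ln (growth a n) + ln (1 + a / n)"
      unfolding growth_Suc[OF that] using growth_pos[OF a, of n] growth_factor_pos[OF a that]
      by (simp add: ln_mult)
    moreover have "ln (real (n + 1)) = ln (real n) + ln (1 + 1 / n)"
    proof -
      have "real (n + 1) = real n * (1 + 1 / n)" using that by (simp add: field_simps)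
      moreover have "0 < 1 + 1 / real n" by (simp add: add_pos_nonneg)
      ultimately show ?thesis using that ln_mult[of "real n" "1 + 1 / n"] by simp
    qed
    ultimately show ?thesis by (simp add: l_def algebra_simps)
  qed
  have "(\<lambda>n::nat. ln (1 + a / n) - a * ln (1 + 1 / n)) \<in> O(\<lambda>n. 1 / (real n)\<^sup>2)"
    by real_asymp
  then obtain K where K: "K > 0" "\<forall>\<^sub>F n::nat in sequentially. norm (ln (1 + a / n) - a * ln (1 + 1 / n)) \<le> K * norm (1 / (real n)\<^sup>2)"
    by (elim landau_o.bigE)
  then obtain N where N: "\<And>n::nat. n \<ge> N \<Longrightarrow> \<bar>ln (1 + a / n) - a * ln (1 + 1 / n)\<bar> \<le> K * (1 / (real n)\<^sup>2)"
    unfolding eventually_sequentially by auto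
  define N' where "N' = max N 2"
  \<comment> \<open>A telescoping majorant: its increments \<open>1 / (n * (n - 1))\<close> dominate
    \<open>1 / n^2\<close>.\<close>
  define B where "B n = - (1 / (real n - 1))" for n :: nat
  have stepB: "\<bar>l (n + 1) - l n\<bar> \<le> K * \<bar>B (n + 1) - B n\<bar>" "B n \<le> B (n + 1)" if "n \<ge> N'" for n
  proof -
    have n: "n \<ge> N" "n \<ge> 2" using that by (auto simp: N'_def)
    have B: "B (n + 1) - B n = 1 / (real n * (real n - 1))" using n by (simp add: B_def field_simps)
    have "0 < real n * (real n - 1)" "real n * (real n - 1) \<le> (real n)\<^sup>2" using n by (auto simp: power2_eq_square)
    then have B2: "1 / (real n)\<^sup>2 \<le> B (n + 1) - B n" "0 \<le> B (n + 1) - B n" unfolding B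
      using frac_le[of 1 1 "real n * (real n - 1)" "(real n)\<^sup>2"] by simp_all
    show "B n \<le> B (n + 1)" using B2 by simp
    have "\<bar>l (n + 1) - l n\<bar> \<le> K * (1 / (real n)\<^sup>2)" using N[OF n(1)] l_Suc[OF n(2)] by simp
    also have "\<dots> \<le> K * (B (n + 1) - B n)" using B2 K by (intro mult_left_mono) auto
    finally show "\<bar>l (n + 1) - l n\<bar> \<le> K * \<bar>B (n + 1) - B n\<bar>" using B2 by simp
  qed
  have diff: "\<bar>l n - l m\<bar> \<le> K * (1 / (real m - 1))" if "N' \<le> m" "m \<le> n" for m n
  proof -
    have "\<bar>l n - l m\<bar> \<le> K * \<bar>B n - B m\<bar>"
      by (rule stolz_step_bound[of N']) (use that stepB in auto)
    also have "\<bar>B n - B m\<bar> \<le> 1 / (real m - 1)"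
    proof -
      have m: "m \<ge> 2" using that by (auto simp: N'_def)
      then have "1 / (real n - 1) \<le> 1 / (real m - 1)" "0 \<le> 1 / (real n - 1)" using that
        by (auto intro!: divide_left_mono)
      then show ?thesis unfolding B_def by linarith
    qed
    finally show ?thesis using K by (simp add: mult_left_mono)
  qed
  have lim0: "(\<lambda>m::nat. K * (1 / (real m - 1))) \<longlonglongrightarrow> 0" by real_asymp
  have "Cauchy l"
  proof (rule metric_CauchyI)
    fix e :: real assume "e > 0"
    from order_tendstoD(2)[OF lim0, of "e / 2"] this
    obtain m where m: "K * (1 / (real m - 1)) < e / 2" "m \<ge> N'"
      unfolding eventually_sequentially by (metis half_gt_zero_iff linorder_le_cases)
    have "dist (l n) (l k) < e" if "n \<ge> m" "k \<ge> m" for n k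
      using diff[OF m(2) that(1)] diff[OF m(2) that(2)] m(1)
      unfolding dist_real_def by linarith
    then show "\<exists>M. \<forall>m\<ge>M. \<forall>n\<ge>M. dist (l m) (l n) < e" by blast
  qed
  then obtain lam where lam: "l \<longlonglongrightarrow> lam" using Cauchy_convergent_iff convergent_def by blast
  have rate: "\<bar>l m - lam\<bar> \<le> K * (1 / (real m - 1))" if "m \<ge> N'" for m
  proof (rule tendsto_upperbound[of "\<lambda>n. \<bar>l n - l m\<bar>" _ sequentially])
    show "(\<lambda>n. \<bar>l n - l m\<bar>) \<longlonglongrightarrow> \<bar>l m - lam\<bar>"
      by (subst abs_minus_commute) (intro tendsto_intros lam)
    show "\<forall>\<^sub>F n in sequentially. \<bar>l n - l m\<bar> \<le> K * (1 / (real m - 1))"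
      using diff[OF that] by (intro eventually_sequentiallyI[of m]) auto
  qed simp
  have expl: "growth a n / real n powr a = exp (l n)" if "n \<ge> 1" for n
    using that growth_pos[OF a, of n] by (simp add: l_def exp_diff powr_def)
  show thesis
  proof (rule that[of "exp lam"])
    show "(\<lambda>n. growth a n / real n powr a) \<longlonglongrightarrow> exp lam"
      by (rule Lim_transform_eventually[OF tendsto_exp[OF lam]])
         (use expl in \<open>auto intro!: eventually_sequentiallyI[of 1]\<close>)
    have "(\<lambda>n::nat. 2 * exp lam * K * (sqrt n * (1 / (real n - 1)))) \<longlonglongrightarrow> 0"
      by real_asymp
    then show "(\<lambda>n. sqrt n * (growth a n / real n powr a - exp lam)) \<longlonglongrightarrow> 0"
    proof (rule Lim_null_comparison[rotated])
      have "\<forall>\<^sub>F n in sequentially. \<bar>l n - lam\<bar> < 1 / 2"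
        using tendstoD[OF lam, of "1 / 2"] by (simp add: dist_real_def)
      moreover have "\<forall>\<^sub>F n in sequentially. n \<ge> max N' 1" by (rule eventually_ge_at_top)
      ultimately show "\<forall>\<^sub>F n in sequentially. norm (sqrt n * (growth a n / real n powr a - exp lam))
          \<le> 2 * exp lam * K * (sqrt n * (1 / (real n - 1)))"
      proof eventually_elim
        case (elim n)
        have "\<bar>growth a n / real n powr a - exp lam\<bar> = exp lam * \<bar>exp (l n - lam) - 1\<bar>"
        proof -
          have "exp (l n) - exp lam = exp lam * (exp (l n - lam) - 1)"
            by (simp add: right_diff_distrib exp_diff)
          then show ?thesis using expl[of n] elim(2) by (simp add: abs_mult)
        qed
        also have "\<dots> \<le> exp lam * (2 * (K * (1 / (real n - 1))))"
          using abs_exp_minus_one_le[of "l n - lam"] rate[of n] elim by (intro mult_left_mono) auto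
        finally have "sqrt n * \<bar>growth a n / real n powr a - exp lam\<bar> \<le> sqrt n * (exp lam * (2 * (K * (1 / (real n - 1)))))"
          by (rule mult_left_mono) simp
        then show ?case by (simp add: abs_mult mult_ac)
      qed
    qed
  qed simp
qed

text \<open>Multiplied by \<open>\<tau>^2\<close> this is the sum of squared arguments
  \<open>(\<tau> / q k)^2\<close> along the iteration, hence, up to the factor
  \<open>\<sigma>2\<close>, the accumulated variance.\<close>

definition growth_sum :: "real \<Rightarrow> nat \<Rightarrow> real" where
  "growth_sum a n = (\<Sum>k=2..<n. 1 / (growth a (k + 1))\<^sup>2)"

lemma growth_sum_Suc: "n \<ge> 2 \<Longrightarrow> growth_sum a (n + 1) - growth_sum a n = 1 / (growth a (n + 1))\<^sup>2"
  by (simp add: growth_sum_def)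

text \<open>In the applications \<open>d\<close> is the increment of an explicit comparison
  sequence, so that Stolz quotients reduce to asymptotics of powers.\<close>

lemma growth_inverse_square_limit:
  assumes "C > 0" "(\<lambda>n. growth a n / real n powr a) \<longlonglongrightarrow> C"
    and "(\<lambda>n::nat. real (n + 1) powr (- 2 * a) / d n) \<longlonglongrightarrow> 1"
  shows "(\<lambda>n. 1 / (growth a (n + 1))\<^sup>2 / d n) \<longlonglongrightarrow> 1 / C\<^sup>2"
proof -
  have "(\<lambda>n. 1 / (growth a (n + 1) / real (n + 1) powr a)\<^sup>2 * (real (n + 1) powr (- 2 * a) / d n)) \<longlonglongrightarrow> 1 / C\<^sup>2 * 1"
    using assms(1) LIMSEQ_ignore_initial_segment[OF assms(2), of 1]
    by (intro tendsto_intros assms(3)) auto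
  moreover have "1 / (growth a (n + 1) / real (n + 1) powr a)\<^sup>2 * (real (n + 1) powr (- 2 * a) / d n)
      = 1 / (growth a (n + 1))\<^sup>2 / d n" for n
  proof -
    define w where "w = real (n + 1) powr a"
    have "real (n + 1) powr (- 2 * a) = inverse (w\<^sup>2)"
      by (simp add: w_def powr_power powr_minus mult.commute)
    moreover have "w > 0" by (simp add: w_def)
    ultimately show ?thesis
      unfolding w_def[symmetric] by (simp add: power_divide field_simps)
  qed
  ultimately show ?thesis by simp
qed

text \<open>The sum behaves like \<open>n powr (1 - 2 * a) / (C^2 * (1 - 2 * a))\<close> and the
  prefactor like \<open>C^2 * n powr (2 * a - 1)\<close>, so \<open>C\<close> cancels.\<close>

lemma growth_sum_subcritical:
  assumes a: "- 1 \<le> a" "a < 1 / 2"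
  shows "(\<lambda>n. (growth a n)\<^sup>2 / n * growth_sum a n) \<longlonglongrightarrow> 1 / (1 - 2 * a)"
proof -
  obtain C where C: "C > 0" "(\<lambda>n. growth a n / real n powr a) \<longlonglongrightarrow> C"
    using growth_asymptotics[OF a(1)] by blast
  define B where "B n = real n powr (1 - 2 * a) / (1 - 2 * a)" for n :: nat
  have "(\<lambda>n::nat. real (n + 1) powr (- 2 * a) / (B (n + 1) - B n)) \<longlonglongrightarrow> 1"
    unfolding B_def using a by real_asymp
  from growth_inverse_square_limit[OF C this]
  have "(\<lambda>n. (growth_sum a (n + 1) - growth_sum a n) / (B (n + 1) - B n)) \<longlonglongrightarrow> 1 / C\<^sup>2"
    by (rule Lim_transform_eventually) (use growth_sum_Suc in \<open>auto intro!: eventually_sequentiallyI[of 2]\<close>)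
  moreover have "\<forall>\<^sub>F n in sequentially. B n < B (n + 1)"
    unfolding B_def
    by (intro always_eventually allI divide_strict_right_mono powr_less_mono2) (use a in auto)
  moreover have "filterlim B at_top sequentially" unfolding B_def using a by real_asymp
  ultimately have "(\<lambda>n. growth_sum a n / B n) \<longlonglongrightarrow> 1 / C\<^sup>2" by (rule stolz_cesaro_top)
  then have "(\<lambda>n. (growth a n / real n powr a)\<^sup>2 * (growth_sum a n / B n) * (1 / (1 - 2 * a))) \<longlonglongrightarrow> C\<^sup>2 * (1 / C\<^sup>2) * (1 / (1 - 2 * a))"
    by (intro tendsto_mult tendsto_power tendsto_const C)
  moreover have "\<forall>\<^sub>F n in sequentially. (growth a n / real n powr a)\<^sup>2 * (growth_sum a n / B n) * (1 / (1 - 2 * a))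
      = (growth a n)\<^sup>2 / n * growth_sum a n"
  proof (rule eventually_sequentiallyI[of 1])
    fix n :: nat assume n: "n \<ge> 1"
    define w where "w = real n powr a"
    have "B n = n / w\<^sup>2 / (1 - 2 * a)"
      using n by (simp add: B_def w_def powr_power powr_diff mult.commute)
    moreover have "w > 0" using n by (simp add: w_def)
    ultimately show "(growth a n / real n powr a)\<^sup>2 * (growth_sum a n / B n) * (1 / (1 - 2 * a))
      = (growth a n)\<^sup>2 / n * growth_sum a n"
      unfolding w_def[symmetric] using a by (simp add: power_divide)
  qed
  ultimately show ?thesis using C(1) by (auto intro: Lim_transform_eventually)
qed

text \<open>At this value of \<open>a\<close> the summands behave like \<open>1 / (C^2 * k)\<close>;
  this is where the logarithm in the critical normalisation comes from.\<close>

lemma growth_sum_critical: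
  "(\<lambda>n. (growth (1 / 2) n)\<^sup>2 / (n * ln n) * growth_sum (1 / 2) n) \<longlonglongrightarrow> 1"
proof -
  obtain C where C: "C > 0" "(\<lambda>n. growth (1 / 2) n / real n powr (1 / 2)) \<longlonglongrightarrow> C"
    using growth_asymptotics[of "1 / 2"] by auto
  define B where "B n = ln (real n)" for n :: nat
  have "(\<lambda>n::nat. real (n + 1) powr (- 2 * (1 / 2)) / (B (n + 1) - B n)) \<longlonglongrightarrow> 1"
    unfolding B_def by real_asymp
  from growth_inverse_square_limit[OF C this]
  have "(\<lambda>n. (growth_sum (1 / 2) (n + 1) - growth_sum (1 / 2) n) / (B (n + 1) - B n)) \<longlonglongrightarrow> 1 / C\<^sup>2"
    by (rule Lim_transform_eventually) (use growth_sum_Suc in \<open>auto intro!: eventually_sequentiallyI[of 2]\<close>)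
  moreover have "\<forall>\<^sub>F n in sequentially. B n < B (n + 1)"
    by (rule eventually_sequentiallyI[of 1]) (auto simp: B_def)
  moreover have "filterlim B at_top sequentially" unfolding B_def by real_asymp
  ultimately have "(\<lambda>n. growth_sum (1 / 2) n / B n) \<longlonglongrightarrow> 1 / C\<^sup>2" by (rule stolz_cesaro_top)
  then have "(\<lambda>n. (growth (1 / 2) n / real n powr (1 / 2))\<^sup>2 * (growth_sum (1 / 2) n / B n)) \<longlonglongrightarrow> C\<^sup>2 * (1 / C\<^sup>2)"
    by (intro tendsto_mult tendsto_power C)
  moreover have "(growth (1 / 2) n / real n powr (1 / 2))\<^sup>2 * (growth_sum (1 / 2) n / B n)
      = (growth (1 / 2) n)\<^sup>2 / (n * ln n) * growth_sum (1 / 2) n" for n :: nat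
    by (simp add: B_def powr_half_sqrt power_divide)
  ultimately show ?thesis using C(1) by simp
qed

section \<open>Variance remaining after time n in the supercritical case\<close>

definition growth_tail :: "real \<Rightarrow> nat \<Rightarrow> real" where
  "growth_tail a n = (\<Sum>k. 1 / (growth a (k + n + 1))\<^sup>2)"

context
  fixes a C :: real
  assumes a: "1 / 2 < a" and C: "C > 0" "(\<lambda>n. growth a n / real n powr a) \<longlonglongrightarrow> C"
begin

lemma growth_inverse_square_summable: "summable (\<lambda>k. 1 / (growth a (k + 1))\<^sup>2)"
proof (rule summable_comparison_test_ev)
  have "(\<lambda>n::nat. real (n + 1) powr (- 2 * a) / real (n + 1) powr (- 2 * a)) \<longlonglongrightarrow> 1"
    by (rule tendsto_eventually) auto
  from growth_inverse_square_limit[OF C this]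
  have "\<forall>\<^sub>F k in sequentially. 1 / (growth a (k + 1))\<^sup>2 / real (k + 1) powr (- 2 * a) < 1 / C\<^sup>2 + 1"
    by (rule order_tendstoD(2)) simp
  then show "\<forall>\<^sub>F k in sequentially. norm (1 / (growth a (k + 1))\<^sup>2) \<le> (1 / C\<^sup>2 + 1) * real (k + 1) powr (- 2 * a)"
  proof eventually_elim
    case (elim k)
    have "0 < real (k + 1) powr (- 2 * a)" by simp
    with elim have "1 / (growth a (k + 1))\<^sup>2 < (1 / C\<^sup>2 + 1) * real (k + 1) powr (- 2 * a)"
      by (simp only: pos_divide_less_eq)
    then show ?case by simp
  qed
  have "summable (\<lambda>k::nat. real k powr (- 2 * a))"
    using a by (subst summable_real_powr_iff) simp
  then have "summable (\<lambda>k. real (k + 1) powr (- 2 * a))" by (subst summable_iff_shift)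
  then show "summable (\<lambda>k. (1 / C\<^sup>2 + 1) * real (k + 1) powr (- 2 * a))" by (rule summable_mult)
qed

lemma growth_tail_eq: "growth_tail a n = (\<Sum>k. 1 / (growth a (k + 1))\<^sup>2) - (\<Sum>k<n. 1 / (growth a (k + 1))\<^sup>2)"
  using suminf_minus_initial_segment[OF growth_inverse_square_summable, of n]
  by (simp add: growth_tail_def)

lemma growth_tail_partial: "(\<lambda>m. \<Sum>k=n..<m. 1 / (growth a (k + 1))\<^sup>2) \<longlonglongrightarrow> growth_tail a n"
proof -
  let ?f = "\<lambda>k. 1 / (growth a (k + 1))\<^sup>2"
  have "(\<lambda>m. (\<Sum>k<m. ?f k) - (\<Sum>k<n. ?f k)) \<longlonglongrightarrow> growth_tail a n"
    unfolding growth_tail_eq by (intro tendsto_diff summable_LIMSEQ growth_inverse_square_summable tendsto_const)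
  then show ?thesis
  proof (rule Lim_transform_eventually)
    show "\<forall>\<^sub>F m in sequentially. (\<Sum>k<m. ?f k) - (\<Sum>k<n. ?f k) = (\<Sum>k=n..<m. ?f k)"
    proof (rule eventually_sequentiallyI[of n])
      fix m assume "n \<le> m"
      then show "(\<Sum>k<m. ?f k) - (\<Sum>k<n. ?f k) = (\<Sum>k=n..<m. ?f k)"
        using sum.atLeastLessThan_concat[of 0 n m ?f] by (simp add: lessThan_atLeast0)
    qed
  qed
qed

lemma growth_tail_zero: "growth_tail a \<longlonglongrightarrow> 0"
proof -
  have "(\<lambda>n. (\<Sum>k. 1 / (growth a (k + 1))\<^sup>2) - (\<Sum>k<n. 1 / (growth a (k + 1))\<^sup>2)) \<longlonglongrightarrow>
      (\<Sum>k. 1 / (growth a (k + 1))\<^sup>2) - (\<Sum>k. 1 / (growth a (k + 1))\<^sup>2)"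
    by (intro tendsto_diff summable_LIMSEQ growth_inverse_square_summable tendsto_const)
  then show ?thesis unfolding growth_tail_eq[abs_def] by simp
qed

text \<open>The tail and \<open>n powr (1 - 2 * a)\<close> both decrease to 0, so the vanishing form
  of the Stolz theorem applies. The factor \<open>C^2\<close> appears because \<open>W\<close> is
  asymptotically \<open>C\<close> times \<open>Z\<close>.\<close>

lemma growth_tail_supercritical:
  "(\<lambda>n. C\<^sup>2 * real n powr (2 * a - 1) * growth_tail a n) \<longlonglongrightarrow> 1 / (2 * a - 1)"
proof -
  define B where "B n = real n powr (1 - 2 * a) / (2 * a - 1)" for n :: nat
  have "(\<lambda>n::nat. real (n + 1) powr (- 2 * a) / (B n - B (n + 1))) \<longlonglongrightarrow> 1"
  proof -
    have "B n = - (real n powr (1 - 2 * a) / (1 - 2 * a))" for n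
      using a by (simp add: B_def field_simps)
    then show ?thesis using a by (simp only:) real_asymp
  qed
  from growth_inverse_square_limit[OF C this]
  have "(\<lambda>n. (growth_tail a (n + 1) - growth_tail a n) / (B (n + 1) - B n)) \<longlonglongrightarrow> 1 / C\<^sup>2"
  proof (rule Lim_transform_eventually)
    have "1 / (growth a (n + 1))\<^sup>2 / (B n - B (n + 1)) = (growth_tail a (n + 1) - growth_tail a n) / (B (n + 1) - B n)" for n
      unfolding growth_tail_eq by (simp add: divide_simps)
    then show "\<forall>\<^sub>F n in sequentially. 1 / (growth a (n + 1))\<^sup>2 / (B n - B (n + 1))
        = (growth_tail a (n + 1) - growth_tail a n) / (B (n + 1) - B n)" by simp
  qed
  moreover have "\<forall>\<^sub>F n in sequentially. B (n + 1) < B n"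
    by (rule eventually_sequentiallyI[of 1])
       (use a in \<open>auto simp: B_def intro!: divide_strict_right_mono powr_less_mono2_neg\<close>)
  moreover have "B \<longlonglongrightarrow> 0" unfolding B_def using a by real_asymp
  ultimately have "(\<lambda>n. growth_tail a n / B n) \<longlonglongrightarrow> 1 / C\<^sup>2"
    using growth_tail_zero by (rule stolz_cesaro_zero)
  then have "(\<lambda>n. C\<^sup>2 / (2 * a - 1) * (growth_tail a n / B n)) \<longlonglongrightarrow> C\<^sup>2 / (2 * a - 1) * (1 / C\<^sup>2)"
    by (rule tendsto_mult_left)
  moreover have "\<forall>\<^sub>F n in sequentially. C\<^sup>2 / (2 * a - 1) * (growth_tail a n / B n)
      = C\<^sup>2 * real n powr (2 * a - 1) * growth_tail a n"
  proof (rule eventually_sequentiallyI[of 1])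
    fix n :: nat assume n: "n \<ge> 1"
    have "B n = 1 / real n powr (2 * a - 1) / (2 * a - 1)"
      using n powr_minus_divide[of "real n" "2 * a - 1"] by (simp add: B_def)
    then show "C\<^sup>2 / (2 * a - 1) * (growth_tail a n / B n) = C\<^sup>2 * real n powr (2 * a - 1) * growth_tail a n"
      using a by simp
  qed
  ultimately show ?thesis using C(1) by (auto intro: Lim_transform_eventually)
qed

end

section \<open>The central limit theorem up to the critical case\<close>

text \<open>The approximant may depend on \<epsilon>, as the starting time of the iteration does.
  Its error is measured relative to \<open>v\<close>, the accumulated sum of squared arguments,
  whose limit is the same for all \<epsilon>.\<close>

lemma limit_by_approximation:
  fixes f :: "nat \<Rightarrow> complex" and V :: real
  assumes "\<And>\<epsilon>. \<epsilon> > 0 \<Longrightarrow> \<exists>z v. z \<longlonglongrightarrow> l \<and> v \<longlonglongrightarrow> V \<and> (\<forall>\<^sub>F n in sequentially. cmod (f n - z n) \<le> \<epsilon> * v n)"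
  shows "f \<longlonglongrightarrow> l"
proof (rule tendstoI)
  fix r :: real assume r: "r > 0"
  have V: "\<bar>V\<bar> + 1 > 0" by simp
  define \<epsilon> where "\<epsilon> = r / 2 / (\<bar>V\<bar> + 1)"
  have \<epsilon>: "\<epsilon> > 0" "\<epsilon> * (\<bar>V\<bar> + 1) = r / 2"
    using nonzero_eq_divide_eq[THEN iffD1, OF less_imp_neq[OF V, symmetric] \<epsilon>_def] r V
    by (simp add: \<epsilon>_def, blast)
  obtain z v where z: "z \<longlonglongrightarrow> l" and v: "v \<longlonglongrightarrow> V"
    and le: "\<forall>\<^sub>F n in sequentially. cmod (f n - z n) \<le> \<epsilon> * v n"
    using assms[OF \<epsilon>(1)] by blast
  have "\<forall>\<^sub>F n in sequentially. dist (z n) l < r / 2" by (rule tendstoD[OF z]) (use r in simp)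
  moreover have "\<forall>\<^sub>F n in sequentially. v n < \<bar>V\<bar> + 1" by (rule order_tendstoD(2)[OF v]) simp
  ultimately show "\<forall>\<^sub>F n in sequentially. dist (f n) l < r"
    using le
  proof eventually_elim
    case (elim n)
    have "\<epsilon> * v n \<le> \<epsilon> * (\<bar>V\<bar> + 1)" using elim(2) \<epsilon>(1) by (intro mult_left_mono) auto
    then have "dist (f n) (z n) \<le> r / 2" using elim(3) unfolding \<epsilon>(2) dist_norm by linarith
    then show ?case using dist_triangle[of "f n" l "z n"] elim(1) by linarith
  qed
qed

text \<open>Writing the law as a scaled standard normal makes the known characteristic function of
  the latter available.\<close>

lemma centered_normal_eq_distr:
  assumes "v > 0"
  shows "centered_normal v = distr std_normal_distribution borel (\<lambda>x. sqrt v * x)"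
proof -
  interpret N: prob_space std_normal_distribution by (rule prob_space_normal_density) simp
  have "distributed std_normal_distribution lborel (\<lambda>x. x) std_normal_density"
    unfolding distributed_def by (auto simp: distr_id2)
  from N.normal_density_affine[OF this _, of "sqrt v" 0] assms
  have "distributed std_normal_distribution lborel (\<lambda>x. sqrt v * x) (normal_density 0 (sqrt v))"
    by simp
  from distributed_distr_eq_density[OF this] show ?thesis
    using assms by (simp add: centered_normal_def cong: distr_cong)
qed

lemma real_distribution_centered_normal:
  assumes "v \<ge> 0"
  shows "real_distribution (centered_normal v)"
proof (cases "v = 0")
  case True
  then show ?thesis
    by (auto simp: centered_normal_def real_distribution_def real_distribution_axioms_def
        intro!: prob_space_return)
next
  case False
  then show ?thesis
    using assms prob_space.real_distribution_distr[OF prob_space_normal_density, of 1 "\<lambda>x. sqrt v * x" 0]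
    by (auto simp: centered_normal_eq_distr)
qed

lemma char_centered_normal:
  assumes "v \<ge> 0"
  shows "char (centered_normal v) t = of_real (exp (- (v * t\<^sup>2 / 2)))"
proof (cases "v = 0")
  case True
  then show ?thesis
    by (simp add: centered_normal_def char_def integral_return)
next
  case False
  then have "v > 0" using assms by simp
  have "char (centered_normal v) t = (CLINT x|std_normal_distribution. iexp (t * (sqrt v * x)))"
    unfolding centered_normal_eq_distr[OF \<open>v > 0\<close>] char_def by (subst integral_distr) auto
  also have "\<dots> = char std_normal_distribution (t * sqrt v)"
    by (simp add: char_def mult.assoc)
  finally show ?thesis
    using \<open>v > 0\<close> by (simp add: char_std_normal_distribution power_mult_distrib mult.commute)
qed

lemma (in prob_space) weak_conv_centered_normal:
  assumes Y: "\<And>n. Y n \<in> borel_measurable M" and "v \<ge> 0"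
    and lim: "\<And>t. (\<lambda>n. \<integral>w. iexp (t * Y n w) \<partial>M) \<longlonglongrightarrow> of_real (exp (- (v * t\<^sup>2 / 2)))"
  shows "weak_conv_m (\<lambda>n. distr M borel (Y n)) (centered_normal v)"
proof (rule levy_continuity)
  fix t
  have "char (distr M borel (Y n)) t = (\<integral>w. iexp (t * Y n w) \<partial>M)" for n
    unfolding char_def using Y[of n] by (subst integral_distr) auto
  then show "(\<lambda>n. char (distr M borel (Y n)) t) \<longlonglongrightarrow> char (centered_normal v) t"
    using lim char_centered_normal[OF \<open>v \<ge> 0\<close>] by simp
qed (use Y real_distribution_centered_normal[OF \<open>v \<ge> 0\<close>] in auto)

section \<open>Iteration of the one-step estimate\<close>

context square_integrable_walk
begin

lemma a_ge: "- 1 \<le> a"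
proof -
  have "(1 - 2 * p) * \<alpha> \<le> 1 * 1"
    using p_range alpha_range by (intro mult_mono) auto
  then show ?thesis by (simp add: a_def algebra_simps)
qed

lemma one_step_uniform:
  assumes "\<epsilon> > 0"
  obtains m \<delta> where "m \<ge> 2" "\<delta> > 0"
    "\<And>n s G. n \<ge> m \<Longrightarrow> \<bar>s\<bar> \<le> \<delta> \<Longrightarrow> G \<in> borel_measurable (F n) \<Longrightarrow> (\<And>w. cmod (G w) \<le> 1) \<Longrightarrow>
      cmod (char_fun G s (n + 1)
        - char_fun G (s * (1 + a / n)) n * exp (- (s\<^sup>2 * \<sigma>2 / 2))) \<le> \<epsilon> * s\<^sup>2"
proof -
  \<comment> \<open>Three groups of errors stay below this level: \<open>\<Lambda> s\<close>, the
    terms \<open>r n\<close> that are free of \<open>s\<close>, and the terms with a further power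
    of \<open>s\<close>.\<close>
  let ?e = "\<epsilon> / 4"
  define r where "r n = a\<^sup>2 / 2 * ((\<integral>w. (Q n w)\<^sup>2 \<partial>M) / (real n)\<^sup>2) + (\<integral>w. \<bar>R n w - \<sigma>2\<bar> \<partial>M) / 2" for n
  define w where "w n = \<sigma>2 * \<bar>a\<bar> / 2 * ((\<integral>w. \<bar>Q n w\<bar> \<partial>M) / n)" for n
  have "r \<longlonglongrightarrow> 0"
    unfolding r_def[abs_def]
    using tendsto_add[OF tendsto_mult_right_zero[OF Q_square_limit[OF a_less_1], of "a\<^sup>2 / 2"]
        tendsto_divide_zero[OF R_limit, of 2]] by simp
  moreover have "w \<longlonglongrightarrow> 0"
    unfolding w_def[abs_def] by (rule tendsto_mult_right_zero[OF Q_abs_limit[OF a_less_1]])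
  ultimately have "\<forall>\<^sub>F n in sequentially. r n < ?e \<and> w n < 1 \<and> n \<ge> 2"
    using assms by (intro eventually_conj order_tendstoD(2)[of r 0] order_tendstoD(2)[of w 0] eventually_ge_at_top) auto
  then obtain m where m: "\<And>n. n \<ge> m \<Longrightarrow> r n < ?e \<and> w n < 1 \<and> n \<ge> 2"
    unfolding eventually_sequentially by blast
  have "\<forall>\<^sub>F s in at 0. \<Lambda> s < ?e"
    using order_tendstoD(2)[OF Lambda_limit, of ?e] assms by simp
  then obtain d where d: "d > 0" "\<And>s. s \<noteq> 0 \<Longrightarrow> \<bar>s\<bar> < d \<Longrightarrow> \<Lambda> s < ?e"
    unfolding eventually_at by (auto simp: dist_real_def)
  \<comment> \<open>Once \<open>\<bar>s\<bar> \<le> 1\<close> and \<open>w n < 1\<close>, the last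
    group is at most \<open>b * \<bar>s\<bar>\<close>.\<close>
  define b where "b = 1 + \<sigma>2\<^sup>2 / 8"
  have b: "b \<ge> 1" by (simp add: b_def)
  define \<delta> where "\<delta> = min (d / 2) (min 1 (?e / b))"
  show thesis
  proof (rule that[of m \<delta>])
    show "m \<ge> 2" using m by blast
    show "\<delta> > 0" using d b assms by (simp add: \<delta>_def)
    fix n s and G :: "'a \<Rightarrow> complex"
    assume n: "n \<ge> m" and s: "\<bar>s\<bar> \<le> \<delta>" and G: "G \<in> borel_measurable (F n)" "\<And>w. cmod (G w) \<le> 1"
    have n1: "n \<ge> 1" using m[OF n] by simp
    have s1: "\<bar>s\<bar> < d" "\<bar>s\<bar> \<le> 1" "\<bar>s\<bar> \<le> ?e / b" using s d unfolding \<delta>_def by auto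
    have "\<Lambda> s \<le> ?e" using d(2)[of s] s1(1) Lambda_0 assms by (cases "s = 0") auto
    moreover have "\<bar>s\<bar> * w n + s\<^sup>2 * \<sigma>2\<^sup>2 / 8 \<le> ?e"
    proof -
      have "\<bar>s\<bar> * w n \<le> \<bar>s\<bar> * 1" using m[OF n] by (intro mult_left_mono) auto
      moreover have "\<bar>s\<bar> * \<bar>s\<bar> \<le> \<bar>s\<bar> * 1" using s1 by (intro mult_left_mono) auto
      then have "s\<^sup>2 * (\<sigma>2\<^sup>2 / 8) \<le> \<bar>s\<bar> * (\<sigma>2\<^sup>2 / 8)"
        by (intro mult_right_mono) (auto simp: power2_eq_square)
      moreover have "\<bar>s\<bar> * b \<le> ?e" using s1(3) b by (simp add: pos_le_divide_eq)
      ultimately show ?thesis by (simp add: b_def distrib_left)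
    qed
    moreover have "r n < ?e" using m[OF n] by simp
    ultimately have le: "\<Lambda> s + r n + (\<bar>s\<bar> * w n + s\<^sup>2 * \<sigma>2\<^sup>2 / 8) \<le> \<epsilon>" using assms by linarith
    have "cmod (char_fun G s (n + 1)
        - char_fun G (s * (1 + a / n)) n * exp (- (s\<^sup>2 * \<sigma>2 / 2)))
        \<le> s\<^sup>2 * (\<Lambda> s + r n + (\<bar>s\<bar> * w n + s\<^sup>2 * \<sigma>2\<^sup>2 / 8))"
      using one_step[OF n1 G, of s] by (simp add: r_def w_def add.assoc mult.assoc)
    also have "\<dots> \<le> s\<^sup>2 * \<epsilon>" using le by (intro mult_left_mono) auto
    finally show "cmod (char_fun G s (n + 1)
        - char_fun G (s * (1 + a / n)) n * exp (- (s\<^sup>2 * \<sigma>2 / 2))) \<le> \<epsilon> * s\<^sup>2"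
      by (simp only: mult.commute)
  qed
qed

abbreviation q :: "nat \<Rightarrow> real" where "q \<equiv> growth a"

abbreviation q_sum :: "nat \<Rightarrow> nat \<Rightarrow> real" where
  "q_sum n N \<equiv> \<Sum>k=n..<N. 1 / (q (k + 1))\<^sup>2"

lemma q_pos: "q n > 0" by (rule growth_pos[OF a_ge])

text \<open>The smallness condition starts at \<open>n + 1\<close> because the step from
  \<open>k - 1\<close> to \<open>k\<close> is expanded at \<open>\<tau> / q k\<close>. Start time
  and \<open>G\<close> remain free: the convergence up to the critical case starts at a fixed time
  with \<open>G = 1\<close>, the supercritical fluctuations at the running time with a factor that
  cancels \<open>Z n\<close>.\<close>

definition char_close :: "real \<Rightarrow> nat \<Rightarrow> real \<Rightarrow> bool" where
  "char_close \<epsilon> m \<delta> \<longleftrightarrow> (\<forall>n N \<tau> G. m \<le> n \<longrightarrow> n \<le> N \<longrightarrow> (\<forall>k. n < k \<longrightarrow> k \<le> N \<longrightarrow> \<bar>\<tau> / q k\<bar> \<le> \<delta>) \<longrightarrow>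
    G \<in> borel_measurable (F n) \<longrightarrow> (\<forall>w. cmod (G w) \<le> 1) \<longrightarrow>
    cmod (char_fun G (\<tau> / q N) N
      - char_fun G (\<tau> / q n) n * exp (- (\<sigma>2 / 2 * (\<tau>\<^sup>2 * q_sum n N))))
    \<le> \<epsilon> * (\<tau>\<^sup>2 * q_sum n N))"

lemma char_approx:
  assumes "\<epsilon> > 0"
  obtains m \<delta> where "m \<ge> 2" "\<delta> > 0" "char_close \<epsilon> m \<delta>"
proof -
  obtain m \<delta> where m: "m \<ge> 2" "\<delta> > 0"
    and one_step_bound: "\<And>n s G. n \<ge> m \<Longrightarrow> \<bar>s\<bar> \<le> \<delta> \<Longrightarrow> G \<in> borel_measurable (F n) \<Longrightarrow> (\<And>w. cmod (G w) \<le> 1) \<Longrightarrow>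
      cmod (char_fun G s (n + 1)
        - char_fun G (s * (1 + a / n)) n * exp (- (s\<^sup>2 * \<sigma>2 / 2))) \<le> \<epsilon> * s\<^sup>2"
    using one_step_uniform[OF assms] by blast
  show thesis
  proof (rule that[OF m], unfold char_close_def, intro allI impI)
    fix n N \<tau> and G :: "'a \<Rightarrow> complex"
    assume n: "m \<le> n" "n \<le> N" and small': "\<forall>k. n < k \<longrightarrow> k \<le> N \<longrightarrow> \<bar>\<tau> / q k\<bar> \<le> \<delta>"
      and G': "G \<in> borel_measurable (F n)" "\<forall>w. cmod (G w) \<le> 1"
    note small = small'[rule_format] and G = G'(1) G'(2)[rule_format]
    define e where "e N = char_fun G (\<tau> / q N) N" for N
    define v where "v N = \<tau>\<^sup>2 * q_sum n N" for N
    have "cmod (e N - e n * exp (- (\<sigma>2 / 2 * v N))) \<le> \<epsilon> * v N"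
      using n(2) small
    proof (induction N rule: dec_induct)
      case base
      then show ?case by (simp add: v_def)
    next
      case (step N)
      define s where "s = \<tau> / q (N + 1)"
      have N: "m \<le> N" "N \<ge> 2" using n step.hyps m by auto
      have v: "v (N + 1) = v N + s\<^sup>2"
        using step.hyps by (simp add: v_def s_def distrib_left power_divide)
      \<comment> \<open>The recursion of the products moves the argument exactly one index back, so
        the induction hypothesis applies with the same \<tau>.\<close>
      have sN: "s * (1 + a / N) = \<tau> / q N"
        using q_pos[of N] growth_factor_pos[OF a_ge N(2)]
        by (simp add: s_def growth_Suc[OF N(2), simplified])
      have "cmod (char_fun G s (N + 1)
        - char_fun G (s * (1 + a / N)) N * exp (- (s\<^sup>2 * \<sigma>2 / 2))) \<le> \<epsilon> * s\<^sup>2"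
        using step.prems[of "N + 1"] step.hyps
        by (intro one_step_bound N measurable_F_mono[OF G(1)] G(2)) (auto simp: s_def)
      then have 1: "cmod (e (N + 1) - e N * exp (- (s\<^sup>2 * \<sigma>2 / 2))) \<le> \<epsilon> * s\<^sup>2"
        unfolding sN unfolding e_def s_def[symmetric] .
      have "cmod (e N - e n * exp (- (\<sigma>2 / 2 * v N))) \<le> \<epsilon> * v N"
        by (rule step.IH) (use step.prems in auto)
      \<comment> \<open>Multiplying the old error by this factor does not enlarge it.\<close>
      moreover have "exp (- (s\<^sup>2 * \<sigma>2 / 2)) \<le> 1" using sigma2_nonneg by simp
      ultimately have "cmod (e N - e n * exp (- (\<sigma>2 / 2 * v N))) * exp (- (s\<^sup>2 * \<sigma>2 / 2)) \<le> \<epsilon> * v N * 1"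
        by (intro mult_mono) (auto intro: order_trans[OF norm_ge_zero])
      moreover have "e N * exp (- (s\<^sup>2 * \<sigma>2 / 2)) - e n * exp (- (\<sigma>2 / 2 * v (N + 1)))
         = (e N - e n * exp (- (\<sigma>2 / 2 * v N))) * of_real (exp (- (s\<^sup>2 * \<sigma>2 / 2)))"
      proof -
        have "- (\<sigma>2 / 2 * v (N + 1)) = - (\<sigma>2 / 2 * v N) + - (s\<^sup>2 * \<sigma>2 / 2)"
          unfolding v by (simp add: algebra_simps)
        then show ?thesis by (simp only: exp_add of_real_mult left_diff_distrib mult.assoc)
      qed
      ultimately have 2: "cmod (e N * exp (- (s\<^sup>2 * \<sigma>2 / 2)) - e n * exp (- (\<sigma>2 / 2 * v (N + 1)))) \<le> \<epsilon> * v N"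
        by (simp add: norm_mult)
      have "cmod (e (N + 1) - e n * exp (- (\<sigma>2 / 2 * v (N + 1)))) \<le> \<epsilon> * s\<^sup>2 + \<epsilon> * v N"
        using norm_triangle_mono[OF 1 2] by simp
      also have "\<epsilon> * s\<^sup>2 + \<epsilon> * v N = \<epsilon> * v (N + 1)" unfolding v by (simp add: distrib_left)
      finally show ?case by simp
    qed
    then show "cmod (char_fun G (\<tau> / q N) N
        - char_fun G (\<tau> / q n) n * exp (- (\<sigma>2 / 2 * (\<tau>\<^sup>2 * q_sum n N))))
      \<le> \<epsilon> * (\<tau>\<^sup>2 * q_sum n N)"
      by (simp only: e_def v_def)
  qed
qed

text \<open>The iteration starts at a fixed time \<open>m\<close> that depends only on the
  tolerance. Since \<open>\<tau> N\<close> tends to 0, the walk at time \<open>m\<close> is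
  forgotten in the limit, and \<open>\<eta>\<close> keeps all intermediate arguments in the range of
  the one-step estimate.\<close>

lemma char_limit:
  fixes \<tau> :: "nat \<Rightarrow> real"
  assumes V: "(\<lambda>N. (\<tau> N)\<^sup>2 * growth_sum a N) \<longlonglongrightarrow> V" and \<tau>: "\<tau> \<longlonglongrightarrow> 0"
    and \<eta>: "\<eta> \<longlonglongrightarrow> 0" "\<And>k N. 2 \<le> k \<Longrightarrow> k \<le> N \<Longrightarrow> \<bar>\<tau> N / q k\<bar> \<le> \<eta> N"
  shows "(\<lambda>N. \<integral>w. iexp (\<tau> N / q N * Q N w) \<partial>M) \<longlonglongrightarrow> of_real (exp (- (\<sigma>2 / 2 * V)))"
proof (rule limit_by_approximation)
  fix \<epsilon> :: real assume "\<epsilon> > 0"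
  obtain m \<delta> where m: "m \<ge> 2" "\<delta> > 0"
    and close: "char_close \<epsilon> m \<delta>"
    using char_approx[OF \<open>\<epsilon> > 0\<close>] by blast
  \<comment> \<open>The finitely many terms before \<open>m\<close> carry the vanishing factor
    \<open>(\<tau> N)^2\<close>, so the limit is still \<open>V\<close>.\<close>
  define v where "v N = (\<tau> N)\<^sup>2 * q_sum m N" for N
  have v: "v \<longlonglongrightarrow> V"
  proof (rule Lim_transform_eventually)
    have "(\<lambda>N. (\<tau> N)\<^sup>2 * growth_sum a N - (\<tau> N)\<^sup>2 * growth_sum a m) \<longlonglongrightarrow> V - 0\<^sup>2 * growth_sum a m"
      by (intro tendsto_diff V tendsto_mult tendsto_power \<tau> tendsto_const)
    then show "(\<lambda>N. (\<tau> N)\<^sup>2 * growth_sum a N - (\<tau> N)\<^sup>2 * growth_sum a m) \<longlonglongrightarrow> V" by simp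
    show "\<forall>\<^sub>F N in sequentially. (\<tau> N)\<^sup>2 * growth_sum a N - (\<tau> N)\<^sup>2 * growth_sum a m = v N"
    proof (rule eventually_sequentiallyI[of m])
      fix N assume "m \<le> N"
      then have "growth_sum a N = growth_sum a m + q_sum m N"
        unfolding growth_sum_def using m by (subst sum.atLeastLessThan_concat) auto
      then show "(\<tau> N)\<^sup>2 * growth_sum a N - (\<tau> N)\<^sup>2 * growth_sum a m = v N"
        by (simp add: v_def distrib_left)
    qed
  qed
  define e where "e N = (\<integral>w. iexp (\<tau> N / q m * Q m w) \<partial>M)" for N
  have "e \<longlonglongrightarrow> 1"
  proof -
    have "(\<lambda>N. e N - 1) \<longlonglongrightarrow> 0"
    proof (rule Lim_null_comparison)
      have "(\<lambda>N. \<bar>\<tau> N\<bar> * ((\<integral>w. \<bar>Q m w\<bar> \<partial>M) / q m)) \<longlonglongrightarrow> 0"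
        using tendsto_mult_left_zero[OF tendsto_rabs_zero[OF \<tau>]] .
      then show "(\<lambda>N. \<bar>\<tau> N\<bar> * ((\<integral>w. \<bar>Q m w\<bar> \<partial>M) / q m)) \<longlonglongrightarrow> 0" .
      show "\<forall>\<^sub>F N in sequentially. norm (e N - 1) \<le> \<bar>\<tau> N\<bar> * ((\<integral>w. \<bar>Q m w\<bar> \<partial>M) / q m)"
      proof (rule always_eventually, rule allI)
        fix N
        note [measurable] = Q_measurable[of m]
        have "cmod ((\<integral>w. iexp (\<tau> N / q m * Q m w) \<partial>M) - (\<integral>w. 1 \<partial>M)) \<le> (\<integral>w. \<bar>\<tau> N\<bar> / q m * \<bar>Q m w\<bar> \<partial>M)"
        proof (rule norm_integral_diff_le)
          show "integrable M (\<lambda>w. iexp (\<tau> N / q m * Q m w))"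
            by (rule integrable_const_bound[of _ 1]) auto
          show "cmod (iexp (\<tau> N / q m * Q m w) - 1) \<le> \<bar>\<tau> N\<bar> / q m * \<bar>Q m w\<bar>" for w
            using iexp_first_order[of "\<tau> N / q m * Q m w"] q_pos[of m] by (simp only: abs_mult abs_divide abs_of_pos)
        qed (use Q_integrable in auto)
        then show "norm (e N - 1) \<le> \<bar>\<tau> N\<bar> * ((\<integral>w. \<bar>Q m w\<bar> \<partial>M) / q m)"
          by (simp add: e_def prob_space)
      qed
    qed
    from tendsto_add[OF this tendsto_const[of 1]] show ?thesis by simp
  qed
  then have "(\<lambda>N. e N * of_real (exp (- (\<sigma>2 / 2 * v N)))) \<longlonglongrightarrow> 1 * of_real (exp (- (\<sigma>2 / 2 * V)))"
    by (intro tendsto_mult tendsto_of_real tendsto_exp tendsto_minus tendsto_mult_left v)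
  moreover have "\<forall>\<^sub>F N in sequentially. \<eta> N < \<delta> \<and> N \<ge> m"
    using m by (intro eventually_conj order_tendstoD(2)[OF \<eta>(1)] eventually_ge_at_top) auto
  then have "\<forall>\<^sub>F N in sequentially. cmod ((\<integral>w. iexp (\<tau> N / q N * Q N w) \<partial>M)
      - e N * of_real (exp (- (\<sigma>2 / 2 * v N)))) \<le> \<epsilon> * v N"
  proof eventually_elim
    case (elim N)
    have "cmod (char_fun (\<lambda>_. 1) (\<tau> N / q N) N
        - char_fun (\<lambda>_. 1) (\<tau> N / q m) m * exp (- (\<sigma>2 / 2 * v N))) \<le> \<epsilon> * v N"
      unfolding v_def
    proof (rule close[unfolded char_close_def, rule_format])
      show "\<bar>\<tau> N / q k\<bar> \<le> \<delta>" if "m < k" "k \<le> N" for k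
        using \<eta>(2)[of k N] that m elim by auto
    qed (use elim in auto)
    then show ?case by (simp add: e_def)
  qed
  ultimately show "\<exists>z v. z \<longlonglongrightarrow> of_real (exp (- (\<sigma>2 / 2 * V))) \<and> v \<longlonglongrightarrow> V \<and>
      (\<forall>\<^sub>F N in sequentially. cmod ((\<integral>w. iexp (\<tau> N / q N * Q N w) \<partial>M) - z N) \<le> \<epsilon> * v N)"
    using v unfolding mult_1 by blast
qed

text \<open>For a normalisation \<open>b\<close> and frequency \<open>t\<close>, the choice
  \<open>\<tau> N = t * b N * q N\<close> produces the argument \<open>t * b N\<close> at the final
  time. By \<open>growth_ratio_le\<close>, the earlier arguments are at most
  \<open>\<bar>t\<bar> * b N * max 1 (q N)\<close>.\<close>

lemma Q_weak_conv:
  fixes b :: "nat \<Rightarrow> real"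
  assumes v: "v \<ge> 0" and b: "\<And>n. b n \<ge> 0"
    and sum: "(\<lambda>n. (b n * q n)\<^sup>2 * growth_sum a n) \<longlonglongrightarrow> v"
    and small: "(\<lambda>n. b n * max 1 (q n)) \<longlonglongrightarrow> 0"
  shows "weak_conv_m (\<lambda>n. distr M borel (\<lambda>w. b n * Q n w)) (centered_normal (\<sigma>2 * v))"
proof (rule weak_conv_centered_normal)
  show "(\<lambda>w. b n * Q n w) \<in> borel_measurable M" for n using Q_measurable[of n] by measurable
  show "0 \<le> \<sigma>2 * v" using sigma2_nonneg v by simp
  fix t :: real
  have bound: "b n * q n / q k \<le> b n * max 1 (q n)" if "2 \<le> k" "k \<le> n" for k n
    using mult_left_mono[OF growth_ratio_le[OF a_ge that] b[of n]] by simp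
  have "(\<lambda>N. \<integral>w. iexp (t * (b N * q N) / q N * Q N w) \<partial>M) \<longlonglongrightarrow> of_real (exp (- (\<sigma>2 / 2 * (t\<^sup>2 * v))))"
  proof (rule char_limit)
    show "(\<lambda>N. (t * (b N * q N))\<^sup>2 * growth_sum a N) \<longlonglongrightarrow> t\<^sup>2 * v"
      using tendsto_mult_left[OF sum, of "t\<^sup>2"] by (simp add: power_mult_distrib mult.assoc)
    have "(\<lambda>N. b N * q N) \<longlonglongrightarrow> 0"
      by (rule tendsto_sandwich[OF _ _ tendsto_const small])
         (use b less_imp_le[OF q_pos] in \<open>auto intro!: always_eventually mult_left_mono mult_nonneg_nonneg\<close>)
    then show "(\<lambda>N. t * (b N * q N)) \<longlonglongrightarrow> 0" by (rule tendsto_mult_right_zero)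
    show "(\<lambda>n. \<bar>t\<bar> * (b n * max 1 (q n))) \<longlonglongrightarrow> 0" by (rule tendsto_mult_right_zero[OF small])
    show "\<bar>t * (b N * q N) / q k\<bar> \<le> \<bar>t\<bar> * (b N * max 1 (q N))" if "2 \<le> k" "k \<le> N" for k N
      using mult_left_mono[OF bound[OF that], of "\<bar>t\<bar>"] b[of N] q_pos[of N] q_pos[of k]
      by (simp add: abs_mult)
  qed
  moreover have "t * (b N * q N) / q N * x = t * (b N * x)" for N x using q_pos[of N] by simp
  ultimately have "(\<lambda>N. \<integral>w. iexp (t * (b N * Q N w)) \<partial>M) \<longlonglongrightarrow> of_real (exp (- (\<sigma>2 / 2 * (t\<^sup>2 * v))))"
    by (simp only:)
  then show "(\<lambda>n. \<integral>w. iexp (t * (b n * Q n w)) \<partial>M) \<longlonglongrightarrow> of_real (exp (- (\<sigma>2 * v * t\<^sup>2 / 2)))"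
    by (simp add: mult_ac)
qed

lemma subcritical_weak_conv:
  assumes "a < 1 / 2"
  shows "weak_conv_m (\<lambda>n. distr M borel (\<lambda>w. 1 / sqrt n * Q n w)) (centered_normal (\<sigma>2 / (1 - 2 * a)))"
proof -
  obtain C where C: "C > 0" "(\<lambda>n. q n / real n powr a) \<longlonglongrightarrow> C"
    using growth_asymptotics[OF a_ge] by blast
  have "weak_conv_m (\<lambda>n. distr M borel (\<lambda>w. 1 / sqrt n * Q n w)) (centered_normal (\<sigma>2 * (1 / (1 - 2 * a))))"
  proof (rule Q_weak_conv)
    show "(\<lambda>n. (1 / sqrt n * q n)\<^sup>2 * growth_sum a n) \<longlonglongrightarrow> 1 / (1 - 2 * a)"
      using growth_sum_subcritical[OF a_ge assms] by (simp add: power_divide)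
    \<comment> \<open>The product over \<open>sqrt n\<close> behaves like
      \<open>C * n powr (a - 1 / 2)\<close>, which vanishes since \<open>a\<close> is below one
      half.\<close>
    have "(\<lambda>n::nat. q n / real n powr a * (real n powr a / sqrt n)) \<longlonglongrightarrow> C * 0"
      by (intro tendsto_mult C) (use assms in real_asymp)
    then have 1: "(\<lambda>n. q n / sqrt n) \<longlonglongrightarrow> 0"
      by (rule Lim_transform_eventually[OF tendsto_eq_rhs]) (auto intro!: eventually_sequentiallyI[of 1])
    have 2: "(\<lambda>n::nat. 1 / sqrt n) \<longlonglongrightarrow> 0" by real_asymp
    have "max (1 / sqrt n) (q n / sqrt n) = 1 / sqrt n * max 1 (q n)" for n :: nat
      by (simp add: max_mult_distrib_left)
    then show "(\<lambda>n. 1 / sqrt n * max 1 (q n)) \<longlonglongrightarrow> 0" using tendsto_max[OF 2 1] by simp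
  qed (use assms in auto)
  then show ?thesis by simp
qed

lemma critical_weak_conv:
  assumes "a = 1 / 2"
  shows "weak_conv_m (\<lambda>n. distr M borel (\<lambda>w. 1 / sqrt (n * ln n) * Q n w)) (centered_normal \<sigma>2)"
proof -
  obtain C where C: "C > 0" "(\<lambda>n. q n / real n powr a) \<longlonglongrightarrow> C"
    using growth_asymptotics[OF a_ge] by blast
  have "weak_conv_m (\<lambda>n. distr M borel (\<lambda>w. 1 / sqrt (n * ln n) * Q n w)) (centered_normal (\<sigma>2 * 1))"
  proof (rule Q_weak_conv)
    \<comment> \<open>At \<open>n = 0\<close> and \<open>n = 1\<close> the product is 0, and the
      reciprocal of its root is then 0 as well.\<close>
    have nonneg: "0 \<le> real n * ln (real n)" for n :: nat by (cases "n = 0") auto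
    show "(\<lambda>n. (1 / sqrt (n * ln n) * q n)\<^sup>2 * growth_sum a n) \<longlonglongrightarrow> 1"
      using growth_sum_critical nonneg by (simp add: power_divide assms)
    show "0 \<le> 1 / sqrt (n * ln n)" for n :: nat using nonneg[of n] by simp
    have "(\<lambda>n::nat. q n / real n powr a * (real n powr a / sqrt (n * ln n))) \<longlonglongrightarrow> C * 0"
      by (intro tendsto_mult C) (unfold assms, real_asymp)
    then have 1: "(\<lambda>n. q n / sqrt (n * ln n)) \<longlonglongrightarrow> 0"
      by (rule Lim_transform_eventually[OF tendsto_eq_rhs]) (auto intro!: eventually_sequentiallyI[of 1])
    have 2: "(\<lambda>n::nat. 1 / sqrt (n * ln n)) \<longlonglongrightarrow> 0" by real_asymp
    have "max (1 / sqrt (n * ln n)) (q n / sqrt (n * ln n)) = 1 / sqrt (n * ln n) * max 1 (q n)" for n :: nat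
      using nonneg[of n] by (simp add: max_mult_distrib_left)
    then show "(\<lambda>n. 1 / sqrt (n * ln n) * max 1 (q n)) \<longlonglongrightarrow> 0" using tendsto_max[OF 2 1] by simp
  qed auto
  then show ?thesis by simp
qed

end

section \<open>The supercritical martingale\<close>

lemma cmod_iexp_diff_le: "cmod (iexp x - iexp y) \<le> \<bar>x - y\<bar>"
proof -
  have "iexp x = iexp (x - y) * iexp y" using iexp_add[of "x - y" y] by simp
  then have "iexp x - iexp y = (iexp (x - y) - 1) * iexp y" by (simp only: left_diff_distrib mult_1)
  then have "cmod (iexp x - iexp y) = cmod (iexp (x - y) - 1)" by (simp only: norm_mult norm_exp_i_times mult_1_right)
  then show ?thesis using iexp_first_order[of "x - y"] by simp
qed

context square_integrable_walk
begin

definition Z :: "nat \<Rightarrow> 'a \<Rightarrow> real" where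
  "Z n w = Q n w / q n"

lemma Z_measurable_F: "Z n \<in> borel_measurable (F n)"
  unfolding Z_def[abs_def] using Q_measurable_F[of n] by measurable

lemma Z_measurable: "Z n \<in> borel_measurable M"
  using Z_measurable_F by (rule measurable_F_M)

lemma Z_square: "integrable M (\<lambda>w. (Z n w)\<^sup>2)"
  unfolding Z_def power_divide using Q_square by simp

lemma Z_diff_measurable_F: "n \<le> N \<Longrightarrow> (\<lambda>w. Z N w - Z n w) \<in> borel_measurable (F N)"
  using Z_measurable_F[of N] measurable_F_mono[OF Z_measurable_F[of n]] by measurable

lemma Z_diff_measurable: "(\<lambda>w. Z N w - Z n w) \<in> borel_measurable M"
  using Z_measurable[of n] Z_measurable[of N] by measurable

lemma Z_diff_square: "integrable M (\<lambda>w. (Z N w - Z n w)\<^sup>2)"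
  using integrable_square_add[OF Z_measurable[of N] _ Z_square, of "\<lambda>w. - Z n w"] Z_measurable[of n] Z_square[of n]
  by simp

text \<open>The numerator is the centered step minus its conditional mean, hence a martingale
  difference. The index starts at 2 as the recursion of the products does.\<close>

lemma Z_Suc: "n \<ge> 2 \<Longrightarrow> Z (n + 1) w - Z n w = (X (n + 1) w - c - a / n * Q n w) / q (n + 1)"
proof -
  assume n: "n \<ge> 2"
  define u where "u = 1 + a / n"
  have u: "u > 0" using growth_factor_pos[OF a_ge n] by (simp add: u_def)
  have qn: "q (n + 1) = q n * u" using growth_Suc[OF n] by (simp add: u_def)
  have "Z (n + 1) w - Z n w = (Q (n + 1) w - u * Q n w) / q (n + 1)"
    unfolding Z_def qn using u q_pos[of n] by (simp add: field_simps)
  also have "Q (n + 1) w - u * Q n w = X (n + 1) w - c - a / n * Q n w"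
    unfolding Q_Suc u_def by (simp add: algebra_simps)
  finally show ?thesis .
qed

text \<open>The martingale property, tested against the past: \<open>G\<close> stays admissible at
  all later times, and the drift identity cancels each increment separately.\<close>

lemma Z_martingale:
  assumes n: "2 \<le> n" "n \<le> N" and G: "G \<in> borel_measurable (F n)" "integrable M (\<lambda>w. (G w)\<^sup>2)"
  shows "(\<integral>w. G w * (Z N w - Z n w) \<partial>M) = 0"
  using n(2)
proof (induction N rule: dec_induct)
  case (step N)
  have N: "N \<ge> 2" "N \<ge> 1" using step n by auto
  note GN = measurable_F_mono[OF G(1) step.hyps(1)]
  note GM = measurable_F_M[OF G(1)]
  have int: "integrable M (\<lambda>w. G w * (X (N + 1) w - c))" "integrable M (\<lambda>w. G w * Q N w)"
    using integrable_mult_of_squares[OF GM f_X_measurable[of "N + 1"] G(2) f_X_square[of "N + 1"]]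
      integrable_mult_of_squares[OF GM Q_measurable[of N] G(2) Q_square[of N]] by simp_all
  have "(\<integral>w. G w * (Z (N + 1) w - Z N w) \<partial>M)
      = (\<integral>w. (G w * (X (N + 1) w - c) - a / N * (G w * Q N w)) / q (N + 1) \<partial>M)"
    unfolding Z_Suc[OF N(1)] by (intro Bochner_Integration.integral_cong refl) (simp add: algebra_simps diff_divide_distrib)
  also have "\<dots> = ((\<integral>w. G w * (X (N + 1) w - c) \<partial>M) - a / N * (\<integral>w. G w * Q N w \<partial>M)) / q (N + 1)"
    using int by simp
  also have "\<dots> = 0"
    unfolding expectation_drift[OF N(2) GN G(2)] by simp
  finally have 0: "(\<integral>w. G w * (Z (N + 1) w - Z N w) \<partial>M) = 0" .
  have "(\<integral>w. G w * (Z (N + 1) w - Z n w) \<partial>M)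
      = (\<integral>w. G w * (Z (N + 1) w - Z N w) + G w * (Z N w - Z n w) \<partial>M)"
    by (simp add: algebra_simps)
  also have "\<dots> = 0"
    using 0 step.IH integrable_mult_of_squares[OF GM Z_diff_measurable G(2) Z_diff_square]
    by (subst Bochner_Integration.integral_add) auto
  finally show ?case by simp
qed simp

text \<open>Pythagoras for orthogonal martingale increments.\<close>

lemma Z_diff_square_split:
  assumes n: "2 \<le> n" "n \<le> k" "k \<le> N"
  shows "(\<integral>w. (Z N w - Z n w)\<^sup>2 \<partial>M) = (\<integral>w. (Z N w - Z k w)\<^sup>2 \<partial>M) + (\<integral>w. (Z k w - Z n w)\<^sup>2 \<partial>M)"
proof -
  have int: "integrable M (\<lambda>w. (Z k w - Z n w) * (Z N w - Z k w))"
    by (intro integrable_mult_of_squares Z_diff_measurable Z_diff_square)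
  have "(\<integral>w. (Z N w - Z n w)\<^sup>2 \<partial>M) = (\<integral>w. ((Z N w - Z k w)\<^sup>2 + (Z k w - Z n w)\<^sup>2)
      + 2 * ((Z k w - Z n w) * (Z N w - Z k w)) \<partial>M)"
    by (intro Bochner_Integration.integral_cong refl) (simp add: power2_eq_square algebra_simps)
  also have "\<dots> = (\<integral>w. (Z N w - Z k w)\<^sup>2 \<partial>M) + (\<integral>w. (Z k w - Z n w)\<^sup>2 \<partial>M)
      + 2 * (\<integral>w. (Z k w - Z n w) * (Z N w - Z k w) \<partial>M)"
    using int Z_diff_square by simp
  also have "(\<integral>w. (Z k w - Z n w) * (Z N w - Z k w) \<partial>M) = 0"
    by (rule Z_martingale) (use n Z_diff_measurable_F Z_diff_square in auto)
  finally show ?thesis by simp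
qed

lemma Z_increment_bound:
  obtains K where "K > 0" "\<And>n. n \<ge> 2 \<Longrightarrow> (\<integral>w. (Z (n + 1) w - Z n w)\<^sup>2 \<partial>M) \<le> K * (1 / (q (n + 1))\<^sup>2)"
proof -
  define K1 where "K1 = (\<integral>w. (\<xi> 1 w - c)\<^sup>2 + (- \<xi> 1 w - c)\<^sup>2 \<partial>M)"
  have K1: "0 \<le> K1" unfolding K1_def by (intro Bochner_Integration.integral_nonneg) auto
  obtain K2 where K2: "K2 > 0" "\<And>n. norm ((\<integral>w. (Q n w)\<^sup>2 \<partial>M) / (real n)\<^sup>2) \<le> K2"
    using convergent_imp_Bseq[OF convergentI[OF Q_square_limit[OF a_less_1]]] unfolding Bseq_def by blast
  show thesis
  \<comment> \<open>The doubled terms come from \<open>(u - v)^2 \<le> 2 * u^2 + 2 * v^2\<close>;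
    the summand 1 only ensures positivity.\<close>
  proof (rule that[of "2 * K1 + 2 * (a\<^sup>2 * K2) + 1"])
    show "0 < 2 * K1 + 2 * (a\<^sup>2 * K2) + 1" using K1 K2 by (simp add: add_nonneg_pos)
    fix n :: nat assume n: "n \<ge> 2"
    let ?f = "\<lambda>w. X (n + 1) w - c"
    have fX: "integrable M (\<lambda>w. (?f w)\<^sup>2)" "(\<integral>w. (?f w)\<^sup>2 \<partial>M) \<le> K1"
      using f_X_square[of "n + 1"] f_X_square_bound[of "n + 1"] by (simp_all add: K1_def)
    have "(\<integral>w. (Z (n + 1) w - Z n w)\<^sup>2 \<partial>M)
        \<le> (\<integral>w. (2 * (?f w)\<^sup>2 + 2 * (a\<^sup>2 / (real n)\<^sup>2 * (Q n w)\<^sup>2)) * (1 / (q (n + 1))\<^sup>2) \<partial>M)"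
    proof (rule integral_mono)
      fix w
      have "(u - v)\<^sup>2 \<le> 2 * u\<^sup>2 + 2 * v\<^sup>2" for u v :: real
        using zero_le_power2[of "u + v"] by (simp add: power2_eq_square algebra_simps)
      from this[of "?f w" "a / n * Q n w"]
      have "(?f w - a / n * Q n w)\<^sup>2 \<le> 2 * (?f w)\<^sup>2 + 2 * (a\<^sup>2 / (real n)\<^sup>2 * (Q n w)\<^sup>2)"
        by (simp add: power_mult_distrib power_divide)
      then show "(Z (n + 1) w - Z n w)\<^sup>2 \<le> (2 * (?f w)\<^sup>2 + 2 * (a\<^sup>2 / (real n)\<^sup>2 * (Q n w)\<^sup>2)) * (1 / (q (n + 1))\<^sup>2)"
        unfolding Z_Suc[OF n] power_divide by (simp add: divide_right_mono)
    qed (use fX Q_square Z_diff_square in auto)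
    also have "\<dots> = (2 * (\<integral>w. (?f w)\<^sup>2 \<partial>M) + 2 * (a\<^sup>2 * ((\<integral>w. (Q n w)\<^sup>2 \<partial>M) / (real n)\<^sup>2))) * (1 / (q (n + 1))\<^sup>2)"
      using fX Q_square by simp
    also have "\<dots> \<le> (2 * K1 + 2 * (a\<^sup>2 * K2) + 1) * (1 / (q (n + 1))\<^sup>2)"
    proof (rule mult_right_mono)
      have "a\<^sup>2 * ((\<integral>w. (Q n w)\<^sup>2 \<partial>M) / (real n)\<^sup>2) \<le> a\<^sup>2 * K2"
        using K2(2)[of n] by (intro mult_left_mono) auto
      then show "2 * (\<integral>w. (?f w)\<^sup>2 \<partial>M) + 2 * (a\<^sup>2 * ((\<integral>w. (Q n w)\<^sup>2 \<partial>M) / (real n)\<^sup>2)) \<le> 2 * K1 + 2 * (a\<^sup>2 * K2) + 1"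
        using fX(2) by linarith
    qed simp
    finally show "(\<integral>w. (Z (n + 1) w - Z n w)\<^sup>2 \<partial>M) \<le> (2 * K1 + 2 * (a\<^sup>2 * K2) + 1) * (1 / (q (n + 1))\<^sup>2)" .
  qed
qed

text \<open>Kolmogorov's maximal inequality, proved by decomposing at the first exceedance time.\<close>

lemma Z_maximal:
  assumes n: "2 \<le> n" "n \<le> N" and "\<epsilon> > 0"
  shows "prob {w \<in> space M. \<exists>k\<in>{n..N}. \<epsilon> \<le> \<bar>Z k w - Z n w\<bar>} \<le> (\<integral>w. (Z N w - Z n w)\<^sup>2 \<partial>M) / \<epsilon>\<^sup>2"
proof -
  \<comment> \<open>The event that \<open>k\<close> is the first time from \<open>n\<close> on at
    which the level is reached; it is decided by the past up to \<open>k\<close>.\<close>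
  define A where "A k = {w \<in> space M. \<epsilon> \<le> \<bar>Z k w - Z n w\<bar> \<and> (\<forall>j\<in>{n..<k}. \<not> \<epsilon> \<le> \<bar>Z j w - Z n w\<bar>)}" for k
  have AF: "A k \<in> sets (F k)" if "n \<le> k" for k
  proof -
    have P: "{w \<in> space (F k). \<epsilon> \<le> \<bar>Z j w - Z n w\<bar>} \<in> sets (F k)"
      "{w \<in> space (F k). \<not> \<epsilon> \<le> \<bar>Z j w - Z n w\<bar>} \<in> sets (F k)" if "j \<le> k" for j
    proof -
      note [measurable] = measurable_F_mono[OF Z_measurable_F \<open>n \<le> k\<close>] measurable_F_mono[OF Z_measurable_F that]
      show "{w \<in> space (F k). \<epsilon> \<le> \<bar>Z j w - Z n w\<bar>} \<in> sets (F k)"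
        "{w \<in> space (F k). \<not> \<epsilon> \<le> \<bar>Z j w - Z n w\<bar>} \<in> sets (F k)" by measurable
    qed
    have "{w \<in> space (F k). \<epsilon> \<le> \<bar>Z k w - Z n w\<bar> \<and> (\<forall>j\<in>{n..<k}. \<not> \<epsilon> \<le> \<bar>Z j w - Z n w\<bar>)} \<in> sets (F k)"
      by (intro sets.sets_Collect_conj sets.sets_Collect_finite_All P) auto
    then show ?thesis by (simp add: A_def)
  qed
  then have AM [measurable]: "A k \<in> sets M" if "k \<in> {n..N}" for k using sets_F_subset that by auto
  have disj: "disjoint_family_on A {n..N}"
    unfolding disjoint_family_on_def
  proof (intro ballI impI)
    fix i j assume "i \<in> {n..N}" "j \<in> {n..N}" "i \<noteq> j"
    then show "A i \<inter> A j = {}" unfolding A_def by (cases i j rule: linorder_cases) auto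
  qed
  have UN: "{w \<in> space M. \<exists>k\<in>{n..N}. \<epsilon> \<le> \<bar>Z k w - Z n w\<bar>} = (\<Union>k\<in>{n..N}. A k)"
  proof (intro equalityI subsetI)
    fix w assume "w \<in> {w \<in> space M. \<exists>k\<in>{n..N}. \<epsilon> \<le> \<bar>Z k w - Z n w\<bar>}"
    then obtain k where k: "k \<in> {n..N}" "\<epsilon> \<le> \<bar>Z k w - Z n w\<bar>" and w: "w \<in> space M" by auto
    define k0 where "k0 = (LEAST k. n \<le> k \<and> \<epsilon> \<le> \<bar>Z k w - Z n w\<bar>)"
    have "n \<le> k0 \<and> \<epsilon> \<le> \<bar>Z k0 w - Z n w\<bar>" unfolding k0_def by (rule LeastI[of _ k]) (use k in auto)
    moreover have "k0 \<le> k" unfolding k0_def by (rule Least_le) (use k in auto)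
    moreover have "\<not> \<epsilon> \<le> \<bar>Z j w - Z n w\<bar>" if "j \<in> {n..<k0}" for j
      using not_less_Least[of j "\<lambda>k. n \<le> k \<and> \<epsilon> \<le> \<bar>Z k w - Z n w\<bar>"] that unfolding k0_def by auto
    ultimately show "w \<in> (\<Union>k\<in>{n..N}. A k)" using k w by (intro UN_I[of k0]) (auto simp: A_def)
  qed (auto simp: A_def)
  define D where "D w = (Z N w - Z n w)\<^sup>2" for w
  have D: "integrable M D" "\<And>w. 0 \<le> D w" unfolding D_def using Z_diff_square by auto
  have DA: "integrable M (\<lambda>w. D w * indicator (A k) w)" if "k \<in> {n..N}" for k
    using integrable_real_mult_indicator[OF AM[OF that] D(1)] by (simp add: mult.commute)
  have le: "\<epsilon>\<^sup>2 * prob (A k) \<le> (\<integral>w. D w * indicator (A k) w \<partial>M)" if k: "k \<in> {n..N}" for k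
  proof -
    define G where "G w = (Z k w - Z n w) * indicator (A k) w" for w
    have G: "G \<in> borel_measurable (F k)"
      unfolding G_def using k
      by (intro borel_measurable_times Z_diff_measurable_F borel_measurable_indicator AF) auto
    have G2: "integrable M (\<lambda>w. (G w)\<^sup>2)"
    proof (rule Bochner_Integration.integrable_bound[OF Z_diff_square[of k n]])
      show "AE w in M. norm ((G w)\<^sup>2) \<le> norm ((Z k w - Z n w)\<^sup>2)"
        by (auto simp: G_def indicator_def)
    qed (use measurable_F_M[OF G] in measurable)
    have int: "integrable M (\<lambda>w. G w * (Z N w - Z k w))"
      by (intro integrable_mult_of_squares measurable_F_M[OF G] Z_diff_measurable Z_diff_square G2)
    have intA: "integrable M (\<lambda>w. \<epsilon>\<^sup>2 * indicator (A k) w)"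
      using AM[OF k] by (intro integrable_mult_right integrable_real_indicator) (auto simp: less_top[symmetric])
    \<comment> \<open>On \<open>A k\<close> the square of \<open>Z N - Z n\<close> is expanded
      around \<open>Z k\<close>, and the square of the later increment is dropped. The cross term
      has expectation 0, because \<open>G\<close> depends on the past up to \<open>k\<close>
      only.\<close>
    have "(\<integral>w. \<epsilon>\<^sup>2 * indicator (A k) w + 2 * (G w * (Z N w - Z k w)) \<partial>M) \<le> (\<integral>w. D w * indicator (A k) w \<partial>M)"
    proof (rule integral_mono[OF _ DA[OF k]])
      show "integrable M (\<lambda>w. \<epsilon>\<^sup>2 * indicator (A k) w + 2 * (G w * (Z N w - Z k w)))"
        using int intA by auto
      fix w
      show "\<epsilon>\<^sup>2 * indicator (A k) w + 2 * (G w * (Z N w - Z k w)) \<le> D w * indicator (A k) w"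
      proof (cases "w \<in> A k")
        case True
        then have "\<epsilon> \<le> \<bar>Z k w - Z n w\<bar>" by (simp add: A_def)
        then have "\<epsilon>\<^sup>2 \<le> (Z k w - Z n w)\<^sup>2" using \<open>\<epsilon> > 0\<close> by (simp add: abs_le_square_iff[symmetric])
        moreover have "D w = (Z N w - Z k w)\<^sup>2 + 2 * ((Z k w - Z n w) * (Z N w - Z k w)) + (Z k w - Z n w)\<^sup>2"
          unfolding D_def by (simp add: power2_eq_square algebra_simps)
        moreover have "0 \<le> (Z N w - Z k w)\<^sup>2" by simp
        ultimately have "\<epsilon>\<^sup>2 + 2 * ((Z k w - Z n w) * (Z N w - Z k w)) \<le> D w" by linarith
        then show ?thesis using True by (simp add: G_def)
      qed (simp add: G_def)
    qed
    also have "(\<integral>w. \<epsilon>\<^sup>2 * indicator (A k) w + 2 * (G w * (Z N w - Z k w)) \<partial>M)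
        = (\<integral>w. \<epsilon>\<^sup>2 * indicator (A k) w \<partial>M) + 2 * (\<integral>w. G w * (Z N w - Z k w) \<partial>M)"
      using int intA by (subst Bochner_Integration.integral_add) auto
    also have "(\<integral>w. G w * (Z N w - Z k w) \<partial>M) = 0"
      by (rule Z_martingale[OF _ _ G G2]) (use k n in auto)
    finally show ?thesis using AM[OF k] by simp
  qed
  have "\<epsilon>\<^sup>2 * prob (\<Union>k\<in>{n..N}. A k) = (\<Sum>k\<in>{n..N}. \<epsilon>\<^sup>2 * prob (A k))"
    by (subst finite_measure_finite_Union[OF _ _ disj]) (use AM in \<open>auto simp: sum_distrib_left\<close>)
  also have "\<dots> \<le> (\<Sum>k\<in>{n..N}. (\<integral>w. D w * indicator (A k) w \<partial>M))"
    by (intro sum_mono le)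
  also have "\<dots> = (\<integral>w. (\<Sum>k\<in>{n..N}. D w * indicator (A k) w) \<partial>M)"
    using DA by (subst Bochner_Integration.integral_sum) auto
  also have "\<dots> \<le> expectation D"
  proof (rule integral_mono[OF _ D(1)])
    show "integrable M (\<lambda>w. \<Sum>k\<in>{n..N}. D w * indicator (A k) w)"
      by (intro Bochner_Integration.integrable_sum DA)
    fix w
    have "(\<Sum>k\<in>{n..N}. D w * indicator (A k) w) = D w * indicator (\<Union>k\<in>{n..N}. A k) w"
      using disj by (simp add: indicator_UN_disjoint sum_distrib_left)
    also have "\<dots> \<le> D w * 1"
      using D(2)[of w] by (intro mult_left_mono) (auto simp: indicator_def)
    finally show "(\<Sum>k\<in>{n..N}. D w * indicator (A k) w) \<le> D w" by (simp only: mult_1_right)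
  qed
  finally show ?thesis
    unfolding UN D_def using \<open>\<epsilon> > 0\<close> by (simp add: field_simps)
qed

end

section \<open>The supercritical limit and the fluctuations around it\<close>

context square_integrable_walk
begin

text \<open>The factor \<open>q n\<close> cancels, leaving \<open>Q n\<close> over
  \<open>n powr a\<close>, the quantity whose almost sure limit is \<open>L\<close>. The product
  form displays a deterministic factor with limit \<open>C\<close> times the martingale.\<close>

definition W :: "nat \<Rightarrow> 'a \<Rightarrow> real" where
  "W n w = q n / real n powr a * Z n w"

lemma W_measurable: "W n \<in> borel_measurable M"
  unfolding W_def[abs_def] using Z_measurable[of n] by measurable

context
  fixes C :: real
  assumes supercritical: "1 / 2 < a"
    and C: "C > 0" "(\<lambda>n. q n / real n powr a) \<longlonglongrightarrow> C"
    and C_rate: "(\<lambda>n. sqrt n * (q n / real n powr a - C)) \<longlonglongrightarrow> 0"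
begin

lemmas tail_facts = growth_tail_partial[OF supercritical C] growth_tail_zero[OF supercritical C]
  growth_tail_supercritical[OF supercritical C]

text \<open>Orthogonality adds up the increment bounds, and the resulting partial sums stay below
  the tail, uniformly in \<open>N\<close>.\<close>

lemma Z_diff_bound:
  obtains K where "K > 0"
    "\<And>n N. 2 \<le> n \<Longrightarrow> n \<le> N \<Longrightarrow> (\<integral>w. (Z N w - Z n w)\<^sup>2 \<partial>M) \<le> K * growth_tail a n"
proof -
  obtain K where K: "K > 0" "\<And>n. n \<ge> 2 \<Longrightarrow> (\<integral>w. (Z (n + 1) w - Z n w)\<^sup>2 \<partial>M) \<le> K * (1 / (q (n + 1))\<^sup>2)"
    using Z_increment_bound by blast
  show thesis
  proof (rule that[OF K(1)])
    fix n N :: nat assume n: "2 \<le> n" "n \<le> N"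
    have "(\<integral>w. (Z N w - Z n w)\<^sup>2 \<partial>M) \<le> K * q_sum n N"
      using n(2)
    proof (induction N rule: dec_induct)
      case (step N)
      have "(\<integral>w. (Z (N + 1) w - Z n w)\<^sup>2 \<partial>M)
          = (\<integral>w. (Z (N + 1) w - Z N w)\<^sup>2 \<partial>M) + (\<integral>w. (Z N w - Z n w)\<^sup>2 \<partial>M)"
        by (rule Z_diff_square_split) (use n step in auto)
      also have "\<dots> \<le> K * (1 / (q (N + 1))\<^sup>2) + K * q_sum n N"
        using K(2)[of N] step n by (intro add_mono) auto
      also have "\<dots> = K * (\<Sum>k=n..<N + 1. 1 / (q (k + 1))\<^sup>2)"
        using step by (simp add: distrib_left)
      finally show ?case by simp
    qed simp
    also have "q_sum n N \<le> growth_tail a n"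
    proof (rule incseq_le[OF _ tail_facts(1)])
      show "incseq (\<lambda>m. \<Sum>k=n..<m. 1 / (q (k + 1))\<^sup>2)"
        by (intro incseq_SucI sum_mono2) auto
    qed
    then have "K * q_sum n N \<le> K * growth_tail a n"
      using K(1) by (intro mult_left_mono) auto
    finally show "(\<integral>w. (Z N w - Z n w)\<^sup>2 \<partial>M) \<le> K * growth_tail a n" .
  qed
qed

lemma Z_square_bounded:
  obtains B where "\<And>n. n \<ge> 2 \<Longrightarrow> (\<integral>w. (Z n w)\<^sup>2 \<partial>M) \<le> B"
proof -
  obtain K where K: "\<And>n N. 2 \<le> n \<Longrightarrow> n \<le> N \<Longrightarrow> (\<integral>w. (Z N w - Z n w)\<^sup>2 \<partial>M) \<le> K * growth_tail a n"
    using Z_diff_bound by blast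
  show thesis
  proof (rule that[of "2 * (K * growth_tail a 2) + 2 * (\<integral>w. (Z 2 w)\<^sup>2 \<partial>M)"])
    fix n :: nat assume n: "n \<ge> 2"
    have "(\<integral>w. (Z n w)\<^sup>2 \<partial>M) \<le> (\<integral>w. 2 * (Z n w - Z 2 w)\<^sup>2 + 2 * (Z 2 w)\<^sup>2 \<partial>M)"
    proof (rule integral_mono)
      fix w
      \<comment> \<open>This square is exactly the difference of the two sides of the inequality to
        be shown.\<close>
      have "0 \<le> (Z n w - 2 * Z 2 w)\<^sup>2" by simp
      then show "(Z n w)\<^sup>2 \<le> 2 * (Z n w - Z 2 w)\<^sup>2 + 2 * (Z 2 w)\<^sup>2"
        by (simp add: power2_eq_square algebra_simps)
    qed (use Z_square Z_diff_square in auto)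
    also have "\<dots> = 2 * (\<integral>w. (Z n w - Z 2 w)\<^sup>2 \<partial>M) + 2 * (\<integral>w. (Z 2 w)\<^sup>2 \<partial>M)"
      using Z_square Z_diff_square by simp
    finally show "(\<integral>w. (Z n w)\<^sup>2 \<partial>M) \<le> 2 * (K * growth_tail a 2) + 2 * (\<integral>w. (Z 2 w)\<^sup>2 \<partial>M)"
      using K[of 2 n] n by simp
  qed
qed

text \<open>Letting \<open>N\<close> tend to infinity in the maximal inequality bounds the
  probability that the path ever leaves the \<epsilon>-neighbourhood of its value at time
  \<open>m\<close> by a multiple of the tail. The bad event is contained in all of these events, so
  its probability is 0.\<close>

lemma Z_tail_small:
  assumes "\<epsilon> > 0"
  shows "AE w in M. \<exists>m. \<forall>k\<ge>m. \<bar>Z k w - Z m w\<bar> < \<epsilon>"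
proof -
  obtain K where K: "K > 0" "\<And>n N. 2 \<le> n \<Longrightarrow> n \<le> N \<Longrightarrow> (\<integral>w. (Z N w - Z n w)\<^sup>2 \<partial>M) \<le> K * growth_tail a n"
    using Z_diff_bound by blast
  note [measurable] = Z_measurable
  define E where "E m N = {w \<in> space M. \<exists>k\<in>{m..N}. \<epsilon> \<le> \<bar>Z k w - Z m w\<bar>}" for m N
  have E [measurable]: "E m N \<in> sets M" for m N unfolding E_def by measurable
  define B where "B = {w \<in> space M. \<forall>m. \<exists>k\<ge>m. \<epsilon> \<le> \<bar>Z k w - Z m w\<bar>}"
  have B [measurable]: "B \<in> sets M" unfolding B_def by measurable
  have le: "prob B \<le> K * growth_tail a m / \<epsilon>\<^sup>2" if m: "m \<ge> 2" for m
  proof -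
    have "(\<lambda>N. prob (E m N)) \<longlonglongrightarrow> prob (\<Union>N. E m N)"
    proof (rule finite_Lim_measure_incseq)
      show "incseq (E m)" unfolding incseq_def E_def by force
    qed (use E in auto)
    moreover have "prob (E m N) \<le> K * growth_tail a m / \<epsilon>\<^sup>2" if "N \<ge> m" for N
    proof -
      have "prob (E m N) \<le> (\<integral>w. (Z N w - Z m w)\<^sup>2 \<partial>M) / \<epsilon>\<^sup>2"
        unfolding E_def by (rule Z_maximal[OF m that assms])
      also have "\<dots> \<le> K * growth_tail a m / \<epsilon>\<^sup>2"
        by (intro divide_right_mono K(2) m that) auto
      finally show ?thesis .
    qed
    ultimately have "prob (\<Union>N. E m N) \<le> K * growth_tail a m / \<epsilon>\<^sup>2"
      by (intro LIMSEQ_le_const2[of "\<lambda>N. prob (E m N)"]) auto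
    moreover have "prob B \<le> prob (\<Union>N. E m N)"
    proof (rule finite_measure_mono)
      show "B \<subseteq> (\<Union>N. E m N)" unfolding B_def E_def by force
    qed measurable
    ultimately show ?thesis by linarith
  qed
  have "(\<lambda>m. K / \<epsilon>\<^sup>2 * growth_tail a m) \<longlonglongrightarrow> 0"
    by (rule tendsto_mult_right_zero[OF tail_facts(2)])
  then have "prob B \<le> 0"
    by (rule LIMSEQ_le_const) (use le in \<open>auto intro!: exI[of _ 2]\<close>)
  then have "prob B = 0" by (simp add: measure_le_0_iff)
  then have "AE w in M. w \<notin> B" using prob_eq_0[OF B] by simp
  then show ?thesis
    using AE_space
  proof eventually_elim
    case (elim w)
    then obtain m where "\<not> (\<exists>k\<ge>m. \<epsilon> \<le> \<bar>Z k w - Z m w\<bar>)" by (auto simp: B_def)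
    then show ?case by (meson linorder_not_le)
  qed
qed

lemma Z_convergent: "AE w in M. convergent (\<lambda>n. Z n w)"
proof -
  have "AE w in M. \<forall>i::nat. \<exists>m. \<forall>k\<ge>m. \<bar>Z k w - Z m w\<bar> < 1 / real (Suc i)"
    unfolding AE_all_countable by (intro allI Z_tail_small) simp
  then show ?thesis
  proof eventually_elim
    case (elim w)
    have "Cauchy (\<lambda>n. Z n w)"
    proof (rule metric_CauchyI)
      fix e :: real assume "e > 0"
      then obtain i :: nat where i: "1 / real (Suc i) < e / 2"
        using reals_Archimedean[of "e / 2"] by (auto simp: inverse_eq_divide)
      obtain m where m: "\<And>k. k \<ge> m \<Longrightarrow> \<bar>Z k w - Z m w\<bar> < 1 / real (Suc i)" using elim by blast
      have "dist (Z k w) (Z l w) < e" if "k \<ge> m" "l \<ge> m" for k l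
        using m[OF that(1)] m[OF that(2)] i unfolding dist_real_def by linarith
      then show "\<exists>m. \<forall>k\<ge>m. \<forall>l\<ge>m. dist (Z k w) (Z l w) < e" by blast
    qed
    then show ?case by (simp add: Cauchy_convergent_iff)
  qed
qed

lemma W_limit_iff: "(\<lambda>n. W n w) \<longlonglongrightarrow> l \<longleftrightarrow> (\<lambda>n. Z n w) \<longlonglongrightarrow> l / C"
proof
  assume "(\<lambda>n. W n w) \<longlonglongrightarrow> l"
  then have "(\<lambda>n. W n w / (q n / real n powr a)) \<longlonglongrightarrow> l / C"
    using C by (intro tendsto_divide) auto
  then show "(\<lambda>n. Z n w) \<longlonglongrightarrow> l / C"
  proof (rule Lim_transform_eventually, intro eventually_sequentiallyI[of 1])
    fix n :: nat assume "n \<ge> 1"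
    then show "W n w / (q n / real n powr a) = Z n w" using q_pos[of n] by (simp add: W_def)
  qed
next
  assume "(\<lambda>n. Z n w) \<longlonglongrightarrow> l / C"
  then have "(\<lambda>n. q n / real n powr a * Z n w) \<longlonglongrightarrow> C * (l / C)"
    by (intro tendsto_mult C)
  then show "(\<lambda>n. W n w) \<longlonglongrightarrow> l" using C(1) by (simp add: W_def)
qed

lemma W_limit_exists: "\<exists>L \<in> borel_measurable M. AE w in M. (\<lambda>n. W n w) \<longlonglongrightarrow> L w"
proof (intro bexI)
  show "(\<lambda>w. C * lim (\<lambda>n. Z n w)) \<in> borel_measurable M"
    using borel_measurable_lim_metric[OF Z_measurable] by measurable
  show "AE w in M. (\<lambda>n. W n w) \<longlonglongrightarrow> C * lim (\<lambda>n. Z n w)"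
    using Z_convergent unfolding W_limit_iff
    by eventually_elim (use C(1) in \<open>auto simp: convergent_LIMSEQ_iff\<close>)
qed

text \<open>Fatou's lemma for the squares of \<open>Z n\<close>, whose expectations are
  bounded.\<close>

lemma W_limit_square:
  assumes L: "L \<in> borel_measurable M" "AE w in M. (\<lambda>n. W n w) \<longlonglongrightarrow> L w"
  shows "integrable M (\<lambda>w. (L w)\<^sup>2)"
proof -
  note [measurable] = L(1) Z_measurable
  obtain B where B: "\<And>n. n \<ge> 2 \<Longrightarrow> (\<integral>w. (Z n w)\<^sup>2 \<partial>M) \<le> B"
    using Z_square_bounded by blast
  have bound: "(\<integral>\<^sup>+w. ennreal ((Z n w)\<^sup>2) \<partial>M) \<le> ennreal B" if "n \<ge> 2" for n
    by (subst nn_integral_eq_integral) (use Z_square B[OF that] in \<open>auto intro: ennreal_leI\<close>)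
  have "(\<integral>\<^sup>+w. ennreal ((L w / C)\<^sup>2) \<partial>M) = (\<integral>\<^sup>+w. liminf (\<lambda>n. ennreal ((Z n w)\<^sup>2)) \<partial>M)"
  proof (rule nn_integral_cong_AE)
    show "AE w in M. ennreal ((L w / C)\<^sup>2) = liminf (\<lambda>n. ennreal ((Z n w)\<^sup>2))"
      using L(2)
    proof eventually_elim
      case (elim w)
      then have "(\<lambda>n. Z n w) \<longlonglongrightarrow> L w / C" by (simp only: W_limit_iff)
      then have "(\<lambda>n. ennreal ((Z n w)\<^sup>2)) \<longlonglongrightarrow> ennreal ((L w / C)\<^sup>2)"
        by (intro tendsto_ennrealI tendsto_power)
      then show ?case by (intro lim_imp_Liminf[symmetric]) auto
    qed
  qed
  also have "\<dots> \<le> liminf (\<lambda>n. \<integral>\<^sup>+w. ennreal ((Z n w)\<^sup>2) \<partial>M)"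
    by (rule nn_integral_liminf) measurable
  also have "\<dots> \<le> limsup (\<lambda>n. \<integral>\<^sup>+w. ennreal ((Z n w)\<^sup>2) \<partial>M)"
    by (rule Liminf_le_Limsup) simp
  also have "\<dots> \<le> ennreal B"
    by (rule Limsup_bounded) (use bound in \<open>auto intro: eventually_sequentiallyI\<close>)
  finally have "(\<integral>\<^sup>+w. ennreal ((L w / C)\<^sup>2) \<partial>M) < \<infinity>"
    by (rule order.strict_trans1) simp
  then have "integrable M (\<lambda>w. (L w / C)\<^sup>2)"
    by (intro integrableI_nonneg) auto
  then have "integrable M (\<lambda>w. C\<^sup>2 * (L w / C)\<^sup>2)" by (rule integrable_mult_right)
  then show ?thesis using C(1) by (simp add: power_divide)
qed

text \<open>The estimate between times \<open>n\<close> and \<open>N\<close> is passed to the limit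
  in \<open>N\<close>, using dominated convergence on one side and the partial sums of the tail on
  the other.\<close>

lemma char_tail_approx:
  assumes L: "L \<in> borel_measurable M" "AE w in M. (\<lambda>n. W n w) \<longlonglongrightarrow> L w" and "\<epsilon> > 0"
  obtains m \<delta> where "m \<ge> 2" "\<delta> > 0"
    "\<And>n \<tau>. m \<le> n \<Longrightarrow> \<bar>\<tau> / q n\<bar> \<le> \<delta> \<Longrightarrow>
      cmod ((\<integral>w. iexp (\<tau> * (L w / C - Z n w)) \<partial>M) - exp (- (\<sigma>2 / 2 * (\<tau>\<^sup>2 * growth_tail a n))))
        \<le> \<epsilon> * (\<tau>\<^sup>2 * growth_tail a n)"
proof -
  obtain m \<delta> where m: "m \<ge> 2" "\<delta> > 0"
    and close: "char_close \<epsilon> m \<delta>"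
    using char_approx[OF \<open>\<epsilon> > 0\<close>] by blast
  show thesis
  proof (rule that[OF m])
    fix n and \<tau> :: real assume n: "m \<le> n" and small: "\<bar>\<tau> / q n\<bar> \<le> \<delta>"
    define v where "v N = \<tau>\<^sup>2 * q_sum n N" for N
    have v: "v \<longlonglongrightarrow> \<tau>\<^sup>2 * growth_tail a n"
      unfolding v_def[abs_def] by (intro tendsto_mult_left tail_facts(1))
    \<comment> \<open>This factor removes the value at time \<open>n\<close>: the characteristic
      function at the start of the iteration becomes 1, and the one at the end belongs to the
      increment of \<open>Z\<close>.\<close>
    define G where "G w = iexp (- (\<tau> * Z n w))" for w
    have G: "G \<in> borel_measurable (F n)" "cmod (G w) \<le> 1" for w
    proof -
      note [measurable] = Z_measurable_F[of n]
      show "G \<in> borel_measurable (F n)" unfolding G_def[abs_def] by measurable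
    qed (simp add: G_def)
    have GZ: "G w * iexp (\<tau> / q N * Q N w) = iexp (\<tau> * (Z N w - Z n w))" for N w
      unfolding G_def iexp_add[symmetric] by (simp add: Z_def algebra_simps)
    have bound: "cmod ((\<integral>w. iexp (\<tau> * (Z N w - Z n w)) \<partial>M) - exp (- (\<sigma>2 / 2 * v N))) \<le> \<epsilon> * v N"
      if "n \<le> N" for N
    proof -
      have small_k: "\<bar>\<tau> / q k\<bar> \<le> \<delta>" if "n < k" for k
      proof -
        \<comment> \<open>For positive \<open>a\<close> the products increase, so smallness of the
          argument at time \<open>n\<close> implies it at all later times.\<close>
        have "q n \<le> q k" by (rule growth_mono) (use supercritical n m that in auto)
        then have "\<bar>\<tau>\<bar> / q k \<le> \<bar>\<tau>\<bar> / q n" using q_pos by (intro divide_left_mono) auto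
        then show ?thesis using small q_pos[of n] q_pos[of k] by (simp add: abs_divide)
      qed
      have "cmod (char_fun G (\<tau> / q N) N - char_fun G (\<tau> / q n) n * exp (- (\<sigma>2 / 2 * v N))) \<le> \<epsilon> * v N"
        unfolding v_def
        by (rule close[unfolded char_close_def, rule_format]) (use n that small_k G in auto)
      then show ?thesis unfolding GZ by (simp add: prob_space)
    qed
    have lim: "(\<lambda>N. \<integral>w. iexp (\<tau> * (Z N w - Z n w)) \<partial>M) \<longlonglongrightarrow> (\<integral>w. iexp (\<tau> * (L w / C - Z n w)) \<partial>M)"
    proof (rule integral_dominated_convergence[where w = "\<lambda>_. 1"])
      note [measurable] = L(1) Z_measurable
      show "(\<lambda>w. iexp (\<tau> * (L w / C - Z n w))) \<in> borel_measurable M"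
        "(\<lambda>w. iexp (\<tau> * (Z N w - Z n w))) \<in> borel_measurable M" for N by measurable
      show "AE w in M. (\<lambda>N. iexp (\<tau> * (Z N w - Z n w))) \<longlonglongrightarrow> iexp (\<tau> * (L w / C - Z n w))"
        using L(2)
      proof eventually_elim
        case (elim w)
        then have "(\<lambda>n. Z n w) \<longlonglongrightarrow> L w / C" by (simp only: W_limit_iff)
        then show ?case by (intro tendsto_intros)
      qed
    qed auto
    show "cmod ((\<integral>w. iexp (\<tau> * (L w / C - Z n w)) \<partial>M) - exp (- (\<sigma>2 / 2 * (\<tau>\<^sup>2 * growth_tail a n))))
        \<le> \<epsilon> * (\<tau>\<^sup>2 * growth_tail a n)"
    proof (rule tendsto_le[OF sequentially_bot])
      show "(\<lambda>N. \<epsilon> * v N) \<longlonglongrightarrow> \<epsilon> * (\<tau>\<^sup>2 * growth_tail a n)" by (rule tendsto_mult_left[OF v])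
      show "(\<lambda>N. cmod ((\<integral>w. iexp (\<tau> * (Z N w - Z n w)) \<partial>M) - exp (- (\<sigma>2 / 2 * v N))))
          \<longlonglongrightarrow> cmod ((\<integral>w. iexp (\<tau> * (L w / C - Z n w)) \<partial>M) - exp (- (\<sigma>2 / 2 * (\<tau>\<^sup>2 * growth_tail a n))))"
        by (intro tendsto_norm tendsto_diff lim tendsto_of_real tendsto_exp tendsto_minus tendsto_mult_left v)
      show "\<forall>\<^sub>F N in sequentially. cmod ((\<integral>w. iexp (\<tau> * (Z N w - Z n w)) \<partial>M) - exp (- (\<sigma>2 / 2 * v N))) \<le> \<epsilon> * v N"
        using bound by (rule eventually_sequentiallyI)
    qed
  qed
qed

lemma char_tail_limit:
  fixes \<tau> :: "nat \<Rightarrow> real"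
  assumes L: "L \<in> borel_measurable M" "AE w in M. (\<lambda>n. W n w) \<longlonglongrightarrow> L w"
    and V: "(\<lambda>n. (\<tau> n)\<^sup>2 * growth_tail a n) \<longlonglongrightarrow> V" and small: "(\<lambda>n. \<tau> n / q n) \<longlonglongrightarrow> 0"
  shows "(\<lambda>n. \<integral>w. iexp (\<tau> n * (L w / C - Z n w)) \<partial>M) \<longlonglongrightarrow> of_real (exp (- (\<sigma>2 / 2 * V)))"
proof (rule limit_by_approximation)
  fix \<epsilon> :: real assume "\<epsilon> > 0"
  obtain m \<delta> where m: "m \<ge> 2" "\<delta> > 0" and
    approx: "\<And>n \<tau>. m \<le> n \<Longrightarrow> \<bar>\<tau> / q n\<bar> \<le> \<delta> \<Longrightarrow>
      cmod ((\<integral>w. iexp (\<tau> * (L w / C - Z n w)) \<partial>M) - exp (- (\<sigma>2 / 2 * (\<tau>\<^sup>2 * growth_tail a n))))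
        \<le> \<epsilon> * (\<tau>\<^sup>2 * growth_tail a n)"
    using char_tail_approx[OF L \<open>\<epsilon> > 0\<close>] by blast
  have "(\<lambda>n. complex_of_real (exp (- (\<sigma>2 / 2 * ((\<tau> n)\<^sup>2 * growth_tail a n))))) \<longlonglongrightarrow> of_real (exp (- (\<sigma>2 / 2 * V)))"
    by (intro tendsto_of_real tendsto_exp tendsto_minus tendsto_mult_left V)
  moreover have "\<forall>\<^sub>F n in sequentially. \<bar>\<tau> n / q n\<bar> < \<delta> \<and> n \<ge> m"
    using m by (intro eventually_conj order_tendstoD(2)[OF tendsto_rabs_zero[OF small]] eventually_ge_at_top) auto
  then have "\<forall>\<^sub>F n in sequentially. cmod ((\<integral>w. iexp (\<tau> n * (L w / C - Z n w)) \<partial>M)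
      - exp (- (\<sigma>2 / 2 * ((\<tau> n)\<^sup>2 * growth_tail a n)))) \<le> \<epsilon> * ((\<tau> n)\<^sup>2 * growth_tail a n)"
    by eventually_elim (rule approx; simp)
  ultimately show "\<exists>z v. z \<longlonglongrightarrow> of_real (exp (- (\<sigma>2 / 2 * V))) \<and> v \<longlonglongrightarrow> V \<and>
      (\<forall>\<^sub>F n in sequentially. cmod ((\<integral>w. iexp (\<tau> n * (L w / C - Z n w)) \<partial>M) - z n) \<le> \<epsilon> * v n)"
    using V by blast
qed

text \<open>The identity \<open>W n - L = C * (Z n - L / C) + (q n / n powr a - C) * Z n\<close>
  separates the martingale tail, which yields the normal law, from a normalisation error, which
  \<open>C_rate\<close> and the mean square bound on \<open>Z\<close> remove.\<close>

lemma supercritical_weak_conv: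
  assumes L: "L \<in> borel_measurable M" "AE w in M. (\<lambda>n. W n w) \<longlonglongrightarrow> L w"
  shows "weak_conv_m (\<lambda>n. distr M borel (\<lambda>w. sqrt (real n powr (2 * a - 1)) * (W n w - L w)))
    (centered_normal (\<sigma>2 / (2 * a - 1)))"
proof (rule weak_conv_centered_normal)
  note [measurable] = L(1) Z_measurable W_measurable
  define b where "b n = sqrt (real n powr (2 * a - 1))" for n :: nat
  show "(\<lambda>w. sqrt (real n powr (2 * a - 1)) * (W n w - L w)) \<in> borel_measurable M" for n by measurable
  show "0 \<le> \<sigma>2 / (2 * a - 1)" using sigma2_nonneg supercritical by simp
  fix t :: real
  have b2: "(b n)\<^sup>2 = real n powr (2 * a - 1)" for n by (simp add: b_def)
  \<comment> \<open>The argument is chosen so that \<open>- (t * C * b n) * (L / C - Z n)\<close>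
    equals \<open>t * b n * (C * Z n - L)\<close>.\<close>
  have main: "(\<lambda>n. \<integral>w. iexp (- (t * C * b n) * (L w / C - Z n w)) \<partial>M)
      \<longlonglongrightarrow> of_real (exp (- (\<sigma>2 / 2 * (t\<^sup>2 * (1 / (2 * a - 1))))))"
  proof (rule char_tail_limit[OF L])
    show "(\<lambda>n. (- (t * C * b n))\<^sup>2 * growth_tail a n) \<longlonglongrightarrow> t\<^sup>2 * (1 / (2 * a - 1))"
      using tendsto_mult_left[OF tail_facts(3), of "t\<^sup>2"]
      by (simp only: power2_minus power_mult_distrib b2 mult.assoc)
    have "(\<lambda>n::nat. b n / real n powr a) \<longlonglongrightarrow> 0"
      unfolding b_def using supercritical by real_asymp
    from tendsto_divide[OF this C(2)] C(1)
    have "(\<lambda>n. - (t * C) * (b n / real n powr a / (q n / real n powr a))) \<longlonglongrightarrow> 0"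
      by (intro tendsto_mult_right_zero) simp
    then show "(\<lambda>n. - (t * C * b n) / q n) \<longlonglongrightarrow> 0"
    proof (rule Lim_transform_eventually, intro eventually_sequentiallyI[of 1])
      fix n :: nat assume "n \<ge> 1"
      then show "- (t * C) * (b n / real n powr a / (q n / real n powr a)) = - (t * C * b n) / q n" by simp
    qed
  qed
  obtain B where B: "\<And>n. n \<ge> 2 \<Longrightarrow> (\<integral>w. (Z n w)\<^sup>2 \<partial>M) \<le> B"
    using Z_square_bounded by blast
  define d where "d n = q n / real n powr a - C" for n
  have "(\<lambda>n. b n * d n) \<longlonglongrightarrow> 0"
  proof (rule Lim_null_comparison[OF _ tendsto_rabs_zero[OF C_rate]])
    show "\<forall>\<^sub>F n in sequentially. norm (b n * d n) \<le> \<bar>sqrt n * (q n / real n powr a - C)\<bar>"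
    proof (rule eventually_sequentiallyI[of 1])
      fix n :: nat assume n: "n \<ge> 1"
      \<comment> \<open>Here \<open>a < 1\<close> makes the normalisation at most
        \<open>sqrt n\<close>, the factor for which the rate of the products is known.\<close>
      have "real n powr (2 * a - 1) \<le> real n powr 1" using n a_less_1 by (intro powr_mono) auto
      then have "b n \<le> sqrt n" using n by (simp add: b_def)
      moreover have "0 \<le> b n" by (simp add: b_def)
      ultimately show "norm (b n * d n) \<le> \<bar>sqrt n * (q n / real n powr a - C)\<bar>"
        by (simp add: d_def abs_mult mult_right_mono)
    qed
  qed
  then have err: "(\<lambda>n. \<bar>t\<bar> * \<bar>b n * d n\<bar> * sqrt B) \<longlonglongrightarrow> 0"
    by (intro tendsto_mult_left_zero tendsto_mult_right_zero tendsto_rabs_zero)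
  have "(\<lambda>n. (\<integral>w. iexp (t * (b n * (W n w - L w))) \<partial>M)
      - (\<integral>w. iexp (- (t * C * b n) * (L w / C - Z n w)) \<partial>M)) \<longlonglongrightarrow> 0"
  proof (rule Lim_null_comparison[OF _ err], rule eventually_sequentiallyI[of 2])
    fix n :: nat assume n: "n \<ge> 2"
    have Zint: "integrable M (Z n)" by (rule square_integrable_imp_integrable[OF Z_measurable Z_square])
    have "norm ((\<integral>w. iexp (t * (b n * (W n w - L w))) \<partial>M)
      - (\<integral>w. iexp (- (t * C * b n) * (L w / C - Z n w)) \<partial>M)) \<le> (\<integral>w. \<bar>t\<bar> * \<bar>b n * d n\<bar> * \<bar>Z n w\<bar> \<partial>M)"
    proof (rule norm_integral_diff_le)
      show "integrable M (\<lambda>w. iexp (t * (b n * (W n w - L w))))"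
        "integrable M (\<lambda>w. iexp (- (t * C * b n) * (L w / C - Z n w)))"
        by (rule integrable_const_bound[of _ 1]; force)+
      show "integrable M (\<lambda>w. \<bar>t\<bar> * \<bar>b n * d n\<bar> * \<bar>Z n w\<bar>)" using Zint by simp
      fix w
      have "t * (b n * (W n w - L w)) - - (t * C * b n) * (L w / C - Z n w) = t * (b n * d n) * Z n w"
      proof -
        have "C * (L w / C) = L w" using C(1) by simp
        moreover have "t * (b n * (W n w - l)) - - (t * C * b n) * (x - Z n w) = t * (b n * d n) * Z n w"
          if "C * x = l" for x l
          unfolding W_def d_def that[symmetric] by (simp add: algebra_simps)
        ultimately show ?thesis by blast
      qed
      then show "norm (iexp (t * (b n * (W n w - L w))) - iexp (- (t * C * b n) * (L w / C - Z n w)))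
          \<le> \<bar>t\<bar> * \<bar>b n * d n\<bar> * \<bar>Z n w\<bar>"
        using cmod_iexp_diff_le[of "t * (b n * (W n w - L w))" "- (t * C * b n) * (L w / C - Z n w)"]
        by (simp only: abs_mult)
    qed
    also have "\<dots> = \<bar>t\<bar> * \<bar>b n * d n\<bar> * (\<integral>w. \<bar>Z n w\<bar> \<partial>M)" by simp
    also have "\<dots> \<le> \<bar>t\<bar> * \<bar>b n * d n\<bar> * sqrt B"
    proof (rule mult_left_mono)
      show "(\<integral>w. \<bar>Z n w\<bar> \<partial>M) \<le> sqrt B"
        using expectation_abs_le_sqrt[OF Z_measurable Z_square, of n] real_sqrt_le_mono[OF B[OF n]] by linarith
    qed simp
    finally show "norm ((\<integral>w. iexp (t * (b n * (W n w - L w))) \<partial>M)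
      - (\<integral>w. iexp (- (t * C * b n) * (L w / C - Z n w)) \<partial>M)) \<le> \<bar>t\<bar> * \<bar>b n * d n\<bar> * sqrt B" .
  qed
  from tendsto_add[OF this main]
  have "(\<lambda>n. \<integral>w. iexp (t * (b n * (W n w - L w))) \<partial>M) \<longlonglongrightarrow> of_real (exp (- (\<sigma>2 / 2 * (t\<^sup>2 * (1 / (2 * a - 1))))))"
    by simp
  then show "(\<lambda>n. \<integral>w. iexp (t * (sqrt (real n powr (2 * a - 1)) * (W n w - L w))) \<partial>M)
      \<longlonglongrightarrow> of_real (exp (- (\<sigma>2 / (2 * a - 1) * t\<^sup>2 / 2)))"
    unfolding b_def by (simp add: mult_ac)
qed

end

end

(* If \<alpha> = 1 then every X_n is plus or minus \<xi> 1, and the limit law is a mixture of normal laws,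
   which is normal only if \<bar>\<xi> 1\<bar> is almost surely constant; hence the assumption alpha_one. *)
theorem theorem4:
  fixes M :: "'a measure"
    and \<xi> \<gamma> \<rho> X T :: "nat \<Rightarrow> 'a \<Rightarrow> real"
    and U :: "nat \<Rightarrow> 'a \<Rightarrow> nat"
    and p \<alpha> a \<mu>1 \<mu>2 \<sigma>2 :: real
    and W :: "nat \<Rightarrow> 'a \<Rightarrow> real"
  assumes walk: "step_reinforced_walk M \<xi> U \<gamma> \<rho> p \<alpha> X"
    and square_integrable: "integrable M (\<lambda>\<omega>. (\<xi> 1 \<omega>)\<^sup>2)"
    and alpha_one: "\<alpha> = 1 \<Longrightarrow> \<exists>c. AE \<omega> in M. \<bar>\<xi> 1 \<omega>\<bar> = c"
  defines "T \<equiv> \<lambda>n \<omega>. \<Sum>k=1..n. X k \<omega>"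
    and "a \<equiv> (2 * p - 1) * \<alpha>"
    and "\<mu>1 \<equiv> integral\<^sup>L M (\<xi> 1)"
    and "\<mu>2 \<equiv> integral\<^sup>L M (\<lambda>\<omega>. (\<xi> 1 \<omega>)\<^sup>2)"
    and "\<sigma>2 \<equiv> \<mu>2 - (1 - \<alpha>)\<^sup>2 * \<mu>1\<^sup>2 / (1 - a)\<^sup>2"
    and "W \<equiv> \<lambda>n \<omega>. real n powr (1 - a) * (T n \<omega> / real n - (1 - \<alpha>) * \<mu>1 / (1 - a))"
  shows
    "(- 1 \<le> a \<and> a < 1 / 2 \<longrightarrow>
        weak_conv_m
          (\<lambda>n. distr M borel
            (\<lambda>\<omega>. sqrt (real n) * (T n \<omega> / real n - (1 - \<alpha>) * \<mu>1 / (1 - a))))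
          (centered_normal (\<sigma>2 / (1 - 2 * a)))) \<and>
     (a = 1 / 2 \<longrightarrow>
        weak_conv_m
          (\<lambda>n. distr M borel
            (\<lambda>\<omega>. sqrt (real n) / sqrt (ln (real n)) * (T n \<omega> / real n - 2 * (1 - \<alpha>) * \<mu>1)))
          (centered_normal (\<mu>2 - 4 * \<mu>1\<^sup>2 * (1 - \<alpha>)\<^sup>2))) \<and>
     (1 / 2 < a \<and> a < 1 \<longrightarrow>
        (\<exists>L \<in> borel_measurable M. AE \<omega> in M. (\<lambda>n. W n \<omega>) \<longlonglongrightarrow> L \<omega>) \<and>
        (\<forall>L \<in> borel_measurable M. (AE \<omega> in M. (\<lambda>n. W n \<omega>) \<longlonglongrightarrow> L \<omega>) \<longrightarrow>
           integrable M (\<lambda>\<omega>. (L \<omega>)\<^sup>2) \<and>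
           weak_conv_m
             (\<lambda>n. distr M borel (\<lambda>\<omega>. sqrt (real n powr (2 * a - 1)) * (W n \<omega> - L \<omega>)))
             (centered_normal (\<sigma>2 / (2 * a - 1)))))"
proof -
  let ?c = "(1 - \<alpha>) * \<mu>1 / (1 - a)"
  \<comment> \<open>All three regimes satisfy \<open>a < 1\<close>, so each of them can interpret
    the locale.\<close>
  have walk_locale: "square_integrable_walk M \<xi> U \<gamma> \<rho> p \<alpha> X" if "a < 1"
    using walk square_integrable alpha_one that
    by (simp add: square_integrable_walk_def square_integrable_walk_axioms_def a_def)
  have params: "square_integrable_walk.a p \<alpha> = a" "square_integrable_walk.c M \<xi> p \<alpha> = ?c"
      "square_integrable_walk.\<sigma>2 M \<xi> p \<alpha> = \<sigma>2"
      "walk_drift.Q X (\<lambda>x. x - ?c) n w = T n w - n * ?c" if "a < 1" for n w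
  proof -
    interpret S: square_integrable_walk M \<xi> U \<gamma> \<rho> p \<alpha> X by (rule walk_locale[OF that])
    show a: "S.a = a" by (simp add: S.a_def a_def)
    show c: "S.c = ?c" by (simp add: S.c_def S.\<mu>1_def \<mu>1_def a)
    show "S.\<sigma>2 = \<sigma>2"
      by (simp add: S.\<sigma>2_def S.\<mu>2_def \<mu>2_def \<sigma>2_def c power_divide power_mult_distrib)
    show "walk_drift.Q X (\<lambda>x. x - ?c) n w = T n w - n * ?c"
      using S.Q_def[of n w] by (simp add: c T_def sum_subtractf)
  qed
  show ?thesis
  proof (intro conjI impI)
    assume a: "- 1 \<le> a \<and> a < 1 / 2"
    then have a1: "a < 1" by simp
    interpret S: square_integrable_walk M \<xi> U \<gamma> \<rho> p \<alpha> X by (rule walk_locale[OF a1])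
    \<comment> \<open>At \<open>n = 0\<close> both sides are 0, because division by 0 yields
      0.\<close>
    have "1 / sqrt n * (T n w - n * ?c) = sqrt n * (T n w / n - ?c)" for n w
    proof (cases "n = 0")
      case False
      then have "sqrt n / n = 1 / sqrt n" by (simp add: real_div_sqrt field_simps)
      moreover have "sqrt n * (T n w / n - ?c) = sqrt n / n * (T n w - n * ?c)"
        using False by (simp add: field_simps)
      ultimately show ?thesis by simp
    qed simp
    then show "weak_conv_m (\<lambda>n. distr M borel (\<lambda>w. sqrt n * (T n w / n - ?c)))
        (centered_normal (\<sigma>2 / (1 - 2 * a)))"
      using S.subcritical_weak_conv a unfolding params[OF a1] by simp
  next
    assume a: "a = 1 / 2"
    then have a1: "a < 1" by simp
    interpret S: square_integrable_walk M \<xi> U \<gamma> \<rho> p \<alpha> X by (rule walk_locale[OF a1])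
    have c: "?c = 2 * (1 - \<alpha>) * \<mu>1" by (simp add: a)
    have "1 / sqrt (n * ln n) * (T n w - n * ?c) = sqrt n / sqrt (ln n) * (T n w / n - ?c)" for n w
    proof (cases "n = 0")
      case False
      then have "sqrt n / n = 1 / sqrt n" by (simp add: real_div_sqrt field_simps)
      moreover have "sqrt n / sqrt (ln n) * (T n w / n - ?c) = sqrt n / n * (T n w - n * ?c) / sqrt (ln n)"
        using False by (simp add: field_simps)
      ultimately show ?thesis by (simp add: real_sqrt_mult)
    qed simp
    note eq = this
    have \<sigma>2: "\<sigma>2 = \<mu>2 - 4 * \<mu>1\<^sup>2 * (1 - \<alpha>)\<^sup>2"
      by (simp add: \<sigma>2_def a power_divide)
    have "S.a = 1 / 2" using params(1)[OF a1] a by (rule trans)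
    from S.critical_weak_conv[OF this]
    show "weak_conv_m (\<lambda>n. distr M borel (\<lambda>w. sqrt n / sqrt (ln n) * (T n w / n - 2 * (1 - \<alpha>) * \<mu>1)))
        (centered_normal (\<mu>2 - 4 * \<mu>1\<^sup>2 * (1 - \<alpha>)\<^sup>2))"
      unfolding params[OF a1] eq unfolding c \<sigma>2 .
  next
    assume a: "1 / 2 < a \<and> a < 1"
    then have a1: "a < 1" by simp
    interpret S: square_integrable_walk M \<xi> U \<gamma> \<rho> p \<alpha> X by (rule walk_locale[OF a1])
    obtain C where C: "C > 0" "(\<lambda>n. growth S.a n / real n powr S.a) \<longlonglongrightarrow> C"
        "(\<lambda>n. sqrt n * (growth S.a n / real n powr S.a - C)) \<longlonglongrightarrow> 0"
      using growth_asymptotics[OF S.a_ge] by blast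
    have sa: "1 / 2 < S.a" using a params(1)[OF a1] by simp
    \<comment> \<open>For positive \<open>n\<close> this is
      \<open>n powr (1 - a) / n = 1 / n powr a\<close>; at \<open>n = 0\<close> both sides are 0,
      since a power of base 0 is 0.\<close>
    have W: "S.W n w = W n w" for n w
    proof (cases "n = 0")
      case False
      have "S.W n w = S.Q n w / real n powr a"
        using S.q_pos[of n] by (simp add: S.W_def S.Z_def params(1)[OF a1])
      also have "\<dots> = W n w"
        using False unfolding params(2,4)[OF a1] by (simp add: W_def powr_diff field_simps)
      finally show ?thesis .
    qed (simp add: S.W_def W_def)
    show "\<exists>L \<in> borel_measurable M. AE w in M. (\<lambda>n. W n w) \<longlonglongrightarrow> L w"
      using S.W_limit_exists[OF sa C] unfolding W .
    show "\<forall>L \<in> borel_measurable M. (AE w in M. (\<lambda>n. W n w) \<longlonglongrightarrow> L w) \<longrightarrow>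
           integrable M (\<lambda>w. (L w)\<^sup>2) \<and>
           weak_conv_m
             (\<lambda>n. distr M borel (\<lambda>w. sqrt (real n powr (2 * a - 1)) * (W n w - L w)))
             (centered_normal (\<sigma>2 / (2 * a - 1)))"
      using S.W_limit_square[OF sa C] S.supercritical_weak_conv[OF sa C]
      unfolding W params(1,3)[OF a1] by blast
  qed
qed

end
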